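(* Let $N\in\{1,2,3\}$, $d\ge3$, $\lambda>0$, $\mu_1,\dots,\mu_d>0$ and $b_{ij}=b_{ji}>0$ for $i\ne j$, and consider the system $$-\Delta u_i+\lambda u_i=\mu_i u_i^3+u_i\sum_{j\ne i}b_{ij}u_j^2,\qquad u_i\in H^1(\mathbb{R}^N;\mathbb{R}),\quad i=1,\ldots,d$$ (that is, $\lambda_1=\cdots=\lambda_d=\lambda$). Suppose that $$\alpha:=\min_{1\le i\le d}\Big(\min_{j\ne i}b_{ij}-\mu_i\Big)>0$$ and $$\max_{\substack{1\le i\le d\\ j,k\neq i,\ k\ne j}}|b_{ij}-b_{ik}|<\frac{\alpha}{d-2}.$$ Then $G=G^*$, i.e. all ground states of the system are fully nontrivial.
   Context: Let $1\le N\le 3$, $\lambda_i,\mu_i>0$ for $i=1,\dots,d$, and $b_{ij}=b_{ji}>0$ for $i\neq j$. Consider the system $-\Delta u_i+\lambda_i u_i=\mu_i u_i^3+u_i\sum_{j\neq i}b_{ij}u_j^2$ in $\mathbb{R}^N$, $u_i\in H^1(\mathbb{R}^N;\mathbb{R})$, $i=1,\dots,d$. Its solutions are the critical points of the $C^2$ functional $I_d:(H^1(\mathbb{R}^N))^d\to\mathbb{R}$, $$I_d(\mathbf{u})=\frac12\sum_{i=1}^d\int(|\nabla u_i|^2+\lambda_i u_i^2)-\frac14\sum_{i=1}^d\mu_i\int u_i^4-\frac12\sum_{i<j}b_{ij}\int u_i^2u_j^2 .$$ The ground state level is $c=\inf\{I_d(\mathbf{u}):\mathbf{u}\ne\mathbf{0},\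 I_d'(\mathbf{u})=0\}$, and a ground state is an element of $G=\{\mathbf{u}:\mathbf{u}\neq\mathbf{0},\ I_d'(\mathbf{u})=0,\ I_d(\mathbf{u})=c\}$. $G^*=\{\mathbf{u}\in G: u_i\not\equiv0\text{ for every } i=1,\dots,d\}$ is the set of fully nontrivial ground states. *)

theory Defs
  imports "HOL-Analysis.Analysis"
begin

primrec C_k :: "nat \<Rightarrow> ('a::euclidean_space \<Rightarrow> real) \<Rightarrow> bool" where
  "C_k 0 f \<longleftrightarrow> continuous_on UNIV f"
| "C_k (Suc k) f \<longleftrightarrow> (\<forall>x. f differentiable (at x)) \<and>
     (\<forall>e\<in>Basis. C_k k (\<lambda>x. frechet_derivative f (at x) e))"

definition test_function :: "('a::euclidean_space \<Rightarrow> real) \<Rightarrow> bool" where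
  "test_function \<phi> \<longleftrightarrow> (\<forall>k. C_k k \<phi>) \<and> compact (closure {x. \<phi> x \<noteq> 0})"

definition square_integrable :: "('a::euclidean_space \<Rightarrow> 'b::euclidean_space) \<Rightarrow> bool" where
  "square_integrable f \<longleftrightarrow>
     f \<in> borel_measurable lborel \<and> integrable lborel (\<lambda>x. (norm (f x))\<^sup>2)"

definition weak_gradient :: "('a::euclidean_space \<Rightarrow> real) \<Rightarrow> ('a \<Rightarrow> 'a) \<Rightarrow> bool" where
  "weak_gradient u g \<longleftrightarrow>
     (\<forall>\<phi>. test_function \<phi> \<longrightarrow> (\<forall>e\<in>Basis.
        (\<integral>x. u x * frechet_derivative \<phi> (at x) e \<partial>lborel) = - (\<integral>x. (g x \<bullet> e) * \<phi> x \<partial>lborel)))"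

text \<open>Elements of the Sobolev space are Borel representatives. Functions that agree almost
  everywhere are not identified, so every statement that a function vanishes has to be read
  almost everywhere.\<close>

definition H1 :: "('a::euclidean_space \<Rightarrow> real) set" where
  "H1 = {u. square_integrable u \<and> (\<exists>g. square_integrable g \<and> weak_gradient u g)}"

text \<open>A square integrable weak gradient is unique up to a null set, so the integrals below
  do not depend on the choice.\<close>

definition grad :: "('a::euclidean_space \<Rightarrow> real) \<Rightarrow> 'a \<Rightarrow> 'a" where
  "grad u = (SOME g. square_integrable g \<and> weak_gradient u g)"

definition H1_vec :: "('d \<Rightarrow> 'a::euclidean_space \<Rightarrow> real) set" where
  "H1_vec = {u. \<forall>i. u i \<in> H1}"

definition H1_norm :: "('d::finite \<Rightarrow> 'a::euclidean_space \<Rightarrow> real) \<Rightarrow> real" where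
  "H1_norm u = sqrt (\<Sum>i\<in>UNIV. \<integral>x. (norm (grad (u i) x))\<^sup>2 + (u i x)\<^sup>2 \<partial>lborel)"

text \<open>Frechet differentiability at \<open>u\<close>, with derivative \<open>L\<close>, of a functional \<open>J\<close> on
  \<open>H1_vec\<close>. It is spelled out because \<open>H1_vec\<close> is a set of representatives rather than a
  normed type; only the values of \<open>J\<close> and \<open>L\<close> on \<open>H1_vec\<close> are relevant.\<close>

definition has_H1_derivative ::
  "(('d::finite \<Rightarrow> 'a::euclidean_space \<Rightarrow> real) \<Rightarrow> real) \<Rightarrow>
   (('d \<Rightarrow> 'a \<Rightarrow> real) \<Rightarrow> real) \<Rightarrow> ('d \<Rightarrow> 'a \<Rightarrow> real) \<Rightarrow> bool" where
  "has_H1_derivative J L u \<longleftrightarrow>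
     (\<forall>v\<in>H1_vec. \<forall>w\<in>H1_vec. L (\<lambda>i x. v i x + w i x) = L v + L w) \<and>
     (\<forall>r. \<forall>v\<in>H1_vec. L (\<lambda>i x. r * v i x) = r * L v) \<and>
     (\<exists>K. \<forall>v\<in>H1_vec. \<bar>L v\<bar> \<le> K * H1_norm v) \<and>
     (\<forall>\<epsilon>>0. \<exists>\<delta>>0. \<forall>v\<in>H1_vec. H1_norm v < \<delta> \<longrightarrow>
        \<bar>J (\<lambda>i x. u i x + v i x) - J u - L v\<bar> \<le> \<epsilon> * H1_norm v)"

text \<open>The components are indexed by a finite type \<open>'d\<close>. Its linear order only serves to
  write the sum over \<open>i < j\<close>. The diagonal entries of \<open>b\<close> are never used.\<close>

definition energy ::
  "('d::{finite,linorder} \<Rightarrow> real) \<Rightarrow> ('d \<Rightarrow> real) \<Rightarrow> ('d \<Rightarrow> 'd \<Rightarrow> real) \<Rightarrow>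
   ('d \<Rightarrow> 'a::euclidean_space \<Rightarrow> real) \<Rightarrow> real" where
  "energy lam \<mu> b u =
     1/2 * (\<Sum>i\<in>UNIV. \<integral>x. (norm (grad (u i) x))\<^sup>2 + lam i * (u i x)\<^sup>2 \<partial>lborel)
     - 1/4 * (\<Sum>i\<in>UNIV. \<mu> i * (\<integral>x. (u i x)^4 \<partial>lborel))
     - 1/2 * (\<Sum>(i, j)\<in>{(i, j). i < j}. b i j * (\<integral>x. (u i x)\<^sup>2 * (u j x)\<^sup>2 \<partial>lborel))"

definition nontrivial_solutions ::
  "('d::{finite,linorder} \<Rightarrow> real) \<Rightarrow> ('d \<Rightarrow> real) \<Rightarrow> ('d \<Rightarrow> 'd \<Rightarrow> real) \<Rightarrow>
   ('d \<Rightarrow> 'a::euclidean_space \<Rightarrow> real) set" where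
  "nontrivial_solutions lam \<mu> b =
     {u \<in> H1_vec. \<not> (\<forall>i. AE x in lborel. u i x = 0) \<and>
        has_H1_derivative (energy lam \<mu> b) (\<lambda>_. 0) u}"

text \<open>The infimum of the energy on \<open>nontrivial_solutions\<close>, which is bounded below by \<open>0\<close>
  in dimension at most three when \<open>lam\<close>, \<open>\<mu>\<close> and \<open>b\<close> are positive. The space dimension
  is not determined by the parameters and enters through a type argument.\<close>

definition ground_level ::
  "'a::euclidean_space itself \<Rightarrow> ('d::{finite,linorder} \<Rightarrow> real) \<Rightarrow> ('d \<Rightarrow> real) \<Rightarrow>
   ('d \<Rightarrow> 'd \<Rightarrow> real) \<Rightarrow> real" where
  "ground_level T lam \<mu> b =
     (INF u\<in>(nontrivial_solutions lam \<mu> b :: ('d \<Rightarrow> 'a \<Rightarrow> real) set). energy lam \<mu> b u)"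

definition ground_states ::
  "('d::{finite,linorder} \<Rightarrow> real) \<Rightarrow> ('d \<Rightarrow> real) \<Rightarrow> ('d \<Rightarrow> 'd \<Rightarrow> real) \<Rightarrow>
   ('d \<Rightarrow> 'a::euclidean_space \<Rightarrow> real) set" where
  "ground_states lam \<mu> b =
     {u \<in> nontrivial_solutions lam \<mu> b. energy lam \<mu> b u = ground_level TYPE('a) lam \<mu> b}"

definition fully_nontrivial_ground_states ::
  "('d::{finite,linorder} \<Rightarrow> real) \<Rightarrow> ('d \<Rightarrow> real) \<Rightarrow> ('d \<Rightarrow> 'd \<Rightarrow> real) \<Rightarrow>
   ('d \<Rightarrow> 'a::euclidean_space \<Rightarrow> real) set" where
  "fully_nontrivial_ground_states lam \<mu> b =
     {u \<in> ground_states lam \<mu> b. \<forall>i. \<not> (AE x in lborel. u i x = 0)}"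

end

theory Submission
  imports Defs "HOL-Complex_Analysis.Great_Picard"
begin

text \<open>Let \<open>S\<close> be the best constant in \<open>S (\<integral>v\<^sup>4)\<^bsup>1/2\<^esup> \<le> \<integral>|\<nabla>v|\<^sup>2 + \<lambda> v\<^sup>2\<close>, and let \<open>M\<close> be the maximum over
  the simplex of the quadratic form with matrix \<open>\<beta>\<close>, where \<open>\<beta>\<^sub>i\<^sub>i = \<mu>\<^sub>i\<close> and \<open>\<beta>\<^sub>i\<^sub>j = b\<^sub>i\<^sub>j\<close>. If \<open>w\<close> solves the scalar
  equation at the level of \<open>S\<close> and \<open>y\<close> is a maximizer on the simplex, then the multiple of \<open>w\<close> by
  \<open>(\<surd>(S y\<^sub>i / M))\<^sub>i\<close> solves the system with energy at most \<open>S\<^sup>2 / (4 M)\<close>. Conversely, for a solution \<open>u\<close> put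
  \<open>z\<^sub>i = (\<integral>u\<^sub>i\<^sup>4)\<^bsup>1/2\<^esup>\<close>. The Nehari identity and Hoelder's inequality give
  \<open>S (\<Sum>z\<^sub>i) \<le> 4 I(u) \<le> \<Sum>\<beta>\<^sub>i\<^sub>j z\<^sub>i z\<^sub>j \<le> M (\<Sum>z\<^sub>i)\<^sup>2\<close>, so that for a ground state all inequalities are equalities and \<open>z\<close> is
  a multiple of a maximizer on the simplex. Under the assumptions on \<open>b\<close> every such maximizer has only
  positive entries.

  For the scalar equation, the Sobolev inequality, local compactness and non-vanishing of minimizing
  sequences are all read off from averages over dyadic cubes. A minimizing sequence is translated,
  and strong limits of its midpoint combinations replace weak limits; an almost minimizer almost
  solves the equation, and the equation passes to the limit.\<close>

section \<open>Square integrable and fourth power integrable functions\<close>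

text \<open>The level is an infimum over critical points, not over the Nehari set, so bounding it
  from above requires an actual solution of the system. This is why the scalar problem has to be
  solved and not only its infimum estimated. The common \<lambda> is what allows all components to
  be multiples of one scalar function, and the equality of the row sums of \<beta> at a maximizer
  with positive entries is exactly the condition for these multiples to satisfy all equations at
  once. In the scalar problem the obstacle is translation invariance, through which a minimizing
  sequence can escape. Dyadic averages fit because at each level they are constant on countably many
  cubes: a diagonal subsequence makes all of them converge, and a Poincare inequality controls what
  they miss, uniformly on bounded sets. The limit is not shown to be normalized. The equation and a
  bound on its form are carried over, and the comparison of levels works with these two facts.
  Existence of ground states is not asserted: a given ground state supplies the nonzero function
  from which the scalar problem starts.\<close>

definition L2_inner :: "('a::euclidean_space \<Rightarrow> 'b::euclidean_space) \<Rightarrow> ('a \<Rightarrow> 'b) \<Rightarrow> real" where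
  "L2_inner f g = (\<integral>x. f x \<bullet> g x \<partial>lborel)"

lemma square_integrableI:
  "f \<in> borel_measurable lborel \<Longrightarrow> integrable lborel (\<lambda>x. (norm (f x))\<^sup>2) \<Longrightarrow> square_integrable f"
  by (simp add: square_integrable_def)

lemma square_integrable_measurable [measurable_dest]:
  "square_integrable f \<Longrightarrow> f \<in> borel_measurable borel"
  by (simp add: square_integrable_def)

lemma square_integrable_bound:
  fixes f :: "'a::euclidean_space \<Rightarrow> 'b::euclidean_space" and g :: "'a \<Rightarrow> 'c::euclidean_space"
  assumes "square_integrable g" "f \<in> borel_measurable lborel" "AE x in lborel. norm (f x) \<le> norm (g x)"
  shows "square_integrable f"
proof (rule square_integrableI)
  show "integrable lborel (\<lambda>x. (norm (f x))\<^sup>2)"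
  proof (rule Bochner_Integration.integrable_bound)
    show "integrable lborel (\<lambda>x. (norm (g x))\<^sup>2)"
      using assms(1) by (simp add: square_integrable_def)
    show "(\<lambda>x. (norm (f x))\<^sup>2) \<in> borel_measurable lborel"
      using assms(2) by measurable
    show "AE x in lborel. norm ((norm (f x))\<^sup>2) \<le> norm ((norm (g x))\<^sup>2)"
      using assms(3) by eventually_elim (simp add: power_mono)
  qed
qed (use assms in auto)

lemma integrable_inner:
  assumes "square_integrable f" "square_integrable g"
  shows "integrable lborel (\<lambda>x. f x \<bullet> g x)"
proof (rule Bochner_Integration.integrable_bound)
  show "integrable lborel (\<lambda>x. (norm (f x))\<^sup>2 + (norm (g x))\<^sup>2)"
    using assms by (simp add: square_integrable_def)
  note [measurable] = assms[THEN square_integrable_measurable]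
  show "(\<lambda>x. f x \<bullet> g x) \<in> borel_measurable lborel" by measurable
  have "\<bar>x \<bullet> y\<bar> \<le> (norm x)\<^sup>2 + (norm y)\<^sup>2" for x y :: 'b
  proof -
    have "\<bar>x \<bullet> y\<bar> \<le> norm x * norm y" by (rule Cauchy_Schwarz_ineq2)
    moreover have "2 * (norm x * norm y) \<le> (norm x)\<^sup>2 + (norm y)\<^sup>2"
      using sum_squares_bound[of "norm x" "norm y"] by simp
    moreover have "0 \<le> norm x * norm y" by simp
    ultimately show ?thesis by linarith
  qed
  then show "AE x in lborel. norm (f x \<bullet> g x) \<le> norm ((norm (f x))\<^sup>2 + (norm (g x))\<^sup>2)"
    by simp
qed

lemma square_integrable_scale:
  "square_integrable f \<Longrightarrow> square_integrable (\<lambda>x. r *\<^sub>R f x)"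
  by (auto simp: square_integrable_def power_mult_distrib)

lemma square_integrable_add:
  assumes "square_integrable f" "square_integrable g"
  shows "square_integrable (\<lambda>x. f x + g x)"
proof (rule square_integrableI)
  note [measurable] = assms[THEN square_integrable_measurable]
  show "(\<lambda>x. f x + g x) \<in> borel_measurable lborel" by measurable
  have "(\<lambda>x. (norm (f x + g x))\<^sup>2) = (\<lambda>x. (norm (f x))\<^sup>2 + 2 * (f x \<bullet> g x) + (norm (g x))\<^sup>2)"
    by (simp add: power2_norm_eq_inner inner_add_left inner_add_right inner_commute algebra_simps)
  then show "integrable lborel (\<lambda>x. (norm (f x + g x))\<^sup>2)"
    using assms integrable_inner[OF assms] by (simp add: square_integrable_def)
qed

lemma square_integrable_diff:
  "square_integrable f \<Longrightarrow> square_integrable g \<Longrightarrow> square_integrable (\<lambda>x. f x - g x)"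
  using square_integrable_add[of f "\<lambda>x. (-1) *\<^sub>R g x"] square_integrable_scale[of g "-1"] by simp

lemma square_integrable_mult: 
  fixes f :: "'a::euclidean_space \<Rightarrow> real"
  shows "square_integrable f \<Longrightarrow> square_integrable (\<lambda>x. r * f x)"
  using square_integrable_scale[of f r] by simp

lemmas square_integrable_intros = square_integrable_add square_integrable_diff
  square_integrable_scale square_integrable_mult

lemma L2_inner_commute: "L2_inner f g = L2_inner g f"
  by (simp add: L2_inner_def inner_commute)

lemma L2_inner_add_left:
  "square_integrable f \<Longrightarrow> square_integrable g \<Longrightarrow> square_integrable h \<Longrightarrow>
    L2_inner (\<lambda>x. f x + g x) h = L2_inner f h + L2_inner g h"
  by (simp add: L2_inner_def inner_add_left integrable_inner)

lemma L2_inner_diff_left: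
  "square_integrable f \<Longrightarrow> square_integrable g \<Longrightarrow> square_integrable h \<Longrightarrow>
    L2_inner (\<lambda>x. f x - g x) h = L2_inner f h - L2_inner g h"
  by (simp add: L2_inner_def inner_diff_left integrable_inner)

lemma L2_inner_add_right:
  "square_integrable f \<Longrightarrow> square_integrable g \<Longrightarrow> square_integrable h \<Longrightarrow>
    L2_inner h (\<lambda>x. f x + g x) = L2_inner h f + L2_inner h g"
  by (simp add: L2_inner_def inner_add_right integrable_inner)

lemma L2_inner_diff_right:
  "square_integrable f \<Longrightarrow> square_integrable g \<Longrightarrow> square_integrable h \<Longrightarrow>
    L2_inner h (\<lambda>x. f x - g x) = L2_inner h f - L2_inner h g"
  by (simp add: L2_inner_def inner_diff_right integrable_inner)

lemma L2_inner_scale_left: "L2_inner (\<lambda>x. r *\<^sub>R f x) g = r * L2_inner f g"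
  by (simp add: L2_inner_def)

lemma L2_inner_scale_right: "L2_inner f (\<lambda>x. r *\<^sub>R g x) = r * L2_inner f g"
  by (simp add: L2_inner_def)

lemmas L2_inner_simps = L2_inner_add_left L2_inner_diff_left L2_inner_add_right
  L2_inner_diff_right L2_inner_scale_left L2_inner_scale_right square_integrable_intros

lemma L2_inner_self: "L2_inner f f = (\<integral>x. (norm (f x))\<^sup>2 \<partial>lborel)"
  by (simp add: L2_inner_def power2_norm_eq_inner)

lemma L2_inner_ge_0 [simp]: "0 \<le> L2_inner f f"
  by (simp add: L2_inner_def)

lemma L2_inner_cong_AE:
  assumes "square_integrable f" "square_integrable g" "square_integrable f'" "square_integrable g'"
    and "AE x in lborel. f x = f' x" "AE x in lborel. g x = g' x"
  shows "L2_inner f g = L2_inner f' g'"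
  unfolding L2_inner_def
proof (rule integral_cong_AE)
  note [measurable] = assms(1-4)[THEN square_integrable_measurable]
  show "(\<lambda>x. f x \<bullet> g x) \<in> borel_measurable lborel" "(\<lambda>x. f' x \<bullet> g' x) \<in> borel_measurable lborel"
    by measurable
  show "AE x in lborel. f x \<bullet> g x = f' x \<bullet> g' x"
    using assms(5,6) by eventually_elim simp
qed

lemma L2_inner_eq_0_iff:
  assumes "square_integrable f"
  shows "L2_inner f f = 0 \<longleftrightarrow> (AE x in lborel. f x = 0)"
  unfolding L2_inner_def using integrable_inner[OF assms assms]
  by (subst integral_nonneg_eq_0_iff_AE) auto

text \<open>The squared norm of \<open>f - t g\<close> is a nonnegative quadratic polynomial in
  \<open>t\<close>, so its discriminant is not positive.\<close>

lemma L2_Cauchy_Schwarz_sq: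
  assumes "square_integrable f" "square_integrable g"
  shows "(L2_inner f g)\<^sup>2 \<le> L2_inner f f * L2_inner g g"
proof -
  define A B C where "A = L2_inner f f" and "B = L2_inner f g" and "C = L2_inner g g"
  have poly: "0 \<le> A - 2 * t * B + t\<^sup>2 * C" for t
  proof -
    have "0 \<le> L2_inner (\<lambda>x. f x - t *\<^sub>R g x) (\<lambda>x. f x - t *\<^sub>R g x)" by simp
    also have "\<dots> = A - 2 * t * B + t\<^sup>2 * C"
      using assms L2_inner_commute[of g f]
      by (simp add: L2_inner_simps A_def B_def C_def power2_eq_square algebra_simps)
    finally show ?thesis .
  qed
  have "A \<ge> 0" "C \<ge> 0" by (auto simp: A_def C_def)
  show ?thesis
  proof (cases "C = 0")
    case True
    have "B = 0"
    proof (rule ccontr)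
      assume "B \<noteq> 0"
      \<comment> \<open>With \<open>C = 0\<close> the polynomial is affine in \<open>t\<close>, and
        at this \<open>t\<close> its value is \<open>-1\<close>.\<close>
      then show False using poly[of "(A + 1) / (2 * B)"] True by simp
    qed
    then show ?thesis by (simp add: B_def \<open>A \<ge> 0\<close> \<open>C \<ge> 0\<close>)
  next
    case False
    then have "C > 0" using \<open>C \<ge> 0\<close> by simp
    have "A - 2 * (B / C) * B + (B / C)\<^sup>2 * C = A - B\<^sup>2 / C"
      using \<open>C > 0\<close> by (simp add: power2_eq_square)
    then have "B\<^sup>2 / C \<le> A" using poly[of "B / C"] by simp
    then have "B\<^sup>2 \<le> A * C" using \<open>C > 0\<close> by (simp add: pos_divide_le_eq)
    then show ?thesis by (simp add: A_def B_def C_def)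
  qed
qed

lemma L2_Cauchy_Schwarz:
  assumes "square_integrable f" "square_integrable g"
  shows "\<bar>L2_inner f g\<bar> \<le> sqrt (L2_inner f f) * sqrt (L2_inner g g)"
  using L2_Cauchy_Schwarz_sq[OF assms]
  by (metis real_sqrt_abs real_sqrt_le_iff real_sqrt_mult)

lemma L2_inner_tendsto:
  assumes "\<And>n. square_integrable (f n)" "square_integrable F" "square_integrable g"
    and "(\<lambda>n. L2_inner (\<lambda>x. f n x - F x) (\<lambda>x. f n x - F x)) \<longlonglongrightarrow> 0"
  shows "(\<lambda>n. L2_inner (f n) g) \<longlonglongrightarrow> L2_inner F g"
proof (rule LIM_zero_cancel, rule Lim_null_comparison)
  have "L2_inner (f n) g - L2_inner F g = L2_inner (\<lambda>x. f n x - F x) g" for n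
    by (simp add: assms L2_inner_simps)
  moreover have "\<bar>L2_inner (\<lambda>x. f n x - F x) g\<bar>
      \<le> sqrt (L2_inner (\<lambda>x. f n x - F x) (\<lambda>x. f n x - F x)) * sqrt (L2_inner g g)" for n
    by (rule L2_Cauchy_Schwarz) (intro square_integrable_diff assms)+
  ultimately show "\<forall>\<^sub>F n in sequentially. norm (L2_inner (f n) g - L2_inner F g)
      \<le> sqrt (L2_inner (\<lambda>x. f n x - F x) (\<lambda>x. f n x - F x)) * sqrt (L2_inner g g)"
    by (simp only: real_norm_def) simp
  show "(\<lambda>n. sqrt (L2_inner (\<lambda>x. f n x - F x) (\<lambda>x. f n x - F x)) * sqrt (L2_inner g g)) \<longlonglongrightarrow> 0"
    using tendsto_mult_right[OF tendsto_real_sqrt[OF assms(4)]] by simp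
qed

section \<open>Completeness of L2\<close>

lemma nn_integral_norm_sq:
  "square_integrable f \<Longrightarrow> (\<integral>\<^sup>+x. ennreal ((norm (f x))\<^sup>2) \<partial>lborel) = ennreal (L2_inner f f)"
  unfolding L2_inner_self square_integrable_def by (intro nn_integral_eq_integral) auto

text \<open>Estimates are carried out with extended nonnegative integrals, where Fubini, Fatou and
  monotonicity ask for no integrability. This brings the result back and yields integrability and
  the bound together.\<close>

lemma square_integrable_nn_integralI:
  assumes "f \<in> borel_measurable lborel" "(\<integral>\<^sup>+x. ennreal ((norm (f x))\<^sup>2) \<partial>lborel) \<le> ennreal c" "0 \<le> c"
  shows "square_integrable f" "L2_inner f f \<le> c"
proof -
  note [measurable] = assms(1)
  show *: "square_integrable f"
    using assms(2) by (intro square_integrableI integrableI_nonneg) (auto simp: less_top[symmetric] top_unique)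
  show "L2_inner f f \<le> c"
    using assms(2,3) by (simp add: nn_integral_norm_sq[OF *])
qed

text \<open>The integral of the pointwise series is the sum of the integrals, hence finite, so the
  series is finite almost everywhere.\<close>

lemma AE_summable_if_integrals_summable:
  fixes f :: "nat \<Rightarrow> 'a::euclidean_space \<Rightarrow> real"
  assumes "\<And>k. f k \<in> borel_measurable lborel" "\<And>k x. f k x \<ge> 0"
    and "\<And>k. (\<integral>\<^sup>+x. ennreal (f k x) \<partial>lborel) \<le> ennreal (a k)" "summable a" "\<And>k. a k \<ge> 0"
  shows "AE x in lborel. summable (\<lambda>k. f k x)"
proof -
  note [measurable] = assms(1)
  have "(\<integral>\<^sup>+x. (\<Sum>k. ennreal (f k x)) \<partial>lborel) = (\<Sum>k. \<integral>\<^sup>+x. ennreal (f k x) \<partial>lborel)"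
    by (rule nn_integral_suminf) auto
  also have "\<dots> \<le> (\<Sum>k. ennreal (a k))"
    by (intro suminf_le assms) auto
  also have "\<dots> = ennreal (suminf a)"
    by (rule suminf_ennreal2) (use assms in auto)
  finally have "(\<integral>\<^sup>+x. (\<Sum>k. ennreal (f k x)) \<partial>lborel) \<noteq> \<infinity>"
    by (metis ennreal_less_top infinity_ennreal_def leD)
  then have "AE x in lborel. (\<Sum>k. ennreal (f k x)) \<noteq> \<infinity>"
    by (rule nn_integral_PInf_AE[rotated]) measurable
  then show ?thesis
    by eventually_elim (auto intro!: summable_suminf_not_top assms)
qed

text \<open>Riesz-Fischer: a rapidly Cauchy subsequence converges almost everywhere, and Fatou's
  lemma turns its pointwise limit into a limit in the mean of the whole sequence.\<close>

theorem L2_complete: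
  fixes f :: "nat \<Rightarrow> 'a::euclidean_space \<Rightarrow> 'b::euclidean_space"
  assumes sq: "\<And>n. square_integrable (f n)"
    and cauchy: "\<And>e. e > 0 \<Longrightarrow> \<exists>n0. \<forall>m\<ge>n0. \<forall>n\<ge>n0. L2_inner (\<lambda>x. f m x - f n x) (\<lambda>x. f m x - f n x) \<le> e"
  obtains F where "square_integrable F" "(\<lambda>n. L2_inner (\<lambda>x. f n x - F x) (\<lambda>x. f n x - F x)) \<longlonglongrightarrow> 0"
proof -
  note [measurable] = sq[THEN square_integrable_measurable]
  let ?d = "\<lambda>m n. L2_inner (\<lambda>x. f m x - f n x) (\<lambda>x. f m x - f n x)"
  have "\<exists>n0. \<forall>m\<ge>n0. \<forall>n\<ge>n0. ?d m n \<le> (1/16) ^ k" for k :: nat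
    by (rule cauchy) simp
  then obtain n0 where n0: "\<And>k m n. m \<ge> n0 k \<Longrightarrow> n \<ge> n0 k \<Longrightarrow> ?d m n \<le> (1/16) ^ k"
    by metis
  \<comment> \<open>The sum dominates each \<open>n0 k\<close>, and the summand \<open>k\<close>
    makes \<open>r\<close> strictly increasing.\<close>
  define r where "r k = (\<Sum>j\<le>k. n0 j) + k" for k
  have r_ge: "r k \<ge> n0 k" for k
    using member_le_sum[of k "{..k}" n0] by (simp add: r_def)
  have r_mono: "strict_mono r" by (simp add: strict_mono_Suc_iff r_def)
  have rS: "?d (r (Suc k)) (r k) \<le> (1/16) ^ k" for k
    using r_ge[of k] strict_monoD[OF r_mono, of k "Suc k"] by (intro n0) auto
  \<comment> \<open>The squared increments have integrals of size \<open>(1/16) ^ k\<close>.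
    Weighting by \<open>4 ^ k\<close> keeps the series summable and forces the increments themselves
    below \<open>(1/2) ^ k\<close> eventually, at almost every point.\<close>
  have "AE x in lborel. summable (\<lambda>k. 4 ^ k * (norm (f (r (Suc k)) x - f (r k) x))\<^sup>2)"
  proof (rule AE_summable_if_integrals_summable)
    fix k
    have "(\<integral>\<^sup>+x. ennreal (4 ^ k * (norm (f (r (Suc k)) x - f (r k) x))\<^sup>2) \<partial>lborel)
        = ennreal (4 ^ k) * (\<integral>\<^sup>+x. ennreal ((norm (f (r (Suc k)) x - f (r k) x))\<^sup>2) \<partial>lborel)"
      by (subst nn_integral_cmult[symmetric]) (auto simp: ennreal_mult)
    also have "\<dots> = ennreal (4 ^ k * ?d (r (Suc k)) (r k))"
      by (subst nn_integral_norm_sq) (auto intro!: square_integrable_intros sq simp: ennreal_mult)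
    also have "\<dots> \<le> ennreal ((1/4) ^ k)"
    proof (rule ennreal_leI)
      have "4 ^ k * ?d (r (Suc k)) (r k) \<le> 4 ^ k * (1/16) ^ k"
        by (intro mult_left_mono rS) auto
      also have "\<dots> = (1/4::real) ^ k"
        by (simp flip: power_mult_distrib)
      finally show "4 ^ k * ?d (r (Suc k)) (r k) \<le> (1/4::real) ^ k" .
    qed
    finally show "(\<integral>\<^sup>+x. ennreal (4 ^ k * (norm (f (r (Suc k)) x - f (r k) x))\<^sup>2) \<partial>lborel) \<le> ennreal ((1/4) ^ k)" .
  qed auto
  then have conv: "AE x in lborel. convergent (\<lambda>k. f (r k) x)"
  proof eventually_elim
    case (elim x)
      have "(\<lambda>k. 4 ^ k * (norm (f (r (Suc k)) x - f (r k) x))\<^sup>2) \<longlonglongrightarrow> 0"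
        by (rule summable_LIMSEQ_zero[OF elim])
      from order_tendstoD(2)[OF this, of 1]
      obtain N where N: "\<And>k. k \<ge> N \<Longrightarrow> 4 ^ k * (norm (f (r (Suc k)) x - f (r k) x))\<^sup>2 < 1"
        by (auto simp: eventually_sequentially)
    have "summable (\<lambda>k. norm (f (r (Suc k)) x - f (r k) x))"
    proof (rule summable_comparison_test'[where N = N])
      show "norm (norm (f (r (Suc k)) x - f (r k) x)) \<le> (1/2) ^ k" if "k \<ge> N" for k
      proof -
        have four: "(2 ^ k)\<^sup>2 = (4::real) ^ k" by (simp add: power2_eq_square flip: power_mult_distrib)
        have "(2 ^ k * norm (f (r (Suc k)) x - f (r k) x))\<^sup>2 \<le> 1\<^sup>2"
          using N[OF that] four by (simp only: power_mult_distrib) simp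
        then have "2 ^ k * norm (f (r (Suc k)) x - f (r k) x) \<le> 1"
          by (rule power2_le_imp_le) simp
        then show ?thesis by (simp add: field_simps)
      qed
      show "summable (\<lambda>k. (1/2::real) ^ k)" by (simp add: summable_geometric)
    qed
    then have "summable (\<lambda>k. f (r (Suc k)) x - f (r k) x)" by (rule summable_norm_cancel)
    then have "convergent (\<lambda>n. \<Sum>k<n. f (r (Suc k)) x - f (r k) x)"
      by (simp add: summable_iff_convergent)
    then have "convergent (\<lambda>n. f (r n) x - f (r 0) x)"
      by (simp add: sum_lessThan_telescope[of "\<lambda>k. f (r k) x"])
    then obtain l where "(\<lambda>n. f (r n) x - f (r 0) x) \<longlonglongrightarrow> l"
      by (auto simp: convergent_def)
    then have "(\<lambda>n. f (r n) x - f (r 0) x + f (r 0) x) \<longlonglongrightarrow> l + f (r 0) x"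
      by (intro tendsto_intros)
    then show "convergent (\<lambda>k. f (r k) x)" by (auto simp: convergent_def)
  qed
  define F where "F x = lim (\<lambda>k. f (r k) x)" for x
  have [measurable]: "F \<in> borel_measurable borel"
    unfolding F_def by measurable
  have limF: "AE x in lborel. (\<lambda>k. f (r k) x) \<longlonglongrightarrow> F x"
    using conv by eventually_elim (simp add: F_def convergent_LIMSEQ_iff)
  \<comment> \<open>Fatou's lemma along the subsequence: a bound on \<open>?d m n\<close> for all
    large \<open>m\<close> survives in the limit of \<open>m\<close>.\<close>
  have est: "square_integrable (\<lambda>x. F x - f n x)" "L2_inner (\<lambda>x. F x - f n x) (\<lambda>x. F x - f n x) \<le> e"
    if "e > 0" and n: "\<And>m. m \<ge> n \<Longrightarrow> ?d m n \<le> e" for e n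
  proof -
    have "(\<integral>\<^sup>+x. ennreal ((norm (F x - f n x))\<^sup>2) \<partial>lborel)
        = (\<integral>\<^sup>+x. liminf (\<lambda>k. ennreal ((norm (f (r k) x - f n x))\<^sup>2)) \<partial>lborel)"
    proof (rule nn_integral_cong_AE)
      show "AE x in lborel. ennreal ((norm (F x - f n x))\<^sup>2) = liminf (\<lambda>k. ennreal ((norm (f (r k) x - f n x))\<^sup>2))"
        using limF
      proof eventually_elim
        case (elim x)
        have "(\<lambda>k. ennreal ((norm (f (r k) x - f n x))\<^sup>2)) \<longlonglongrightarrow> ennreal ((norm (F x - f n x))\<^sup>2)"
          by (intro tendsto_intros tendsto_ennrealI elim)
        from lim_imp_Liminf[OF _ this] show ?case by simp
      qed
    qed
    also have "\<dots> \<le> liminf (\<lambda>k. \<integral>\<^sup>+x. ennreal ((norm (f (r k) x - f n x))\<^sup>2) \<partial>lborel)"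
      by (rule nn_integral_liminf) auto
    also have "\<dots> \<le> limsup (\<lambda>k. \<integral>\<^sup>+x. ennreal ((norm (f (r k) x - f n x))\<^sup>2) \<partial>lborel)"
      by (rule Liminf_le_Limsup) simp
    also have "\<dots> \<le> ennreal e"
    proof (rule Limsup_bounded)
      show "\<forall>\<^sub>F k in sequentially. (\<integral>\<^sup>+x. ennreal ((norm (f (r k) x - f n x))\<^sup>2) \<partial>lborel) \<le> ennreal e"
        using eventually_ge_at_top[of n]
      proof eventually_elim
        case (elim k)
        then have "r k \<ge> n" using seq_suble[OF r_mono, of k] by simp
        then show ?case
          by (subst nn_integral_norm_sq) (auto intro!: square_integrable_intros sq ennreal_leI n)
      qed
    qed
    finally have le: "(\<integral>\<^sup>+x. ennreal ((norm (F x - f n x))\<^sup>2) \<partial>lborel) \<le> ennreal e" .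
    have "(\<lambda>x. F x - f n x) \<in> borel_measurable lborel" by measurable
    from square_integrable_nn_integralI[OF this le] that(1)
    show "square_integrable (\<lambda>x. F x - f n x)" "L2_inner (\<lambda>x. F x - f n x) (\<lambda>x. F x - f n x) \<le> e" by auto
  qed
  obtain n1 where n1: "\<And>m. m \<ge> n1 \<Longrightarrow> ?d m n1 \<le> 1" using cauchy[of 1] by auto
  have F: "square_integrable F"
    using square_integrable_add[OF est(1)[of 1 n1, OF _ n1] sq[of n1]] by simp
  show ?thesis
  proof
    show "square_integrable F" by fact
    have eq: "L2_inner (\<lambda>x. f n x - F x) (\<lambda>x. f n x - F x) = L2_inner (\<lambda>x. F x - f n x) (\<lambda>x. F x - f n x)" for n
      by (simp add: L2_inner_self norm_minus_commute)
    show "(\<lambda>n. L2_inner (\<lambda>x. f n x - F x) (\<lambda>x. f n x - F x)) \<longlonglongrightarrow> 0"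
    proof (rule LIMSEQ_I)
      fix e :: real assume "e > 0"
      then obtain N where N: "\<And>m n. m \<ge> N \<Longrightarrow> n \<ge> N \<Longrightarrow> ?d m n \<le> e / 2"
        using cauchy[of "e/2"] by auto
      have "L2_inner (\<lambda>x. f n x - F x) (\<lambda>x. f n x - F x) \<le> e/2" if "n \<ge> N" for n
        unfolding eq by (rule est) (use N that \<open>e > 0\<close> in auto)
      then show "\<exists>no. \<forall>n\<ge>no. norm (L2_inner (\<lambda>x. f n x - F x) (\<lambda>x. f n x - F x) - 0) < e"
        using \<open>e > 0\<close> by (force intro!: exI[of _ N])
    qed
  qed
qed

section \<open>Fourth powers and Hoelder's inequality\<close>

definition L4 :: "('a::euclidean_space \<Rightarrow> real) \<Rightarrow> bool" where
  "L4 f \<longleftrightarrow> f \<in> borel_measurable lborel \<and> integrable lborel (\<lambda>x. (f x) ^ 4)"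

definition L4_norm :: "('a::euclidean_space \<Rightarrow> real) \<Rightarrow> real" where
  "L4_norm f = sqrt (sqrt (\<integral>x. (f x) ^ 4 \<partial>lborel))"

lemma L4_measurable: "L4 f \<Longrightarrow> f \<in> borel_measurable borel"
  by (simp add: L4_def)

lemma L4_norm_ge_0 [simp]: "0 \<le> L4_norm f"
  by (simp add: L4_norm_def)

lemma L4_norm_pow4: "L4_norm f ^ 4 = (\<integral>x. (f x) ^ 4 \<partial>lborel)"
proof -
  have "L4_norm f ^ 4 = (L4_norm f ^ 2) ^ 2" by simp
  then show ?thesis by (simp add: L4_norm_def)
qed

lemma L4_square: "L4 f \<longleftrightarrow> f \<in> borel_measurable lborel \<and> square_integrable (\<lambda>x. (f x)\<^sup>2)"
  by (auto simp: L4_def square_integrable_def)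

lemma L4_mult_square_integrable:
  assumes "L4 f" "L4 g"
  shows "square_integrable (\<lambda>x. f x * g x)"
    and "L2_inner (\<lambda>x. f x * g x) (\<lambda>x. f x * g x) \<le> (L4_norm f * L4_norm g)\<^sup>2"
proof -
  note [measurable] = assms[THEN L4_measurable]
  have sq: "square_integrable (\<lambda>x. (f x)\<^sup>2)" "square_integrable (\<lambda>x. (g x)\<^sup>2)"
    using assms by (auto simp: L4_square)
  show "square_integrable (\<lambda>x. f x * g x)"
    using integrable_inner[OF sq]
    by (intro square_integrableI) (auto simp: power_mult_distrib)
  have "L2_inner (\<lambda>x. f x * g x) (\<lambda>x. f x * g x) = L2_inner (\<lambda>x. (f x)\<^sup>2) (\<lambda>x. (g x)\<^sup>2)"
    by (simp add: L2_inner_def power2_eq_square algebra_simps)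
  also have "\<dots> \<le> sqrt (L2_inner (\<lambda>x. (f x)\<^sup>2) (\<lambda>x. (f x)\<^sup>2)) * sqrt (L2_inner (\<lambda>x. (g x)\<^sup>2) (\<lambda>x. (g x)\<^sup>2))"
    using L2_Cauchy_Schwarz[OF sq] by simp
  also have "\<dots> = (L4_norm f * L4_norm g)\<^sup>2"
    by (simp add: L4_norm_def L2_inner_self power_mult_distrib)
  finally show "L2_inner (\<lambda>x. f x * g x) (\<lambda>x. f x * g x) \<le> (L4_norm f * L4_norm g)\<^sup>2" .
qed

text \<open>Grouping the four factors in pairs makes the integral an inner product of two square
  integrable products, so two rounds of Cauchy-Schwarz suffice. The quartic expansions below are
  bracketed to match this shape.\<close>

lemma L4_Hoelder:
  assumes "L4 f" "L4 g" "L4 h" "L4 k"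
  shows "integrable lborel (\<lambda>x. f x * g x * (h x * k x))"
    and "\<bar>\<integral>x. f x * g x * (h x * k x) \<partial>lborel\<bar> \<le> L4_norm f * L4_norm g * (L4_norm h * L4_norm k)"
proof -
  note fg = L4_mult_square_integrable[OF assms(1,2)] and hk = L4_mult_square_integrable[OF assms(3,4)]
  show "integrable lborel (\<lambda>x. f x * g x * (h x * k x))"
    using integrable_inner[OF fg(1) hk(1)] by simp
  have "\<bar>\<integral>x. f x * g x * (h x * k x) \<partial>lborel\<bar> = \<bar>L2_inner (\<lambda>x. f x * g x) (\<lambda>x. h x * k x)\<bar>"
    by (simp add: L2_inner_def)
  also have "\<dots> \<le> sqrt (L2_inner (\<lambda>x. f x * g x) (\<lambda>x. f x * g x)) * sqrt (L2_inner (\<lambda>x. h x * k x) (\<lambda>x. h x * k x))"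
    by (rule L2_Cauchy_Schwarz[OF fg(1) hk(1)])
  also have "\<dots> \<le> (L4_norm f * L4_norm g) * (L4_norm h * L4_norm k)"
    by (intro mult_mono real_le_lsqrt fg hk) auto
  finally show "\<bar>\<integral>x. f x * g x * (h x * k x) \<partial>lborel\<bar> \<le> L4_norm f * L4_norm g * (L4_norm h * L4_norm k)" .
qed

text \<open>Takes the role of the triangle inequality for fourth powers; its factor \<open>8\<close>
  is what the smallness constants further on have to absorb.\<close>

lemma add_pow4_le: "(a + b) ^ 4 \<le> 8 * (a ^ 4 + b ^ 4)" for a b :: real
proof -
  have "(a + b)\<^sup>2 \<le> 2 * (a\<^sup>2 + b\<^sup>2)" 
    using sum_squares_bound[of a b] by (simp add: power2_sum)
  then have "((a + b)\<^sup>2)\<^sup>2 \<le> (2 * (a\<^sup>2 + b\<^sup>2))\<^sup>2" by (rule power_mono) simp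
  also have "\<dots> \<le> 8 * (a ^ 4 + b ^ 4)"
    using sum_squares_bound[of "a\<^sup>2" "b\<^sup>2"] by (simp add: power2_sum power_mult_distrib)
  finally show ?thesis by simp
qed

lemma L4_add:
  assumes "L4 f" "L4 g"
  shows "L4 (\<lambda>x. f x + g x)"
    and "(\<integral>x. (f x + g x) ^ 4 \<partial>lborel) \<le> 8 * ((\<integral>x. (f x) ^ 4 \<partial>lborel) + (\<integral>x. (g x) ^ 4 \<partial>lborel))"
proof -
  note [measurable] = assms[THEN L4_measurable]
  have int: "integrable lborel (\<lambda>x. 8 * ((f x) ^ 4 + (g x) ^ 4))"
    using assms by (simp add: L4_def)
  have *: "integrable lborel (\<lambda>x. (f x + g x) ^ 4)"
  proof (rule Bochner_Integration.integrable_bound[OF int])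
    have "norm ((f x + g x) ^ 4) \<le> norm (8 * ((f x) ^ 4 + (g x) ^ 4))" for x
    proof -
      have "0 \<le> (f x + g x) ^ 4" "0 \<le> 8 * ((f x) ^ 4 + (g x) ^ 4)"
        by (auto intro!: mult_nonneg_nonneg add_nonneg_nonneg zero_le_even_power)
      then show ?thesis
        using add_pow4_le[of "f x" "g x"] by (simp only: real_norm_def abs_of_nonneg)
    qed
    then show "AE x in lborel. norm ((f x + g x) ^ 4) \<le> norm (8 * ((f x) ^ 4 + (g x) ^ 4))"
      by (intro AE_I2)
  qed measurable
  then show "L4 (\<lambda>x. f x + g x)" by (simp add: L4_def)
  have "(\<integral>x. (f x + g x) ^ 4 \<partial>lborel) \<le> (\<integral>x. 8 * ((f x) ^ 4 + (g x) ^ 4) \<partial>lborel)"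
    by (rule integral_mono[OF * int]) (rule add_pow4_le)
  then show "(\<integral>x. (f x + g x) ^ 4 \<partial>lborel) \<le> 8 * ((\<integral>x. (f x) ^ 4 \<partial>lborel) + (\<integral>x. (g x) ^ 4 \<partial>lborel))"
    using assms by (simp add: L4_def)
qed

lemma L4_bound:
  assumes "L4 g" "f \<in> borel_measurable lborel" "\<And>x. \<bar>f x\<bar> \<le> \<bar>g x\<bar>"
  shows "L4 f" "(\<integral>x. (f x) ^ 4 \<partial>lborel) \<le> (\<integral>x. (g x) ^ 4 \<partial>lborel)"
proof -
  note [measurable] = assms(2)
  have le: "(f x) ^ 4 \<le> (g x) ^ 4" for x
    using power_mono[OF assms(3)[of x], of 4] by simp
  have int: "integrable lborel (\<lambda>x. (f x) ^ 4)"
    by (rule Bochner_Integration.integrable_bound[of _ "\<lambda>x. (g x) ^ 4"])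
      (use assms(1) le in \<open>auto simp: L4_def\<close>)
  then show "L4 f" using assms(2) by (simp add: L4_def)
  show "(\<integral>x. (f x) ^ 4 \<partial>lborel) \<le> (\<integral>x. (g x) ^ 4 \<partial>lborel)"
    by (rule integral_mono) (use int assms(1) le in \<open>auto simp: L4_def\<close>)
qed

section \<open>Smooth bumps and the fundamental lemma of the calculus of variations\<close>

text \<open>With \<open>p = 1\<close> this is the classical flat function. Carrying a polynomial in
  \<open>1 / t\<close> makes the family closed under differentiation: \<open>p\<close> turns into
  \<open>X^2 (p - p')\<close>.\<close>

definition exp_recip :: "real poly \<Rightarrow> real \<Rightarrow> real" where
  "exp_recip p t = (if t > 0 then poly p (1 / t) * exp (- 1 / t) else 0)"

lemma power_poly_div_exp_tendsto_0:
  "((\<lambda>x::real. x ^ k * poly p x / exp x) \<longlongrightarrow> 0) at_top"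
proof (induction p arbitrary: k)
  case 0
  then show ?case by simp
next
  case (pCons a p)
  have "((\<lambda>x. a * (x ^ k / exp x) + x ^ Suc k * poly p x / exp x) \<longlongrightarrow> a * 0 + 0) at_top"
    by (intro tendsto_intros tendsto_power_div_exp_0 pCons)
  then show ?case by (simp add: field_simps)
qed

text \<open>This is differentiability at \<open>0\<close>. Substituting \<open>x = 1 / h\<close> on
  the right reduces it to the exponential outgrowing every polynomial.\<close>

lemma exp_recip_quotient_tendsto_0: "((\<lambda>h. exp_recip p h / h) \<longlongrightarrow> 0) (at 0)"
proof (rule filterlim_split_at)
  have "\<forall>\<^sub>F h in at_left 0. exp_recip p h / h = 0"
    unfolding eventually_at_filter by (auto simp: exp_recip_def)
  then show "((\<lambda>h. exp_recip p h / h) \<longlongrightarrow> 0) (at_left 0)"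
    by (simp add: tendsto_eventually)
  have "((\<lambda>h. inverse h ^ 1 * poly p (inverse h) / exp (inverse h)) \<longlongrightarrow> 0) (at_right 0)"
    by (rule filterlim_compose[OF power_poly_div_exp_tendsto_0 filterlim_inverse_at_top_right])
  then show "((\<lambda>h. exp_recip p h / h) \<longlongrightarrow> 0) (at_right 0)"
  proof (rule Lim_transform_eventually)
    show "\<forall>\<^sub>F h in at_right 0. inverse h ^ 1 * poly p (inverse h) / exp (inverse h) = exp_recip p h / h"
      unfolding eventually_at_filter
      by (auto simp: exp_recip_def field_simps exp_minus)
  qed
qed

lemma exp_recip_has_derivative:
  "(exp_recip p has_field_derivative exp_recip (monom 1 2 * (p - pderiv p)) t) (at t)"
proof -
  consider "t > 0" | "t < 0" | "t = 0" by linarith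
  then show ?thesis
  proof cases
    case 1
    have "((\<lambda>t. poly p (1 / t) * exp (- 1 / t)) has_field_derivative
        poly p (1 / t) * (exp (- 1 / t) * (1 / t\<^sup>2)) + poly (pderiv p) (1 / t) * (- 1 / t\<^sup>2) * exp (- 1 / t)) (at t)"
      using 1 by (auto intro!: derivative_eq_intros DERIV_chain2[OF poly_DERIV] simp: power2_eq_square)
    also have "poly p (1 / t) * (exp (- 1 / t) * (1 / t\<^sup>2)) + poly (pderiv p) (1 / t) * (- 1 / t\<^sup>2) * exp (- 1 / t)
        = exp_recip (monom 1 2 * (p - pderiv p)) t"
      using 1 by (simp add: exp_recip_def poly_monom power2_eq_square field_simps)
    finally show ?thesis
    proof (rule has_field_derivative_transform_within_open[of _ _ _ "{0<..}"])
    qed (use 1 in \<open>auto simp: exp_recip_def\<close>)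
  next
    case 2
    have "((\<lambda>_. 0) has_field_derivative exp_recip (monom 1 2 * (p - pderiv p)) t) (at t)"
      using 2 by (simp add: exp_recip_def)
    then show ?thesis
    proof (rule has_field_derivative_transform_within_open[of _ _ _ "{..<0}"])
    qed (use 2 in \<open>auto simp: exp_recip_def\<close>)
  next
    case 3
    then show ?thesis using exp_recip_quotient_tendsto_0[of p]
      by (simp add: has_field_derivative_iff exp_recip_def)
  qed
qed

text \<open>A class closed under directional derivatives, so that \<open>C_k\<close> for every
  \<open>k\<close> follows by one induction on \<open>k\<close>, without formulas for higher
  derivatives. The affine argument in the second rule feeds a coordinate of \<open>x\<close> into a
  function of one variable.\<close>

inductive_set smooth_fun :: "('a::euclidean_space \<Rightarrow> real) set" where
  const: "(\<lambda>x. c) \<in> smooth_fun"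
| exp_recip: "(\<lambda>x. exp_recip p (c * (x \<bullet> e) + d)) \<in> smooth_fun"
| add: "f \<in> smooth_fun \<Longrightarrow> g \<in> smooth_fun \<Longrightarrow> (\<lambda>x. f x + g x) \<in> smooth_fun"
| mult: "f \<in> smooth_fun \<Longrightarrow> g \<in> smooth_fun \<Longrightarrow> (\<lambda>x. f x * g x) \<in> smooth_fun"

lemma smooth_fun_derivative:
  assumes "f \<in> smooth_fun"
  shows "\<exists>D. (\<forall>x. (f has_derivative D x) (at x)) \<and> (\<forall>v. (\<lambda>x. D x v) \<in> smooth_fun)"
  using assms
proof induction
  case (const c)
  show ?case by (rule exI[of _ "\<lambda>x v. 0"]) (auto intro: smooth_fun.intros)
next
  case (exp_recip p c e d)
  let ?q = "monom 1 2 * (p - pderiv p)"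
  let ?D = "\<lambda>x v. exp_recip ?q (c * (x \<bullet> e) + d) * (c * (v \<bullet> e))"
  have "((\<lambda>x. exp_recip p (c * (x \<bullet> e) + d)) has_derivative ?D x) (at x)" for x
  proof -
    have inner: "((\<lambda>x. c * (x \<bullet> e) + d) has_derivative (\<lambda>v. c * (v \<bullet> e))) (at x)"
      by (auto intro!: derivative_eq_intros)
    have "(exp_recip p has_derivative (\<lambda>y. exp_recip ?q (c * (x \<bullet> e) + d) * y)) (at (c * (x \<bullet> e) + d))"
      using exp_recip_has_derivative[of p "c * (x \<bullet> e) + d"] by (simp add: has_field_derivative_def)
    from has_derivative_compose[OF inner this] show ?thesis .
  qed
  moreover have "(\<lambda>x. ?D x v) \<in> smooth_fun" for v
    by (intro smooth_fun.intros)
  ultimately show ?case by (intro exI[of _ ?D]) auto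
next
  case (add f g)
  then obtain D E where D: "\<And>x. (f has_derivative D x) (at x)" "\<And>v. (\<lambda>x. D x v) \<in> smooth_fun"
    and E: "\<And>x. (g has_derivative E x) (at x)" "\<And>v. (\<lambda>x. E x v) \<in> smooth_fun" by blast
  show ?case
    by (rule exI[of _ "\<lambda>x v. D x v + E x v"]) (auto intro!: smooth_fun.intros D E has_derivative_add)
next
  case (mult f g)
  then obtain D E where D: "\<And>x. (f has_derivative D x) (at x)" "\<And>v. (\<lambda>x. D x v) \<in> smooth_fun"
    and E: "\<And>x. (g has_derivative E x) (at x)" "\<And>v. (\<lambda>x. E x v) \<in> smooth_fun" by blast
  show ?case
    by (rule exI[of _ "\<lambda>x v. f x * E x v + D x v * g x"])
      (auto intro!: smooth_fun.intros D E mult has_derivative_mult)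
qed

lemma smooth_fun_prod:
  "finite I \<Longrightarrow> (\<And>i. i \<in> I \<Longrightarrow> f i \<in> smooth_fun) \<Longrightarrow> (\<lambda>x. \<Prod>i\<in>I. f i x) \<in> smooth_fun"
  by (induction I rule: finite_induct) (auto intro: smooth_fun.intros)

lemma smooth_fun_C_k: "f \<in> smooth_fun \<Longrightarrow> C_k k f"
proof (induction k arbitrary: f)
  case 0
  then obtain D where "\<And>x. (f has_derivative D x) (at x)" using smooth_fun_derivative by blast
  then show ?case
    by (auto intro!: continuous_at_imp_continuous_on has_derivative_continuous)
next
  case (Suc k)
  then obtain D where D: "\<And>x. (f has_derivative D x) (at x)" "\<And>v. (\<lambda>x. D x v) \<in> smooth_fun"
    using smooth_fun_derivative by blast
  have "frechet_derivative f (at x) = D x" for x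
    using frechet_derivative_at[OF D(1)] by simp
  then show ?case using D Suc.IH by (auto simp: differentiable_def)
qed

text \<open>The factor \<open>real n\<close> in the arguments pushes the bump to the indicator of
  the open box as \<open>n\<close> grows. The sums are written to fit the second rule of
  \<open>smooth_fun\<close>.\<close>

definition box_bump :: "'a::euclidean_space \<Rightarrow> 'a \<Rightarrow> nat \<Rightarrow> 'a \<Rightarrow> real" where
  "box_bump a b n x = (\<Prod>i\<in>Basis. exp_recip 1 (real n * (x \<bullet> i) + - real n * (a \<bullet> i))
      * exp_recip 1 (- real n * (x \<bullet> i) + real n * (b \<bullet> i)))"

lemma box_bump_eq_0: "x \<notin> box a b \<Longrightarrow> box_bump a b n x = 0"
proof -
  assume "x \<notin> box a b"
  then obtain i where i: "i \<in> Basis" "x \<bullet> i \<le> a \<bullet> i \<or> x \<bullet> i \<ge> b \<bullet> i"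
    by (auto simp: mem_box not_less)
  then have "exp_recip 1 (real n * (x \<bullet> i) + - real n * (a \<bullet> i))
      * exp_recip 1 (- real n * (x \<bullet> i) + real n * (b \<bullet> i)) = 0"
  proof (elim disjE)
    assume "x \<bullet> i \<le> a \<bullet> i"
    then have "real n * (x \<bullet> i) \<le> real n * (a \<bullet> i)" by (intro mult_left_mono) auto
    then show ?thesis by (simp add: exp_recip_def)
  next
    assume "x \<bullet> i \<ge> b \<bullet> i"
    then have "real n * (b \<bullet> i) \<le> real n * (x \<bullet> i)" by (intro mult_left_mono) auto
    then show ?thesis by (simp add: exp_recip_def)
  qed
  then show ?thesis unfolding box_bump_def using i(1) by (subst prod_zero_iff) auto
qed

lemma exp_recip_one_bounds: "0 \<le> exp_recip 1 t" "exp_recip 1 t \<le> 1"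
  by (auto simp: exp_recip_def)

lemma box_bump_bounds: "0 \<le> box_bump a b n x" "box_bump a b n x \<le> 1"
  unfolding box_bump_def
  by (auto intro!: prod_nonneg prod_le_1 mult_nonneg_nonneg mult_le_one exp_recip_one_bounds)

lemma test_function_box_bump: "test_function (box_bump a b n)"
proof -
  have "box_bump a b n \<in> smooth_fun"
    unfolding box_bump_def by (intro smooth_fun_prod smooth_fun.intros) auto
  moreover have "compact (closure {x. box_bump a b n x \<noteq> 0})"
  proof -
    have "{x. box_bump a b n x \<noteq> 0} \<subseteq> box a b" using box_bump_eq_0 by blast
    then have "bounded {x. box_bump a b n x \<noteq> 0}" using bounded_box bounded_subset by blast
    then show ?thesis by (simp add: compact_closure)
  qed
  ultimately show ?thesis by (simp add: test_function_def smooth_fun_C_k)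
qed

lemma exp_recip_one_tendsto:
  assumes "s > 0"
  shows "(\<lambda>n. exp_recip 1 (real n * s)) \<longlonglongrightarrow> 1"
proof -
  have "filterlim (\<lambda>n. s * real n) at_top sequentially"
    by (rule filterlim_tendsto_pos_mult_at_top[OF tendsto_const assms filterlim_real_sequentially])
  from tendsto_divide_0[OF tendsto_const[of "-1"] filterlim_at_top_imp_at_infinity[OF this]]
  have "(\<lambda>n. exp (- 1 / (s * real n))) \<longlonglongrightarrow> exp 0"
    by (intro tendsto_exp)
  then have "(\<lambda>n. exp (- 1 / (s * real n))) \<longlonglongrightarrow> 1" by simp
  then show ?thesis
  proof (rule Lim_transform_eventually)
    show "\<forall>\<^sub>F n in sequentially. exp (- 1 / (s * real n)) = exp_recip 1 (real n * s)"
      using eventually_gt_at_top[of 0]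
      by eventually_elim (use assms in \<open>auto simp: exp_recip_def mult.commute\<close>)
  qed
qed

lemma box_bump_tendsto: "(\<lambda>n. box_bump a b n x) \<longlonglongrightarrow> indicator (box a b) x"
proof (cases "x \<in> box a b")
  case True
  have "(\<lambda>n. \<Prod>i\<in>Basis. exp_recip 1 (real n * (x \<bullet> i - a \<bullet> i)) * exp_recip 1 (real n * (b \<bullet> i - x \<bullet> i)))
     \<longlonglongrightarrow> (\<Prod>i\<in>(Basis::'a set). 1 * 1)"
    using True by (intro tendsto_prod tendsto_mult exp_recip_one_tendsto) (auto simp: mem_box)
  then show ?thesis using True by (simp add: box_bump_def algebra_simps)
qed (simp add: box_bump_eq_0)

lemma square_integrable_indicator:
  fixes B :: "'a::euclidean_space set"
  assumes "bounded B" "B \<in> sets borel"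
  shows "square_integrable (indicator B :: 'a \<Rightarrow> real)"
proof (rule square_integrableI)
  have "integrable lborel (indicator B :: 'a \<Rightarrow> real)"
    using emeasure_bounded_finite[OF assms(1)] assms(2) by (simp add: integrable_indicator_iff)
  moreover have "(\<lambda>x. (norm (indicator B x :: real))\<^sup>2) = indicator B"
    by (auto simp: indicator_def)
  ultimately show "integrable lborel (\<lambda>x. (norm (indicator B x :: real))\<^sup>2)" by simp
qed (use assms in auto)

text \<open>Testing with bumps and passing to the limit, \<open>F\<close> integrates to zero over
  every open box. Its positive and negative parts are then densities of two measures that agree on
  boxes, an intersection-stable generator, so the densities agree almost everywhere.\<close>

lemma fundamental_lemma_calculus_of_variations:
  fixes F :: "'a::euclidean_space \<Rightarrow> real"
  assumes sq: "square_integrable F"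
    and orth: "\<And>\<phi>. test_function \<phi> \<Longrightarrow> (\<integral>x. F x * \<phi> x \<partial>lborel) = 0"
  shows "AE x in lborel. F x = 0"
proof -
  note [measurable] = square_integrable_measurable[OF sq]
  have int_box: "integrable lborel (\<lambda>x. F x * indicator (box a b) x)" for a b
    using integrable_inner[OF sq square_integrable_indicator[of "box a b"]] by simp
  have box0: "(\<integral>x. F x * indicator (box a b) x \<partial>lborel) = 0" for a b
  proof (rule LIMSEQ_unique)
    show "(\<lambda>n. \<integral>x. F x * box_bump a b n x \<partial>lborel) \<longlonglongrightarrow> 0"
      by (simp add: orth test_function_box_bump)
    show "(\<lambda>n. \<integral>x. F x * box_bump a b n x \<partial>lborel) \<longlonglongrightarrow> (\<integral>x. F x * indicator (box a b) x \<partial>lborel)"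
    proof (rule integral_dominated_convergence[where w = "\<lambda>x. norm (F x * indicator (box a b) x)"])
      show "(\<lambda>x. F x * box_bump a b n x) \<in> borel_measurable lborel" for n
      proof -
        have "box_bump a b n \<in> borel_measurable borel"
          using test_function_box_bump[of a b n]
          by (intro borel_measurable_continuous_onI) (auto simp: test_function_def dest: spec[of _ 0])
        then show ?thesis by measurable
      qed
      show "AE x in lborel. (\<lambda>n. F x * box_bump a b n x) \<longlonglongrightarrow> F x * indicator (box a b) x"
        by (intro AE_I2 tendsto_intros box_bump_tendsto)
      show "AE x in lborel. norm (F x * box_bump a b n x) \<le> norm (F x * indicator (box a b) x)" for n
        by (intro AE_I2) (auto simp: indicator_def box_bump_eq_0 box_bump_bounds abs_mult intro!: mult_left_le)
    qed (use int_box in auto)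
  qed
  define P where "P x = ennreal (F x)" for x
  define N where "N x = ennreal (- F x)" for x
  have [measurable]: "P \<in> borel_measurable borel" "N \<in> borel_measurable borel"
    unfolding P_def N_def by measurable
  \<comment> \<open>Finiteness on boxes is what converts a vanishing real integral into equality of
    the extended integrals of the two parts.\<close>
  have fin: "(\<integral>\<^sup>+x. P x * indicator (box a b) x \<partial>lborel) < \<infinity>"
      "(\<integral>\<^sup>+x. P x * indicator (box a b) x \<partial>lborel) = (\<integral>\<^sup>+x. N x * indicator (box a b) x \<partial>lborel)" for a b
  proof -
    let ?f = "\<lambda>x. F x * indicator (box a b) x"
    have eqs: "P x * indicator (box a b) x = ennreal (?f x)" "N x * indicator (box a b) x = ennreal (- ?f x)" for x
      by (auto simp: P_def N_def indicator_def)
    have f: "(\<integral>\<^sup>+x. ennreal (?f x) \<partial>lborel) < \<infinity>" "(\<integral>\<^sup>+x. ennreal (- ?f x) \<partial>lborel) < \<infinity>"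
      using int_box[of a b] by (auto simp: real_integrable_def less_top)
    have "enn2real (\<integral>\<^sup>+x. ennreal (?f x) \<partial>lborel) = enn2real (\<integral>\<^sup>+x. ennreal (- ?f x) \<partial>lborel)"
      using real_lebesgue_integral_def[OF int_box[of a b]] box0[of a b] by simp
    with f show "(\<integral>\<^sup>+x. P x * indicator (box a b) x \<partial>lborel) < \<infinity>"
      "(\<integral>\<^sup>+x. P x * indicator (box a b) x \<partial>lborel) = (\<integral>\<^sup>+x. N x * indicator (box a b) x \<partial>lborel)"
      unfolding eqs by (metis ennreal_enn2real infinity_ennreal_def)+
  qed
  have "density lborel P = density lborel N"
  proof (rule measure_eqI_generator_eq[where E = "range (\<lambda>(a, b). box a b :: 'a set)" and \<Omega> = UNIV
        and A = "\<lambda>n. box (- (real n *\<^sub>R One)) (real n *\<^sub>R One)"])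
    show "Int_stable (range (\<lambda>(a, b). box a b :: 'a set))"
      by (force intro!: Int_stableI simp: Int_interval box_Int_box)
    show "sets (density lborel P) = sigma_sets UNIV (range (\<lambda>(a, b). box a b :: 'a set))"
      "sets (density lborel N) = sigma_sets UNIV (range (\<lambda>(a, b). box a b :: 'a set))"
      by (simp_all add: borel_eq_box)
    show "(\<Union>i. box (- (real i *\<^sub>R One)) (real i *\<^sub>R One)) = (UNIV :: 'a set)"
      using UN_box_eq_UNIV by simp
    show "emeasure (density lborel P) (box (- (real i *\<^sub>R One)) (real i *\<^sub>R One)) \<noteq> \<infinity>" for i
      using fin(1) by (simp add: emeasure_density less_top)
    show "emeasure (density lborel P) X = emeasure (density lborel N) X"
      if "X \<in> range (\<lambda>(a, b). box a b :: 'a set)" for X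
      using that by (auto simp: emeasure_density fin(2))
  qed auto
  then have "AE x in lborel. P x = N x"
    by (intro sigma_finite_measure.density_unique[OF lborel.sigma_finite_measure_axioms]) auto
  then show ?thesis
  proof eventually_elim
    case (elim x)
    then show "F x = 0"
      by (cases "F x > 0"; cases "F x < 0") (auto simp: P_def N_def ennreal_neg)
  qed
qed

section \<open>Weak gradients\<close>

lemma lborel_distr_translate: "distr lborel borel (\<lambda>x. x + a) = (lborel :: 'a::euclidean_space measure)"
proof -
  have "lborel = density (distr lborel borel (\<lambda>x::'a. a + 1 *\<^sub>R x)) (\<lambda>_. ennreal (\<bar>1\<bar> ^ DIM('a)))"
    by (rule lborel_affine) simp
  then show ?thesis by (simp add: density_1 add.commute)
qed

lemma nn_integral_translate:
  fixes f :: "'a::euclidean_space \<Rightarrow> ennreal"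
  assumes [measurable]: "f \<in> borel_measurable borel"
  shows "(\<integral>\<^sup>+x. f (x + a) \<partial>lborel) = (\<integral>\<^sup>+x. f x \<partial>lborel)"
  by (subst (2) lborel_distr_translate[of a, symmetric]) (simp add: nn_integral_distr)

lemma integral_translate:
  fixes f :: "'a::euclidean_space \<Rightarrow> real"
  assumes [measurable]: "f \<in> borel_measurable borel"
  shows "(\<integral>x. f (x + a) \<partial>lborel) = (\<integral>x. f x \<partial>lborel)"
  by (subst (2) lborel_distr_translate[of a, symmetric]) (simp add: integral_distr)

lemma square_integrable_translate:
  fixes f :: "'a::euclidean_space \<Rightarrow> 'b::euclidean_space"
  assumes "square_integrable f"
  shows "square_integrable (\<lambda>x. f (x + a))"
    "L2_inner (\<lambda>x. f (x + a)) (\<lambda>x. f (x + a)) = L2_inner f f"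
proof -
  note [measurable] = square_integrable_measurable[OF assms]
  have "(\<integral>\<^sup>+x. ennreal ((norm (f (x + a)))\<^sup>2) \<partial>lborel) = ennreal (L2_inner f f)"
    using nn_integral_translate[of "\<lambda>x. ennreal ((norm (f x))\<^sup>2)" a] by (simp add: nn_integral_norm_sq assms)
  then show "square_integrable (\<lambda>x. f (x + a))"
    by (intro square_integrable_nn_integralI(1)[of _ "L2_inner f f"]) auto
  show "L2_inner (\<lambda>x. f (x + a)) (\<lambda>x. f (x + a)) = L2_inner f f"
    unfolding L2_inner_def by (rule integral_translate) measurable
qed

lemma frechet_derivative_translate:
  assumes "f differentiable (at (x + a))"
  shows "(\<lambda>x. f (x + a)) differentiable (at x)"
    "frechet_derivative (\<lambda>x. f (x + a)) (at x) = frechet_derivative f (at (x + a))"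
proof -
  have D: "((\<lambda>x. f (x + a)) has_derivative frechet_derivative f (at (x + a))) (at x)"
  proof (rule has_derivative_compose[of "\<lambda>x. x + a" "\<lambda>v. v" x UNIV f "frechet_derivative f (at (x + a))"])
    show "((\<lambda>x. x + a) has_derivative (\<lambda>v. v)) (at x)"
      by (auto intro!: derivative_eq_intros)
    show "(f has_derivative frechet_derivative f (at (x + a))) (at (x + a))"
      using assms by (simp add: frechet_derivative_works)
  qed
  then show "(\<lambda>x. f (x + a)) differentiable (at x)" by (auto simp: differentiable_def)
  show "frechet_derivative (\<lambda>x. f (x + a)) (at x) = frechet_derivative f (at (x + a))"
    using frechet_derivative_at[OF D] by simp
qed

lemma C_k_translate: "C_k k f \<Longrightarrow> C_k k (\<lambda>x. f (x + a))"
proof (induction k arbitrary: f)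
  case 0
  then show ?case by (auto intro!: continuous_on_compose2[of UNIV f] continuous_intros)
next
  case (Suc k)
  then show ?case by (auto simp: frechet_derivative_translate)
qed

lemma test_function_translate:
  assumes "test_function \<phi>"
  shows "test_function (\<lambda>x. \<phi> (x + a))"
proof -
  let ?K = "(\<lambda>x. -a + x) ` closure {x. \<phi> x \<noteq> 0}"
  have K: "compact ?K"
    using assms by (intro compact_translation) (simp add: test_function_def)
  have "{x. \<phi> (x + a) \<noteq> 0} \<subseteq> ?K"
  proof
    fix x assume "x \<in> {x. \<phi> (x + a) \<noteq> 0}"
    then have "x + a \<in> closure {x. \<phi> x \<noteq> 0}" using closure_subset by fastforce
    then show "x \<in> ?K" by (intro image_eqI[of _ _ "x + a"]) auto
  qed
  then have "bounded {x. \<phi> (x + a) \<noteq> 0}" using bounded_subset compact_imp_bounded[OF K] by blast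
  then show ?thesis using assms by (auto simp: test_function_def C_k_translate compact_closure)
qed

lemma square_integrable_compact_support:
  fixes f :: "'a::euclidean_space \<Rightarrow> real"
  assumes "continuous_on UNIV f" "compact K" "\<And>x. x \<notin> K \<Longrightarrow> f x = 0"
  shows "square_integrable f"
proof -
  have "bounded (f ` K)"
    using assms(1,2) by (intro compact_imp_bounded compact_continuous_image) (auto intro: continuous_on_subset)
  then obtain B where B: "\<And>x. x \<in> K \<Longrightarrow> norm (f x) \<le> B"
    by (auto simp: bounded_iff)
  have [measurable]: "f \<in> borel_measurable borel" by (rule borel_measurable_continuous_onI[OF assms(1)])
  show ?thesis
  proof (rule square_integrable_bound[of "\<lambda>x. B * indicator K x :: real"])
    show "square_integrable (\<lambda>x. B * indicator K x :: real)"
      using assms(2) by (intro square_integrable_mult square_integrable_indicator)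
        (auto intro: compact_imp_bounded compact_imp_closed borel_closed)
    show "AE x in lborel. norm (f x) \<le> norm (B * indicator K x :: real)"
      using B assms(3) by (intro AE_I2) (force simp: indicator_def)
  qed measurable
qed

lemma test_function_props:
  fixes \<phi> :: "'a::euclidean_space \<Rightarrow> real"
  assumes "test_function \<phi>"
  shows test_function_has_derivative: "(\<phi> has_derivative frechet_derivative \<phi> (at x)) (at x)"
    and test_function_square_integrable: "square_integrable \<phi>"
    and test_function_derivative_eq:
      "frechet_derivative \<phi> (at x) v = (\<Sum>e\<in>Basis. (v \<bullet> e) * frechet_derivative \<phi> (at x) e)"
    and test_function_derivative_continuous: "continuous_on UNIV (\<lambda>x. frechet_derivative \<phi> (at x) v)"
    and test_function_derivative_square_integrable: "square_integrable (\<lambda>x. frechet_derivative \<phi> (at x) v)"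
proof -
  have C: "C_k k \<phi>" for k using assms by (simp add: test_function_def)
  let ?K = "closure {x. \<phi> x \<noteq> 0}"
  have K: "compact ?K" using assms by (simp add: test_function_def)
  have diff: "\<phi> differentiable (at x)" for x using C[of 1] by simp
  then show der: "(\<phi> has_derivative frechet_derivative \<phi> (at x)) (at x)" for x
    using frechet_derivative_works by blast
  show "square_integrable \<phi>"
  proof (rule square_integrable_compact_support[OF _ K])
    show "continuous_on UNIV \<phi>" using C[of 0] by simp
    show "x \<notin> ?K \<Longrightarrow> \<phi> x = 0" for x using closure_subset[of "{x. \<phi> x \<noteq> 0}"] by auto
  qed
  show eq: "frechet_derivative \<phi> (at x) v = (\<Sum>e\<in>Basis. (v \<bullet> e) * frechet_derivative \<phi> (at x) e)" for x v
  proof -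
    interpret linear "frechet_derivative \<phi> (at x)"
      by (rule linear_frechet_derivative[OF diff])
    have "frechet_derivative \<phi> (at x) v = frechet_derivative \<phi> (at x) (\<Sum>e\<in>Basis. (v \<bullet> e) *\<^sub>R e)"
      by (simp add: euclidean_representation)
    also have "\<dots> = (\<Sum>e\<in>Basis. (v \<bullet> e) * frechet_derivative \<phi> (at x) e)"
      by (simp add: sum scale)
    finally show ?thesis .
  qed
  show cont: "continuous_on UNIV (\<lambda>x. frechet_derivative \<phi> (at x) v)"
  proof -
    have "continuous_on UNIV (\<lambda>x. frechet_derivative \<phi> (at x) e)" if "e \<in> Basis" for e
      using C[of 1] that by simp
    then show ?thesis by (subst eq) (intro continuous_intros)
  qed
  show "square_integrable (\<lambda>x. frechet_derivative \<phi> (at x) v)"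
  proof (rule square_integrable_compact_support[OF cont K])
    fix x assume "x \<notin> ?K"
    then have x: "x \<in> - ?K" by simp
    \<comment> \<open>Off the closed support \<phi> vanishes on a whole neighbourhood, so its
      derivative there is that of the zero function.\<close>
    have "((\<lambda>_. 0) has_derivative frechet_derivative \<phi> (at x)) (at x)"
    proof (rule has_derivative_transform_within_open[OF der _ x])
      show "open (- ?K)" by auto
      show "y \<in> - ?K \<Longrightarrow> \<phi> y = 0" for y using closure_subset[of "{x. \<phi> x \<noteq> 0}"] by auto
    qed
    then have "frechet_derivative \<phi> (at x) = (\<lambda>_. 0)"
      using has_derivative_unique has_derivative_const by blast
    then show "frechet_derivative \<phi> (at x) v = 0" by simp
  qed
qed

section \<open>Calculus of weak gradients\<close>

lemma weak_gradient_iff: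
  "weak_gradient u g \<longleftrightarrow> (\<forall>\<phi>. test_function \<phi> \<longrightarrow> (\<forall>e\<in>Basis.
     L2_inner u (\<lambda>x. frechet_derivative \<phi> (at x) e) = - L2_inner (\<lambda>x. g x \<bullet> e) \<phi>))"
  by (simp add: weak_gradient_def L2_inner_def)

lemma square_integrable_component:
  assumes "square_integrable g"
  shows "square_integrable (\<lambda>x. g x \<bullet> v)"
proof (rule square_integrable_bound[of "\<lambda>x. norm v *\<^sub>R g x"])
  note [measurable] = square_integrable_measurable[OF assms]
  show "(\<lambda>x. g x \<bullet> v) \<in> borel_measurable lborel" by measurable
  show "AE x in lborel. norm (g x \<bullet> v) \<le> norm (norm v *\<^sub>R g x)"
    using Cauchy_Schwarz_ineq2[of "g _" v] by (intro AE_I2) (simp add: mult.commute[of "norm v"])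
qed (intro square_integrable_scale assms)

text \<open>The definition tests coordinate directions. Difference quotients need the direction of
  an arbitrary shift, which linearity of the derivative provides.\<close>

lemma weak_gradient_all_directions:
  assumes "weak_gradient u g" "square_integrable u" "square_integrable g" "test_function \<phi>"
  shows "L2_inner u (\<lambda>x. frechet_derivative \<phi> (at x) v) = - L2_inner (\<lambda>x. g x \<bullet> v) \<phi>"
proof -
  note int = integrable_inner[OF assms(2) test_function_derivative_square_integrable[OF assms(4)], simplified]
  note int' = integrable_inner[OF square_integrable_component[OF assms(3)] test_function_square_integrable[OF assms(4)], simplified]
  have "L2_inner u (\<lambda>x. frechet_derivative \<phi> (at x) v)
      = (\<integral>x. (\<Sum>e\<in>Basis. (v \<bullet> e) * (u x * frechet_derivative \<phi> (at x) e)) \<partial>lborel)"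
    unfolding L2_inner_def by (subst test_function_derivative_eq[OF assms(4)]) (simp add: sum_distrib_left mult_ac)
  also have "\<dots> = (\<Sum>e\<in>Basis. (v \<bullet> e) * L2_inner u (\<lambda>x. frechet_derivative \<phi> (at x) e))"
    unfolding L2_inner_def by (subst Bochner_Integration.integral_sum) (auto intro!: int)
  also have "\<dots> = (\<Sum>e\<in>Basis. (v \<bullet> e) * - L2_inner (\<lambda>x. g x \<bullet> e) \<phi>)"
    using assms(1,4) by (simp add: weak_gradient_iff)
  also have "\<dots> = - (\<integral>x. (\<Sum>e\<in>Basis. (v \<bullet> e) * ((g x \<bullet> e) * \<phi> x)) \<partial>lborel)"
    unfolding L2_inner_def by (subst Bochner_Integration.integral_sum) (auto intro!: int' simp: sum_negf)
  also have "(\<lambda>x. \<Sum>e\<in>Basis. (v \<bullet> e) * ((g x \<bullet> e) * \<phi> x)) = (\<lambda>x. (g x \<bullet> v) * \<phi> x)"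
    by (simp add: sum_distrib_right sum_distrib_left euclidean_inner[of _ v] mult_ac)
  finally show ?thesis by (simp add: L2_inner_def)
qed

lemma weak_gradient_unique:
  fixes u :: "'a::euclidean_space \<Rightarrow> real"
  assumes "weak_gradient u g" "weak_gradient u h" "square_integrable g" "square_integrable h"
  shows "AE x in lborel. g x = h x"
proof -
  have "AE x in lborel. (g x - h x) \<bullet> e = 0" if "e \<in> Basis" for e
  proof (rule fundamental_lemma_calculus_of_variations)
    show "square_integrable (\<lambda>x. (g x - h x) \<bullet> e)"
      by (intro square_integrable_component square_integrable_diff assms)
    fix \<phi> :: "'a \<Rightarrow> real" assume phi: "test_function \<phi>"
    have "L2_inner (\<lambda>x. g x \<bullet> e) \<phi> = L2_inner (\<lambda>x. h x \<bullet> e) \<phi>"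
      using assms(1,2) phi that by (simp add: weak_gradient_iff)
    moreover have "(\<integral>x. (g x - h x) \<bullet> e * \<phi> x \<partial>lborel) = L2_inner (\<lambda>x. g x \<bullet> e - h x \<bullet> e) \<phi>"
      by (simp add: L2_inner_def inner_diff_left)
    ultimately show "(\<integral>x. (g x - h x) \<bullet> e * \<phi> x \<partial>lborel) = 0"
      by (simp add: L2_inner_diff_left square_integrable_component test_function_square_integrable phi assms)
  qed
  then have "AE x in lborel. \<forall>e\<in>Basis. (g x - h x) \<bullet> e = 0"
    by (simp add: AE_ball_countable countable_finite)
  then show ?thesis
  proof eventually_elim
    case (elim x)
    then have "g x - h x = 0" using euclidean_eqI[of "g x - h x" 0] by simp
    then show ?case by simp
  qed
qed

lemma weak_gradient_add:
  assumes "weak_gradient u g" "weak_gradient v h"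
    and "square_integrable u" "square_integrable v" "square_integrable g" "square_integrable h"
  shows "weak_gradient (\<lambda>x. u x + v x) (\<lambda>x. g x + h x)"
  using assms by (auto simp: weak_gradient_iff inner_add_left L2_inner_add_left
      square_integrable_component test_function_square_integrable test_function_derivative_square_integrable)

lemma weak_gradient_mult:
  assumes "weak_gradient u g"
  shows "weak_gradient (\<lambda>x. r * u x) (\<lambda>x. r *\<^sub>R g x)"
  unfolding weak_gradient_iff
proof (intro allI impI ballI)
  fix \<phi> :: "'a \<Rightarrow> real" and e :: 'a assume phi: "test_function \<phi>" and e: "e \<in> Basis"
  have "L2_inner u (\<lambda>x. frechet_derivative \<phi> (at x) e) = - L2_inner (\<lambda>x. g x \<bullet> e) \<phi>"
    using assms phi e unfolding weak_gradient_iff by blast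
  moreover have "L2_inner (\<lambda>x. r * u x) (\<lambda>x. frechet_derivative \<phi> (at x) e)
      = r * L2_inner u (\<lambda>x. frechet_derivative \<phi> (at x) e)"
    using L2_inner_scale_left[of r u] by simp
  moreover have "L2_inner (\<lambda>x. (r *\<^sub>R g x) \<bullet> e) \<phi> = r * L2_inner (\<lambda>x. g x \<bullet> e) \<phi>"
    using L2_inner_scale_left[of r "\<lambda>x. g x \<bullet> e"] by simp
  ultimately show "L2_inner (\<lambda>x. r * u x) (\<lambda>x. frechet_derivative \<phi> (at x) e)
      = - L2_inner (\<lambda>x. (r *\<^sub>R g x) \<bullet> e) \<phi>" by simp
qed

lemma weak_gradient_translate:
  assumes "weak_gradient u g" "square_integrable u" "square_integrable g"
  shows "weak_gradient (\<lambda>x. u (x + a)) (\<lambda>x. g (x + a))"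
  unfolding weak_gradient_iff
proof (intro allI impI ballI)
  fix \<phi> :: "'a \<Rightarrow> real" and e :: 'a assume phi: "test_function \<phi>" and e: "e \<in> Basis"
  note [measurable] = assms(2,3)[THEN square_integrable_measurable]
    test_function_square_integrable[OF phi, THEN square_integrable_measurable]
    test_function_derivative_square_integrable[OF phi, THEN square_integrable_measurable]
  let ?\<psi> = "\<lambda>x. \<phi> (x + - a)"
  have psi: "test_function ?\<psi>" by (rule test_function_translate[OF phi])
  have "\<phi> differentiable (at x)" for x
    using test_function_has_derivative[OF phi] by (auto simp: differentiable_def)
  then have D: "frechet_derivative ?\<psi> (at x) = frechet_derivative \<phi> (at (x + - a))" for x
    by (rule frechet_derivative_translate)
  have "L2_inner (\<lambda>x. u (x + a)) (\<lambda>x. frechet_derivative \<phi> (at x) e)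
      = L2_inner u (\<lambda>x. frechet_derivative ?\<psi> (at x) e)"
    unfolding L2_inner_def D
    using integral_translate[of "\<lambda>x. u x \<bullet> frechet_derivative \<phi> (at (x + - a)) e" a] by simp
  also have "\<dots> = - L2_inner (\<lambda>x. g x \<bullet> e) ?\<psi>"
    using assms(1) psi e unfolding weak_gradient_iff by blast
  also have "L2_inner (\<lambda>x. g x \<bullet> e) ?\<psi> = L2_inner (\<lambda>x. g (x + a) \<bullet> e) \<phi>"
    unfolding L2_inner_def
    using integral_translate[of "\<lambda>x. (g x \<bullet> e) \<bullet> \<phi> (x + - a)" a] by simp
  finally show "L2_inner (\<lambda>x. u (x + a)) (\<lambda>x. frechet_derivative \<phi> (at x) e) = - L2_inner (\<lambda>x. g (x + a) \<bullet> e) \<phi>" .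
qed

text \<open>For a fixed test function both sides of the defining identity are inner products against
  fixed square integrable functions, hence continuous under convergence in the mean.\<close>

lemma weak_gradient_limit:
  fixes u :: "nat \<Rightarrow> 'a::euclidean_space \<Rightarrow> real"
  assumes "\<And>n. weak_gradient (u n) (g n)" "\<And>n. square_integrable (u n)" "\<And>n. square_integrable (g n)"
    and U: "square_integrable U" "square_integrable G"
    and "(\<lambda>n. L2_inner (\<lambda>x. u n x - U x) (\<lambda>x. u n x - U x)) \<longlonglongrightarrow> 0"
    and "(\<lambda>n. L2_inner (\<lambda>x. g n x - G x) (\<lambda>x. g n x - G x)) \<longlonglongrightarrow> 0"
  shows "weak_gradient U G"
  unfolding weak_gradient_iff
proof (intro allI impI ballI)
  fix \<phi> :: "'a \<Rightarrow> real" and e :: 'a assume phi: "test_function \<phi>" and e: "e \<in> Basis"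
  note phi' = test_function_square_integrable[OF phi] test_function_derivative_square_integrable[OF phi]
  \<comment> \<open>Shifts the direction \<open>e\<close> to the test function, so that
    \<open>L2_inner_tendsto\<close> applies to the vector-valued \<open>g n\<close>
    directly.\<close>
  have move: "L2_inner (\<lambda>x. h x \<bullet> e) \<phi> = L2_inner h (\<lambda>x. \<phi> x *\<^sub>R e)" for h
    by (simp add: L2_inner_def mult.commute)
  have phie: "square_integrable (\<lambda>x. \<phi> x *\<^sub>R e)"
  proof (rule square_integrable_bound[OF phi'(1)])
    note [measurable] = square_integrable_measurable[OF phi'(1)]
    show "(\<lambda>x. \<phi> x *\<^sub>R e) \<in> borel_measurable lborel" by measurable
  qed (use e in auto)
  have "(\<lambda>n. L2_inner (u n) (\<lambda>x. frechet_derivative \<phi> (at x) e)) \<longlonglongrightarrow> L2_inner U (\<lambda>x. frechet_derivative \<phi> (at x) e)"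
    by (intro L2_inner_tendsto assms phi')
  moreover have "L2_inner (u n) (\<lambda>x. frechet_derivative \<phi> (at x) e) = - L2_inner (g n) (\<lambda>x. \<phi> x *\<^sub>R e)" for n
    using assms(1)[of n] phi e unfolding weak_gradient_iff move[symmetric] by blast
  moreover have "(\<lambda>n. - L2_inner (g n) (\<lambda>x. \<phi> x *\<^sub>R e)) \<longlonglongrightarrow> - L2_inner G (\<lambda>x. \<phi> x *\<^sub>R e)"
    by (intro tendsto_minus L2_inner_tendsto assms phie)
  ultimately show "L2_inner U (\<lambda>x. frechet_derivative \<phi> (at x) e) = - L2_inner (\<lambda>x. G x \<bullet> e) \<phi>"
    unfolding move using LIMSEQ_unique by simp
qed

section \<open>Difference quotients\<close>

lemma integrable_translated_product:
  fixes p q :: "'a::euclidean_space \<Rightarrow> real"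
  assumes "square_integrable p" "square_integrable q"
  shows "integrable (lborel \<Otimes>\<^sub>M lborel) (\<lambda>(x, s). indicator {0..1::real} s * (p (x + s *\<^sub>R a) * q (x + s *\<^sub>R b)))"
proof (rule integrableI_bounded)
  note [measurable] = assms[THEN square_integrable_measurable]
  show meas: "(\<lambda>(x, s). indicator {0..1::real} s * (p (x + s *\<^sub>R a) * q (x + s *\<^sub>R b)))
      \<in> borel_measurable (lborel \<Otimes>\<^sub>M lborel)"
    by measurable
  have abs: "square_integrable (\<lambda>x. \<bar>p x\<bar>)" "square_integrable (\<lambda>x. \<bar>q x\<bar>)"
    using assms by (auto simp: square_integrable_def)
  \<comment> \<open>By Cauchy-Schwarz and translation invariance this bounds the integral over
    \<open>x\<close> for every \<open>s\<close>, and \<open>s\<close> runs through an interval of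
    length one.\<close>
  define C where "C = sqrt (L2_inner p p) * sqrt (L2_inner q q)"
  have "(\<integral>\<^sup>+x. ennreal (norm (case x of (x, s) \<Rightarrow> indicator {0..1::real} s * (p (x + s *\<^sub>R a) * q (x + s *\<^sub>R b)))) \<partial>(lborel \<Otimes>\<^sub>M lborel))
    = (\<integral>\<^sup>+s. \<integral>\<^sup>+x. ennreal (norm (indicator {0..1::real} s * (p (x + s *\<^sub>R a) * q (x + s *\<^sub>R b)))) \<partial>lborel \<partial>lborel)"
    by (subst lborel_pair.nn_integral_snd[symmetric]) auto
  also have "\<dots> \<le> (\<integral>\<^sup>+s. ennreal C * indicator {0..1::real} s \<partial>lborel)"
  proof (rule nn_integral_mono)
    fix s :: real
    note tr = square_integrable_translate[OF abs(1), of "s *\<^sub>R a"] square_integrable_translate[OF abs(2), of "s *\<^sub>R b"]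
    have "(\<integral>\<^sup>+x. ennreal (\<bar>p (x + s *\<^sub>R a)\<bar> * \<bar>q (x + s *\<^sub>R b)\<bar>) \<partial>lborel)
        = ennreal (L2_inner (\<lambda>x. \<bar>p (x + s *\<^sub>R a)\<bar>) (\<lambda>x. \<bar>q (x + s *\<^sub>R b)\<bar>))"
      unfolding L2_inner_def inner_real_def
      by (rule nn_integral_eq_integral) (use integrable_inner[OF tr(1,3)] in auto)
    also have "\<dots> \<le> ennreal C"
    proof (rule ennreal_leI)
      have "L2_inner (\<lambda>x. \<bar>p x\<bar>) (\<lambda>x. \<bar>p x\<bar>) = L2_inner p p" "L2_inner (\<lambda>x. \<bar>q x\<bar>) (\<lambda>x. \<bar>q x\<bar>) = L2_inner q q"
        by (simp_all add: L2_inner_def)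
      then show "L2_inner (\<lambda>x. \<bar>p (x + s *\<^sub>R a)\<bar>) (\<lambda>x. \<bar>q (x + s *\<^sub>R b)\<bar>) \<le> C"
        using L2_Cauchy_Schwarz[OF tr(1,3)] tr(2,4) by (simp add: C_def)
    qed
    finally show "(\<integral>\<^sup>+x. ennreal (norm (indicator {0..1::real} s * (p (x + s *\<^sub>R a) * q (x + s *\<^sub>R b)))) \<partial>lborel)
        \<le> ennreal C * indicator {0..1::real} s"
      by (auto simp: indicator_def abs_mult)
  qed
  also have "\<dots> < \<infinity>" by (simp add: nn_integral_cmult)
  finally show "(\<integral>\<^sup>+x. ennreal (norm (case x of (x, s) \<Rightarrow> indicator {0..1::real} s * (p (x + s *\<^sub>R a) * q (x + s *\<^sub>R b)))) \<partial>(lborel \<Otimes>\<^sub>M lborel)) < \<infinity>" .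
qed

text \<open>Cauchy-Schwarz against the indicator. The extended right-hand side lets it be applied
  before anything is known about integrability of \<open>f\<close> on \<open>A\<close>.\<close>

lemma integral_indicator_sq_le:
  fixes f :: "'a::euclidean_space \<Rightarrow> real"
  assumes [measurable]: "A \<in> sets borel" "f \<in> borel_measurable borel"
  shows "ennreal ((\<integral>y. indicator A y * f y \<partial>lborel)\<^sup>2) \<le> emeasure lborel A * (\<integral>\<^sup>+y. indicator A y * ennreal ((f y)\<^sup>2) \<partial>lborel)"
proof -
  let ?f = "\<lambda>y. indicator A y * f y"
  have "ennreal (norm (\<integral>y. ?f y \<partial>lborel)) \<le> (\<integral>\<^sup>+y. ennreal (norm (?f y)) \<partial>lborel)"
    \<comment> \<open>Without integrability the Bochner integral is \<open>0\<close> by convention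
      and the bound is trivial.\<close>
    by (cases "integrable lborel ?f")
      (auto simp: not_integrable_integral_eq intro: integral_norm_bound_ennreal[of lborel ?f, simplified])
  also have "\<dots> = (\<integral>\<^sup>+y. indicator A y * ennreal (norm (?f y)) \<partial>lborel)"
    by (intro nn_integral_cong) (auto simp: indicator_def)
  finally have "(ennreal (norm (\<integral>y. ?f y \<partial>lborel)))\<^sup>2 \<le> (\<integral>\<^sup>+y. indicator A y * ennreal (norm (?f y)) \<partial>lborel)\<^sup>2"
    by (rule power_mono) simp
  also have "\<dots> \<le> (\<integral>\<^sup>+y. (indicator A y)\<^sup>2 \<partial>lborel) * (\<integral>\<^sup>+y. (ennreal (norm (?f y)))\<^sup>2 \<partial>lborel)"
    by (rule Cauchy_Schwarz_nn_integral) auto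
  also have "(\<integral>\<^sup>+y. (indicator A y)\<^sup>2 \<partial>lborel) = (\<integral>\<^sup>+y. indicator A y \<partial>lborel)"
    by (intro nn_integral_cong) (auto simp: indicator_def)
  also have "\<dots> = emeasure lborel A" by simp
  also have "(\<integral>\<^sup>+y. (ennreal (norm (?f y)))\<^sup>2 \<partial>lborel) = (\<integral>\<^sup>+y. indicator A y * ennreal ((f y)\<^sup>2) \<partial>lborel)"
    by (intro nn_integral_cong) (auto simp: indicator_def ennreal_power)
  finally show ?thesis by (simp add: ennreal_power)
qed

text \<open>Averaging translates along a segment does not increase the norm: Jensen's inequality in
  \<open>s\<close>, then Fubini and translation invariance.\<close>

lemma segment_average_bound:
  fixes p :: "'a::euclidean_space \<Rightarrow> real" and h :: 'a
  assumes "square_integrable p"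
  defines "G \<equiv> \<lambda>x. \<integral>s. indicator {0..1::real} s * p (x + s *\<^sub>R h) \<partial>lborel"
  shows "square_integrable G" "L2_inner G G \<le> L2_inner p p"
proof -
  note [measurable] = square_integrable_measurable[OF assms(1)]
  have [measurable]: "G \<in> borel_measurable borel" unfolding G_def by measurable
  have pt: "ennreal ((norm (G x))\<^sup>2) \<le> (\<integral>\<^sup>+s. indicator {0..1::real} s * ennreal ((p (x + s *\<^sub>R h))\<^sup>2) \<partial>lborel)" for x
    using integral_indicator_sq_le[of "{0..1::real}" "\<lambda>s. p (x + s *\<^sub>R h)"] by (simp add: G_def)
  have "(\<integral>\<^sup>+x. ennreal ((norm (G x))\<^sup>2) \<partial>lborel)
      \<le> (\<integral>\<^sup>+x. \<integral>\<^sup>+s. indicator {0..1::real} s * ennreal ((p (x + s *\<^sub>R h))\<^sup>2) \<partial>lborel \<partial>lborel)"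
    by (intro nn_integral_mono pt)
  also have "\<dots> = (\<integral>\<^sup>+s. \<integral>\<^sup>+x. indicator {0..1::real} s * ennreal ((p (x + s *\<^sub>R h))\<^sup>2) \<partial>lborel \<partial>lborel)"
    by (rule lborel_pair.Fubini'[symmetric]) measurable
  also have "\<dots> = (\<integral>\<^sup>+s. ennreal (L2_inner p p) * indicator {0..1::real} s \<partial>lborel)"
  proof (intro nn_integral_cong)
    fix s :: real
    have "(\<integral>\<^sup>+x. ennreal ((p (x + s *\<^sub>R h))\<^sup>2) \<partial>lborel) = ennreal (L2_inner p p)"
      using nn_integral_translate[of "\<lambda>x. ennreal ((p x)\<^sup>2)" "s *\<^sub>R h"] nn_integral_norm_sq[OF assms(1)] by simp
    then show "(\<integral>\<^sup>+x. indicator {0..1::real} s * ennreal ((p (x + s *\<^sub>R h))\<^sup>2) \<partial>lborel)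
        = ennreal (L2_inner p p) * indicator {0..1::real} s"
      by (simp add: nn_integral_cmult mult.commute)
  qed
  also have "\<dots> = ennreal (L2_inner p p)" by (simp add: nn_integral_cmult)
  finally have *: "(\<integral>\<^sup>+x. ennreal ((norm (G x))\<^sup>2) \<partial>lborel) \<le> ennreal (L2_inner p p)" .
  have "G \<in> borel_measurable lborel" by simp
  from square_integrable_nn_integralI[OF this *]
  show "square_integrable G" "L2_inner G G \<le> L2_inner p p" by auto
qed

lemma test_function_difference:
  fixes \<phi> :: "'a::euclidean_space \<Rightarrow> real"
  assumes "test_function \<phi>"
  shows "\<phi> (x + - h) - \<phi> x = - (\<integral>s. indicator {0..1::real} s * frechet_derivative \<phi> (at (x + s *\<^sub>R (- h))) h \<partial>lborel)"
proof -
  let ?D = "\<lambda>s. frechet_derivative \<phi> (at (x + s *\<^sub>R (- h))) (- h)"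
  have "(\<integral>s. indicator {0..1::real} s *\<^sub>R ?D s \<partial>lborel) = \<phi> (x + 1 *\<^sub>R (- h)) - \<phi> (x + 0 *\<^sub>R (- h))"
  proof (rule integral_FTC_Icc)
    fix s :: real assume "0 \<le> s" "s \<le> 1"
    have "((\<lambda>s. x + s *\<^sub>R (- h)) has_derivative (\<lambda>t. t *\<^sub>R (- h))) (at s within {0..1})"
      by (auto intro!: derivative_eq_intros)
    from has_derivative_compose[OF this test_function_has_derivative[OF assms]]
    have "((\<lambda>s. \<phi> (x + s *\<^sub>R (- h))) has_derivative (\<lambda>t. frechet_derivative \<phi> (at (x + s *\<^sub>R (- h))) (t *\<^sub>R (- h)))) (at s within {0..1})" .
    moreover have "frechet_derivative \<phi> (at (x + s *\<^sub>R (- h))) (t *\<^sub>R (- h)) = t *\<^sub>R ?D s" for t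
      using has_derivative_linear[OF test_function_has_derivative[OF assms]] linear_scale by blast
    ultimately show "((\<lambda>s. \<phi> (x + s *\<^sub>R (- h))) has_vector_derivative ?D s) (at s within {0..1})"
      by (simp add: has_vector_derivative_def)
  next
    show "continuous_on {0..1} ?D"
      by (intro continuous_on_compose2[OF test_function_derivative_continuous[OF assms]] continuous_intros) auto
  qed simp
  moreover have "?D s = - frechet_derivative \<phi> (at (x + s *\<^sub>R (- h))) h" for s
    using has_derivative_linear[OF test_function_has_derivative[OF assms]] linear_neg by blast
  ultimately show ?thesis by simp
qed

text \<open>Almost everywhere \<open>u (x + h) - u x\<close> is the mean of
  \<open>g \<bullet> h\<close> along the segment from \<open>x\<close> to \<open>x + h\<close>. This
  is proved by duality, without approximating \<open>u\<close> by smooth functions: the difference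
  is moved to the test function, where the fundamental theorem of calculus holds, and the weak
  gradient moves it back.\<close>

lemma H1_difference_quotient:
  fixes u :: "'a::euclidean_space \<Rightarrow> real"
  assumes wg: "weak_gradient u g" and u: "square_integrable u" and g: "square_integrable g"
  shows "L2_inner (\<lambda>x. u (x + h) - u x) (\<lambda>x. u (x + h) - u x) \<le> (norm h)\<^sup>2 * L2_inner g g"
proof -
  note [measurable] = u[THEN square_integrable_measurable] g[THEN square_integrable_measurable]
  define G where "G x = (\<integral>s. indicator {0..1::real} s * (g (x + s *\<^sub>R h) \<bullet> h) \<partial>lborel)" for x
  note gh = square_integrable_component[OF g, of h]
  have G: "square_integrable G" "L2_inner G G \<le> L2_inner (\<lambda>x. g x \<bullet> h) (\<lambda>x. g x \<bullet> h)"
    using segment_average_bound[OF gh, of h] by (simp_all add: G_def[abs_def])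
  note uh = square_integrable_translate[OF u, of h]
  have "AE x in lborel. (u (x + h) - u x) - G x = 0"
  proof (rule fundamental_lemma_calculus_of_variations)
    show "square_integrable (\<lambda>x. u (x + h) - u x - G x)"
      by (intro square_integrable_diff uh u G)
    fix \<phi> :: "'a \<Rightarrow> real" assume phi: "test_function \<phi>"
    note phi_sq = test_function_square_integrable[OF phi]
      and dphi_sq = test_function_derivative_square_integrable[OF phi]
    note [measurable] = phi_sq[THEN square_integrable_measurable] dphi_sq[THEN square_integrable_measurable]
    note phi_h = square_integrable_translate(1)[OF phi_sq, of "- h"]
    have "L2_inner (\<lambda>x. u (x + h) - u x) \<phi> = L2_inner (\<lambda>x. u (x + h)) \<phi> - L2_inner u \<phi>"
      by (intro L2_inner_diff_left uh u phi_sq)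
    also have "L2_inner (\<lambda>x. u (x + h)) \<phi> = L2_inner u (\<lambda>x. \<phi> (x + - h))"
      unfolding L2_inner_def using integral_translate[of "\<lambda>x. u x \<bullet> \<phi> (x + - h)" h] by simp
    also have "\<dots> - L2_inner u \<phi> = L2_inner u (\<lambda>x. \<phi> (x + - h) - \<phi> x)"
      by (rule L2_inner_diff_right[symmetric, OF phi_h phi_sq u])
    \<comment> \<open>The idle \<open>s *\<^sub>R 0\<close> gives the integrand the form treated in
      \<open>integrable_translated_product\<close>.\<close>
    also have "\<dots> = - (\<integral>x. \<integral>s. indicator {0..1::real} s * (u (x + s *\<^sub>R 0) * frechet_derivative \<phi> (at (x + s *\<^sub>R (- h))) h) \<partial>lborel \<partial>lborel)"
      unfolding L2_inner_def test_function_difference[OF phi]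
      by (simp add: mult_ac flip: Bochner_Integration.integral_mult_right_zero)
    also have "(\<integral>x. \<integral>s. indicator {0..1::real} s * (u (x + s *\<^sub>R 0) * frechet_derivative \<phi> (at (x + s *\<^sub>R (- h))) h) \<partial>lborel \<partial>lborel)
       = (\<integral>s. \<integral>x. indicator {0..1::real} s * (u (x + s *\<^sub>R 0) * frechet_derivative \<phi> (at (x + s *\<^sub>R (- h))) h) \<partial>lborel \<partial>lborel)"
      by (rule lborel_pair.Fubini_integral[symmetric]) (rule integrable_translated_product[OF u dphi_sq])
    also have "\<dots> = (\<integral>s. - (\<integral>x. indicator {0..1::real} s * ((g (x + s *\<^sub>R h) \<bullet> h) * \<phi> (x + s *\<^sub>R 0)) \<partial>lborel) \<partial>lborel)"
    proof (rule Bochner_Integration.integral_cong[OF refl])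
      fix s :: real
      \<comment> \<open>For each fixed \<open>s\<close> the weak gradient is tested with a translate
        of \<phi>; a change of variables then puts the shift on \<open>g\<close>.\<close>
      let ?\<psi> = "\<lambda>x. \<phi> (x + s *\<^sub>R (- h))"
      have "\<phi> differentiable (at x)" for x
        using test_function_has_derivative[OF phi] by (auto simp: differentiable_def)
      then have D: "frechet_derivative ?\<psi> (at x) = frechet_derivative \<phi> (at (x + s *\<^sub>R (- h)))" for x
        by (rule frechet_derivative_translate)
      have "L2_inner u (\<lambda>x. frechet_derivative ?\<psi> (at x) h) = - L2_inner (\<lambda>x. g x \<bullet> h) ?\<psi>"
        by (rule weak_gradient_all_directions[OF wg u g test_function_translate[OF phi]])
      also have "L2_inner (\<lambda>x. g x \<bullet> h) ?\<psi> = (\<integral>x. (g (x + s *\<^sub>R h) \<bullet> h) * \<phi> x \<partial>lborel)"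
        unfolding L2_inner_def
        using integral_translate[of "\<lambda>x. (g x \<bullet> h) \<bullet> \<phi> (x + s *\<^sub>R (- h))" "s *\<^sub>R h"] by simp
      finally have "(\<integral>x. u x * frechet_derivative \<phi> (at (x + s *\<^sub>R (- h))) h \<partial>lborel)
          = - (\<integral>x. (g (x + s *\<^sub>R h) \<bullet> h) * \<phi> x \<partial>lborel)"
        unfolding D L2_inner_def by simp
      then show "(\<integral>x. indicator {0..1::real} s * (u (x + s *\<^sub>R 0) * frechet_derivative \<phi> (at (x + s *\<^sub>R (- h))) h) \<partial>lborel)
        = - (\<integral>x. indicator {0..1::real} s * ((g (x + s *\<^sub>R h) \<bullet> h) * \<phi> (x + s *\<^sub>R 0)) \<partial>lborel)"
        by simp
    qed
    also have "\<dots> = - (\<integral>x. \<integral>s. indicator {0..1::real} s * ((g (x + s *\<^sub>R h) \<bullet> h) * \<phi> (x + s *\<^sub>R 0)) \<partial>lborel \<partial>lborel)"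
      using lborel_pair.Fubini_integral[OF integrable_translated_product[OF gh phi_sq, of h 0]] by simp
    also have "(\<integral>x. \<integral>s. indicator {0..1::real} s * ((g (x + s *\<^sub>R h) \<bullet> h) * \<phi> (x + s *\<^sub>R 0)) \<partial>lborel \<partial>lborel) = L2_inner G \<phi>"
      unfolding L2_inner_def G_def
      by (simp add: mult_ac flip: Bochner_Integration.integral_mult_left_zero)
    finally have "L2_inner (\<lambda>x. u (x + h) - u x) \<phi> = L2_inner G \<phi>" by simp
    then have "L2_inner (\<lambda>x. u (x + h) - u x - G x) \<phi> = 0"
      by (subst L2_inner_diff_left) (auto intro!: square_integrable_diff uh u G phi_sq)
    then show "(\<integral>x. (u (x + h) - u x - G x) * \<phi> x \<partial>lborel) = 0"
      by (simp add: L2_inner_def)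
  qed
  then have "AE x in lborel. u (x + h) - u x = G x" by simp
  then have "L2_inner (\<lambda>x. u (x + h) - u x) (\<lambda>x. u (x + h) - u x) = L2_inner G G"
    by (intro L2_inner_cong_AE square_integrable_diff uh u G)
  also have "\<dots> \<le> L2_inner (\<lambda>x. g x \<bullet> h) (\<lambda>x. g x \<bullet> h)" by (rule G)
  also have "\<dots> \<le> (\<integral>x. (norm h)\<^sup>2 * (norm (g x))\<^sup>2 \<partial>lborel)"
    unfolding L2_inner_def
  proof (rule integral_mono)
    show "(g x \<bullet> h) \<bullet> (g x \<bullet> h) \<le> (norm h)\<^sup>2 * (norm (g x))\<^sup>2" for x
      using Cauchy_Schwarz_ineq[of "g x" h] by (simp add: power2_eq_square power2_norm_eq_inner[symmetric] mult_ac)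
  qed (use g integrable_inner[OF gh gh] in \<open>auto simp: square_integrable_def\<close>)
  also have "\<dots> = (norm h)\<^sup>2 * L2_inner g g" by (simp add: L2_inner_self)
  finally show ?thesis .
qed

section \<open>The Sobolev space as a Hilbert space\<close>

lemma
  assumes "u \<in> H1"
  shows H1_square_integrable: "square_integrable u"
    and grad_square_integrable: "square_integrable (grad u)"
    and weak_gradient_grad: "weak_gradient u (grad u)"
  using assms someI_ex[of "\<lambda>g. square_integrable g \<and> weak_gradient u g"]
  by (auto simp: H1_def grad_def)

lemma H1_I: "square_integrable u \<Longrightarrow> square_integrable g \<Longrightarrow> weak_gradient u g \<Longrightarrow> u \<in> H1"
  by (auto simp: H1_def)

lemma grad_AE_eq:
  assumes "u \<in> H1" "square_integrable g" "weak_gradient u g"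
  shows "AE x in lborel. grad u x = g x"
  using weak_gradient_unique[OF weak_gradient_grad[OF assms(1)] assms(3) grad_square_integrable[OF assms(1)] assms(2)] .

lemma H1_add:
  assumes "u \<in> H1" "v \<in> H1"
  shows "(\<lambda>x. u x + v x) \<in> H1" "AE x in lborel. grad (\<lambda>x. u x + v x) x = grad u x + grad v x"
proof -
  have *: "weak_gradient (\<lambda>x. u x + v x) (\<lambda>x. grad u x + grad v x)"
    by (intro weak_gradient_add weak_gradient_grad H1_square_integrable grad_square_integrable assms)
  then show "(\<lambda>x. u x + v x) \<in> H1"
    by (rule H1_I[rotated 2]) (intro square_integrable_add H1_square_integrable grad_square_integrable assms)+
  then show "AE x in lborel. grad (\<lambda>x. u x + v x) x = grad u x + grad v x"
    by (intro grad_AE_eq * square_integrable_add grad_square_integrable assms)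
qed

lemma H1_mult:
  assumes "u \<in> H1"
  shows "(\<lambda>x. r * u x) \<in> H1" "AE x in lborel. grad (\<lambda>x. r * u x) x = r *\<^sub>R grad u x"
proof -
  have *: "weak_gradient (\<lambda>x. r * u x) (\<lambda>x. r *\<^sub>R grad u x)"
    by (intro weak_gradient_mult weak_gradient_grad assms)
  then show "(\<lambda>x. r * u x) \<in> H1"
    by (rule H1_I[rotated 2]) (intro square_integrable_mult square_integrable_scale H1_square_integrable grad_square_integrable assms)+
  then show "AE x in lborel. grad (\<lambda>x. r * u x) x = r *\<^sub>R grad u x"
    by (intro grad_AE_eq * square_integrable_scale grad_square_integrable assms)
qed

lemma H1_diff:
  assumes "u \<in> H1" "v \<in> H1"
  shows "(\<lambda>x. u x - v x) \<in> H1" "AE x in lborel. grad (\<lambda>x. u x - v x) x = grad u x - grad v x"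
proof -
  note m = H1_mult[OF assms(2), of "-1"]
  note a = H1_add[OF assms(1) m(1)]
  show "(\<lambda>x. u x - v x) \<in> H1" using a(1) by simp
  show "AE x in lborel. grad (\<lambda>x. u x - v x) x = grad u x - grad v x"
    using a(2) m(2) by eventually_elim simp
qed

lemma H1_translate:
  assumes "u \<in> H1"
  shows "(\<lambda>x. u (x + a)) \<in> H1" "AE x in lborel. grad (\<lambda>x. u (x + a)) x = grad u (x + a)"
proof -
  have *: "weak_gradient (\<lambda>x. u (x + a)) (\<lambda>x. grad u (x + a))"
    by (intro weak_gradient_translate weak_gradient_grad H1_square_integrable grad_square_integrable assms)
  then show "(\<lambda>x. u (x + a)) \<in> H1"
    by (rule H1_I[rotated 2]) (intro square_integrable_translate H1_square_integrable grad_square_integrable assms)+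
  then show "AE x in lborel. grad (\<lambda>x. u (x + a)) x = grad u (x + a)"
    by (intro grad_AE_eq * square_integrable_translate grad_square_integrable assms)
qed

section \<open>The bilinear form of the linear part of the equation\<close>

definition H1_form :: "real \<Rightarrow> ('a::euclidean_space \<Rightarrow> real) \<Rightarrow> ('a \<Rightarrow> real) \<Rightarrow> real" where
  "H1_form lam u v = L2_inner (grad u) (grad v) + lam * L2_inner u v"

lemma H1_form_commute: "H1_form lam u v = H1_form lam v u"
  by (simp add: H1_form_def L2_inner_commute)

lemma H1_form_add_left:
  assumes "u \<in> H1" "v \<in> H1" "w \<in> H1"
  shows "H1_form lam (\<lambda>x. u x + v x) w = H1_form lam u w + H1_form lam v w"
proof -
  note sq = assms[THEN H1_square_integrable] assms[THEN grad_square_integrable]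
  have "L2_inner (grad (\<lambda>x. u x + v x)) (grad w) = L2_inner (\<lambda>x. grad u x + grad v x) (grad w)"
    by (intro L2_inner_cong_AE grad_square_integrable square_integrable_add H1_add assms) auto
  then show ?thesis by (simp add: H1_form_def L2_inner_add_left sq algebra_simps)
qed

lemma H1_form_mult_left:
  assumes "u \<in> H1" "w \<in> H1"
  shows "H1_form lam (\<lambda>x. r * u x) w = r * H1_form lam u w"
proof -
  have "L2_inner (grad (\<lambda>x. r * u x)) (grad w) = L2_inner (\<lambda>x. r *\<^sub>R grad u x) (grad w)"
    by (intro L2_inner_cong_AE grad_square_integrable square_integrable_scale H1_mult assms) auto
  then show ?thesis
    using L2_inner_scale_left[of r u w] by (simp add: H1_form_def L2_inner_scale_left algebra_simps)
qed

lemma H1_form_add_right: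
  "u \<in> H1 \<Longrightarrow> v \<in> H1 \<Longrightarrow> w \<in> H1 \<Longrightarrow>
    H1_form lam w (\<lambda>x. u x + v x) = H1_form lam w u + H1_form lam w v"
  using H1_form_add_left[of u v w lam] by (simp add: H1_form_commute)

lemma H1_form_mult_right:
  "u \<in> H1 \<Longrightarrow> w \<in> H1 \<Longrightarrow> H1_form lam w (\<lambda>x. r * u x) = r * H1_form lam w u"
  using H1_form_mult_left[of u w lam r] by (simp add: H1_form_commute)

lemma H1_form_diff_left:
  assumes "u \<in> H1" "v \<in> H1" "w \<in> H1"
  shows "H1_form lam (\<lambda>x. u x - v x) w = H1_form lam u w - H1_form lam v w"
  using H1_form_add_left[OF assms(1) H1_mult(1)[OF assms(2), of "-1"] assms(3)]
    H1_form_mult_left[OF assms(2,3), of lam "-1"] by simp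

lemma H1_form_diff_right:
  "u \<in> H1 \<Longrightarrow> v \<in> H1 \<Longrightarrow> w \<in> H1 \<Longrightarrow>
    H1_form lam w (\<lambda>x. u x - v x) = H1_form lam w u - H1_form lam w v"
  using H1_form_diff_left[of u v w lam] by (simp add: H1_form_commute)

lemma H1_form_ge_0: "0 \<le> lam \<Longrightarrow> 0 \<le> H1_form lam u u"
  by (simp add: H1_form_def)

lemma H1_form_translate:
  assumes "u \<in> H1"
  shows "H1_form lam (\<lambda>x. u (x + a)) (\<lambda>x. u (x + a)) = H1_form lam u u"
proof -
  note sq = H1_square_integrable[OF assms] grad_square_integrable[OF assms]
  have "L2_inner (grad (\<lambda>x. u (x + a))) (grad (\<lambda>x. u (x + a))) = L2_inner (\<lambda>x. grad u (x + a)) (\<lambda>x. grad u (x + a))"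
    by (intro L2_inner_cong_AE grad_square_integrable square_integrable_translate sq H1_translate assms)
  then show ?thesis by (simp add: H1_form_def square_integrable_translate(2) sq)
qed

text \<open>Nonnegativity of the form at \<open>u + v\<close> and at \<open>u - v\<close>,
  expanded.\<close>

lemma H1_form_bound:
  assumes "u \<in> H1" "v \<in> H1" "0 \<le> lam"
  shows "2 * \<bar>H1_form lam u v\<bar> \<le> H1_form lam u u + H1_form lam v v"
proof -
  have "0 \<le> H1_form lam (\<lambda>x. u x + v x) (\<lambda>x. u x + v x)" "0 \<le> H1_form lam (\<lambda>x. u x - v x) (\<lambda>x. u x - v x)"
    by (simp_all add: H1_form_ge_0 assms)
  then show ?thesis
    using assms H1_form_commute[of lam v u]
    by (simp add: H1_form_add_left H1_form_add_right H1_form_diff_left H1_form_diff_right H1_add H1_diff)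
qed

text \<open>Since \<open>lam\<close> is positive, the form controls functions and gradients
  separately in L2. Both converge, and \<open>weak_gradient_limit\<close> identifies the second
  limit as the weak gradient of the first.\<close>

theorem H1_complete:
  fixes z :: "nat \<Rightarrow> 'a::euclidean_space \<Rightarrow> real"
  assumes z: "\<And>n. z n \<in> H1" and lam: "0 < lam"
    and cauchy: "\<And>e. e > 0 \<Longrightarrow> \<exists>n0. \<forall>m\<ge>n0. \<forall>n\<ge>n0. H1_form lam (\<lambda>x. z m x - z n x) (\<lambda>x. z m x - z n x) \<le> e"
  obtains Z where "Z \<in> H1" "(\<lambda>n. H1_form lam (\<lambda>x. z n x - Z x) (\<lambda>x. z n x - Z x)) \<longlonglongrightarrow> 0"
proof -
  note sq = z[THEN H1_square_integrable] z[THEN grad_square_integrable]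
  have form: "H1_form lam (\<lambda>x. u x - v x) (\<lambda>x. u x - v x)
      = L2_inner (\<lambda>x. grad u x - grad v x) (\<lambda>x. grad u x - grad v x) + lam * L2_inner (\<lambda>x. u x - v x) (\<lambda>x. u x - v x)"
    if "u \<in> H1" "v \<in> H1" for u v :: "'a \<Rightarrow> real"
  proof -
    have "L2_inner (grad (\<lambda>x. u x - v x)) (grad (\<lambda>x. u x - v x)) = L2_inner (\<lambda>x. grad u x - grad v x) (\<lambda>x. grad u x - grad v x)"
      by (intro L2_inner_cong_AE grad_square_integrable square_integrable_diff H1_diff that)
    then show ?thesis by (simp add: H1_form_def)
  qed
  obtain U where U: "square_integrable U" "(\<lambda>n. L2_inner (\<lambda>x. z n x - U x) (\<lambda>x. z n x - U x)) \<longlonglongrightarrow> 0"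
  proof (rule L2_complete[OF sq(1)])
    fix e :: real assume "e > 0"
    then have "lam * e > 0" using lam by simp
    then obtain n0 where n0: "\<And>m n. m \<ge> n0 \<Longrightarrow> n \<ge> n0 \<Longrightarrow> H1_form lam (\<lambda>x. z m x - z n x) (\<lambda>x. z m x - z n x) \<le> lam * e"
      using cauchy by blast
    have "L2_inner (\<lambda>x. z m x - z n x) (\<lambda>x. z m x - z n x) \<le> e" if "m \<ge> n0" "n \<ge> n0" for m n
    proof -
      have "lam * L2_inner (\<lambda>x. z m x - z n x) (\<lambda>x. z m x - z n x) \<le> lam * e"
        using n0[OF that] unfolding form[OF z z]
        by (rule order_trans[rotated]) simp
      then show ?thesis using lam by simp
    qed
    then show "\<exists>n0. \<forall>m\<ge>n0. \<forall>n\<ge>n0. L2_inner (\<lambda>x. z m x - z n x) (\<lambda>x. z m x - z n x) \<le> e" by blast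
  qed
  obtain G where G: "square_integrable G" "(\<lambda>n. L2_inner (\<lambda>x. grad (z n) x - G x) (\<lambda>x. grad (z n) x - G x)) \<longlonglongrightarrow> 0"
  proof (rule L2_complete[OF sq(2)])
    fix e :: real assume "e > 0"
    then obtain n0 where n0: "\<And>m n. m \<ge> n0 \<Longrightarrow> n \<ge> n0 \<Longrightarrow> H1_form lam (\<lambda>x. z m x - z n x) (\<lambda>x. z m x - z n x) \<le> e"
      using cauchy by blast
    have "L2_inner (\<lambda>x. grad (z m) x - grad (z n) x) (\<lambda>x. grad (z m) x - grad (z n) x) \<le> e" if "m \<ge> n0" "n \<ge> n0" for m n
      using n0[OF that] lam unfolding form[OF z z] by (intro order_trans[rotated, OF n0[OF that, unfolded form[OF z z]]]) simp
    then show "\<exists>n0. \<forall>m\<ge>n0. \<forall>n\<ge>n0. L2_inner (\<lambda>x. grad (z m) x - grad (z n) x) (\<lambda>x. grad (z m) x - grad (z n) x) \<le> e" by blast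
  qed
  have wg: "weak_gradient U G"
    by (rule weak_gradient_limit[OF weak_gradient_grad[OF z] sq U(1) G(1) U(2) G(2)])
  then have UH: "U \<in> H1" using U G H1_I by blast
  have "H1_form lam (\<lambda>x. z n x - U x) (\<lambda>x. z n x - U x)
      = L2_inner (\<lambda>x. grad (z n) x - G x) (\<lambda>x. grad (z n) x - G x) + lam * L2_inner (\<lambda>x. z n x - U x) (\<lambda>x. z n x - U x)" for n
  proof -
    have "L2_inner (\<lambda>x. grad (z n) x - grad U x) (\<lambda>x. grad (z n) x - grad U x)
        = L2_inner (\<lambda>x. grad (z n) x - G x) (\<lambda>x. grad (z n) x - G x)"
      using grad_AE_eq[OF UH G(1) wg]
      by (intro L2_inner_cong_AE grad_square_integrable square_integrable_diff z UH G) auto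
    then show ?thesis by (simp add: form z UH)
  qed
  moreover have "(\<lambda>n. L2_inner (\<lambda>x. grad (z n) x - G x) (\<lambda>x. grad (z n) x - G x) + lam * L2_inner (\<lambda>x. z n x - U x) (\<lambda>x. z n x - U x)) \<longlonglongrightarrow> 0 + lam * 0"
    by (intro tendsto_intros U G)
  ultimately show ?thesis using that[OF UH] by simp
qed

lemma H1_form_tendsto:
  assumes "\<And>n. z n \<in> H1" "Z \<in> H1" "\<phi> \<in> H1" "0 < lam"
    and lim: "(\<lambda>n. H1_form lam (\<lambda>x. z n x - Z x) (\<lambda>x. z n x - Z x)) \<longlonglongrightarrow> 0"
  shows "(\<lambda>n. H1_form lam (z n) \<phi>) \<longlonglongrightarrow> H1_form lam Z \<phi>"
    and "(\<lambda>n. H1_form lam (z n) (z n)) \<longlonglongrightarrow> H1_form lam Z Z"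
    and "(\<lambda>n. L2_inner (\<lambda>x. z n x - Z x) (\<lambda>x. z n x - Z x)) \<longlonglongrightarrow> 0"
proof -
  let ?E = "\<lambda>n. H1_form lam (\<lambda>x. z n x - Z x) (\<lambda>x. z n x - Z x)"
  have form0: "(\<lambda>n. H1_form lam (\<lambda>x. z n x - Z x) w) \<longlonglongrightarrow> 0" if w: "w \<in> H1" for w
  proof (rule LIMSEQ_I)
    fix e :: real assume e: "e > 0"
    \<comment> \<open>Rescaling \<open>w\<close> by \<open>t\<close> in \<open>H1_form_bound\<close>
      makes each of its two terms at most \<open>t * e\<close>, which takes the role of a
      Cauchy-Schwarz inequality for the form. The \<open>+ 1\<close> covers a vanishing form of
      \<open>w\<close>.\<close>
    define t where "t = e / (H1_form lam w w + 1)"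
    have W: "H1_form lam w w \<ge> 0" using assms by (simp add: H1_form_ge_0)
    then have t: "t > 0" using e by (simp add: t_def)
    have tW: "t * H1_form lam w w \<le> e" using e W by (simp add: t_def field_simps)
    obtain N where N: "\<And>n. n \<ge> N \<Longrightarrow> ?E n < t * e"
      using order_tendstoD(2)[OF lim, of "t * e"] t e by (auto simp: eventually_sequentially)
    have "\<bar>H1_form lam (\<lambda>x. z n x - Z x) w\<bar> < e" if "n \<ge> N" for n
    proof -
      have dH: "(\<lambda>x. z n x - Z x) \<in> H1" by (intro H1_diff assms)
      have "2 * \<bar>H1_form lam (\<lambda>x. z n x - Z x) (\<lambda>x. t * w x)\<bar>
          \<le> ?E n + H1_form lam (\<lambda>x. t * w x) (\<lambda>x. t * w x)"
        by (rule H1_form_bound) (use assms in \<open>auto intro!: H1_diff H1_mult w\<close>)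
      also have "H1_form lam (\<lambda>x. t * w x) (\<lambda>x. t * w x) = t * (t * H1_form lam w w)"
        by (simp add: H1_form_mult_left H1_form_mult_right H1_mult w)
      also have "\<dots> \<le> t * e" using tW t by (intro mult_left_mono) auto
      also have "H1_form lam (\<lambda>x. z n x - Z x) (\<lambda>x. t * w x) = t * H1_form lam (\<lambda>x. z n x - Z x) w"
        by (rule H1_form_mult_right[OF w dH])
      finally have "t * \<bar>H1_form lam (\<lambda>x. z n x - Z x) w\<bar> < t * e"
        using N[OF that] t unfolding abs_mult by linarith
      then show ?thesis using t by simp
    qed
    then show "\<exists>no. \<forall>n\<ge>no. norm (H1_form lam (\<lambda>x. z n x - Z x) w - 0) < e" by auto
  qed
  have diff: "H1_form lam (\<lambda>x. z n x - Z x) w = H1_form lam (z n) w - H1_form lam Z w" if "w \<in> H1" for n w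
    by (intro H1_form_diff_left assms that)
  have conv: "(\<lambda>n. H1_form lam (z n) w) \<longlonglongrightarrow> H1_form lam Z w" if "w \<in> H1" for w
    using form0[OF that] by (simp add: diff that LIM_zero_cancel)
  show "(\<lambda>n. H1_form lam (z n) \<phi>) \<longlonglongrightarrow> H1_form lam Z \<phi>" by (rule conv) fact
  have "H1_form lam (z n) (z n) = ?E n + 2 * H1_form lam (z n) Z - H1_form lam Z Z" for n
    using assms(1,2) H1_form_commute[of lam Z "z n"]
    by (simp add: H1_form_diff_left H1_form_diff_right H1_diff)
  moreover have "(\<lambda>n. ?E n + 2 * H1_form lam (z n) Z - H1_form lam Z Z) \<longlonglongrightarrow> 0 + 2 * H1_form lam Z Z - H1_form lam Z Z"
    by (intro tendsto_intros lim conv assms)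
  ultimately show "(\<lambda>n. H1_form lam (z n) (z n)) \<longlonglongrightarrow> H1_form lam Z Z" by simp
  show "(\<lambda>n. L2_inner (\<lambda>x. z n x - Z x) (\<lambda>x. z n x - Z x)) \<longlonglongrightarrow> 0"
  proof (rule tendsto_sandwich[of "\<lambda>_. 0"])
    show "\<forall>\<^sub>F n in sequentially. L2_inner (\<lambda>x. z n x - Z x) (\<lambda>x. z n x - Z x) \<le> ?E n / lam"
      using assms(4) by (intro always_eventually allI) (simp add: H1_form_def field_simps)
    show "(\<lambda>n. ?E n / lam) \<longlonglongrightarrow> 0" using tendsto_divide[OF lim tendsto_const[of lam]] assms(4) by simp
  qed auto
qed

section \<open>Averages over dyadic cubes\<close>

text \<open>The half-open cube of side \<open>2^-k\<close> around \<open>x\<close> in the dyadic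
  grid. Written with floors, lying in a common cube is visibly an equivalence relation, and it is
  measurable jointly in both points, as Fubini requires.\<close>

definition dyadic_cube :: "nat \<Rightarrow> 'a::euclidean_space \<Rightarrow> 'a set" where
  "dyadic_cube k x = {y. \<forall>e\<in>Basis. \<lfloor>2 ^ k * (y \<bullet> e)\<rfloor> = \<lfloor>2 ^ k * (x \<bullet> e)\<rfloor>}"

definition dyadic_average :: "nat \<Rightarrow> ('a::euclidean_space \<Rightarrow> real) \<Rightarrow> 'a \<Rightarrow> real" where
  "dyadic_average k u x = 2 ^ (k * DIM('a)) * (\<integral>y. indicator (dyadic_cube k x) y * u y \<partial>lborel)"

lemma dyadic_cube_eq: "y \<in> dyadic_cube k x \<Longrightarrow> dyadic_cube k y = dyadic_cube k x"
  by (auto simp: dyadic_cube_def)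

lemma dyadic_cube_commute: "y \<in> dyadic_cube k x \<longleftrightarrow> x \<in> dyadic_cube k y"
  by (auto simp: dyadic_cube_def)

text \<open>The floor at level \<open>k\<close> is a function of the floor at level
  \<open>k + 1\<close>; this is why the cubes are nested.\<close>

lemma floor_double_div: "\<lfloor>x\<rfloor> = \<lfloor>2 * x\<rfloor> div 2" for x :: real
  using floor_divide_real_eq_div[of 2 "2 * x"] by simp

lemma dyadic_cube_Suc_subset: "dyadic_cube (Suc k) x \<subseteq> dyadic_cube k x"
proof -
  have "\<lfloor>2 ^ k * (y \<bullet> e)\<rfloor> = \<lfloor>2 ^ Suc k * (y \<bullet> e)\<rfloor> div 2" for y e :: 'a
    using floor_double_div[of "2 ^ k * (y \<bullet> e)"] by (simp add: mult.assoc)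
  then show ?thesis by (auto simp: dyadic_cube_def)
qed

lemma dyadic_cube_dist:
  assumes "y \<in> dyadic_cube k x" "e \<in> Basis"
  shows "\<bar>(y - x) \<bullet> e\<bar> \<le> (1/2) ^ k"
proof -
  have "\<lfloor>2 ^ k * (y \<bullet> e)\<rfloor> = \<lfloor>2 ^ k * (x \<bullet> e)\<rfloor>" using assms by (simp add: dyadic_cube_def)
  then have "\<bar>2 ^ k * (y \<bullet> e) - 2 ^ k * (x \<bullet> e)\<bar> \<le> 1" by linarith
  then have "2 ^ k * \<bar>(y - x) \<bullet> e\<bar> \<le> 1"
    by (simp add: inner_diff_left abs_mult flip: right_diff_distrib)
  then show ?thesis by (simp add: field_simps power_one_over)
qed

lemma dyadic_cube_measurable [measurable]:
  fixes f g :: "'b \<Rightarrow> 'a::euclidean_space"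
  assumes [measurable]: "f \<in> borel_measurable M" "g \<in> borel_measurable M"
  shows "Measurable.pred M (\<lambda>x. g x \<in> dyadic_cube k (f x))"
  unfolding dyadic_cube_def mem_Collect_eq by measurable

lemma dyadic_cube_borel [measurable]: "dyadic_cube k x \<in> sets borel"
proof -
  have "Measurable.pred borel (\<lambda>y. y \<in> dyadic_cube k x)" by measurable
  then show ?thesis by (simp add: pred_def)
qed

lemma indicator_dyadic_cube_measurable [measurable]:
  fixes f g :: "'b \<Rightarrow> 'a::euclidean_space"
  assumes [measurable]: "f \<in> borel_measurable M" "g \<in> borel_measurable M"
  shows "(\<lambda>x. indicator (dyadic_cube k (f x)) (g x) :: real) \<in> borel_measurable M"
    "(\<lambda>x. indicator (dyadic_cube k (f x)) (g x) :: ennreal) \<in> borel_measurable M"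
  unfolding indicator_def by measurable

text \<open>The cube lies between the open and the closed box with the same corners, whose volumes
  agree.\<close>

lemma emeasure_dyadic_cube:
  fixes x :: "'a::euclidean_space"
  shows "emeasure lborel (dyadic_cube k x) = ennreal (1 / 2 ^ (k * DIM('a)))"
proof -
  define l where "l = (\<Sum>e\<in>Basis. (\<lfloor>2 ^ k * (x \<bullet> e)\<rfloor> / 2 ^ k) *\<^sub>R e)"
  define u where "u = (\<Sum>e\<in>Basis. ((\<lfloor>2 ^ k * (x \<bullet> e)\<rfloor> + 1) / 2 ^ k) *\<^sub>R e)"
  have lu: "l \<bullet> e = \<lfloor>2 ^ k * (x \<bullet> e)\<rfloor> / 2 ^ k" "u \<bullet> e = (\<lfloor>2 ^ k * (x \<bullet> e)\<rfloor> + 1) / 2 ^ k" if "e \<in> Basis" for e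
    using that by (simp_all add: l_def u_def)
  have le: "\<forall>e\<in>Basis. l \<bullet> e \<le> u \<bullet> e" by (simp add: lu divide_right_mono)
  have prod: "(\<Prod>e\<in>Basis. (u - l) \<bullet> e) = 1 / 2 ^ (k * DIM('a))"
  proof -
    have "(\<Prod>e\<in>Basis. (u - l) \<bullet> e) = (\<Prod>e\<in>(Basis :: 'a set). 1 / 2 ^ k)"
      by (rule prod.cong) (simp_all add: lu inner_diff_left diff_divide_distrib[symmetric])
    then show ?thesis by (simp add: power_mult power_divide)
  qed
  have "box l u \<subseteq> dyadic_cube k x"
  proof
    fix y assume y: "y \<in> box l u"
    have "\<lfloor>2 ^ k * (y \<bullet> e)\<rfloor> = \<lfloor>2 ^ k * (x \<bullet> e)\<rfloor>" if e: "e \<in> Basis" for e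
    proof (rule floor_unique)
      have "l \<bullet> e < y \<bullet> e" "y \<bullet> e < u \<bullet> e" using y e by (auto simp: mem_box)
      then show "of_int \<lfloor>2 ^ k * (x \<bullet> e)\<rfloor> \<le> 2 ^ k * (y \<bullet> e)" "2 ^ k * (y \<bullet> e) < of_int \<lfloor>2 ^ k * (x \<bullet> e)\<rfloor> + 1"
        using e by (simp_all add: lu field_simps)
    qed
    then show "y \<in> dyadic_cube k x" by (simp add: dyadic_cube_def)
  qed
  moreover have "dyadic_cube k x \<subseteq> cbox l u"
  proof
    fix y assume y: "y \<in> dyadic_cube k x"
    have "l \<bullet> e \<le> y \<bullet> e \<and> y \<bullet> e \<le> u \<bullet> e" if e: "e \<in> Basis" for e
    proof -
      have eq: "\<lfloor>2 ^ k * (x \<bullet> e)\<rfloor> = \<lfloor>2 ^ k * (y \<bullet> e)\<rfloor>" using y e by (simp add: dyadic_cube_def)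
      have "of_int \<lfloor>2 ^ k * (y \<bullet> e)\<rfloor> \<le> 2 ^ k * (y \<bullet> e)" "2 ^ k * (y \<bullet> e) \<le> of_int \<lfloor>2 ^ k * (y \<bullet> e)\<rfloor> + 1"
        by linarith+
      then have "of_int \<lfloor>2 ^ k * (y \<bullet> e)\<rfloor> / 2 ^ k \<le> y \<bullet> e" "y \<bullet> e \<le> (of_int \<lfloor>2 ^ k * (y \<bullet> e)\<rfloor> + 1) / 2 ^ k"
        by (simp_all add: pos_divide_le_eq pos_le_divide_eq mult.commute)
      then show ?thesis using e by (simp add: lu eq)
    qed
    then show "y \<in> cbox l u" by (simp add: mem_box)
  qed
  ultimately show ?thesis
    using emeasure_mono[of "box l u" "dyadic_cube k x" lborel] emeasure_mono[of "dyadic_cube k x" "cbox l u" lborel]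
      emeasure_lborel_box_eq[of l u] emeasure_lborel_cbox_eq[of l u] le prod
    by (simp add: antisym)
qed

lemma dyadic_cube_bounded: "bounded (dyadic_cube k (x :: 'a::euclidean_space))"
proof (rule boundedI)
  fix y assume y: "y \<in> dyadic_cube k x"
  have "norm (y - x) \<le> (\<Sum>e\<in>Basis. \<bar>(y - x) \<bullet> e\<bar>)" by (rule norm_le_l1)
  also have "\<dots> \<le> (\<Sum>e\<in>(Basis :: 'a set). (1/2) ^ k)" by (intro sum_mono dyadic_cube_dist y)
  finally show "norm y \<le> norm x + (\<Sum>e\<in>(Basis :: 'a set). (1/2) ^ k)"
    using norm_triangle_ineq2[of y x] by linarith
qed

lemma integral_indicator_dyadic_cube:
  "(\<integral>y. indicator (dyadic_cube k (x :: 'a)) y \<partial>lborel) = (1 / 2 ^ (k * DIM('a::euclidean_space)) :: real)"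
  by (simp add: measure_def emeasure_dyadic_cube)

lemma dyadic_average_measurable [measurable]:
  assumes [measurable]: "u \<in> borel_measurable borel"
  shows "dyadic_average k u \<in> borel_measurable borel"
  unfolding dyadic_average_def[abs_def] by measurable

text \<open>Jensen's inequality on one cube: of the two normalizing factors one is cancelled by the
  volume.\<close>

lemma dyadic_average_sq_le:
  fixes f :: "'a::euclidean_space \<Rightarrow> real"
  assumes [measurable]: "f \<in> borel_measurable borel"
  shows "ennreal ((2 ^ (k * DIM('a)) * (\<integral>y. indicator (dyadic_cube k x) y * f y \<partial>lborel))\<^sup>2)
    \<le> ennreal (2 ^ (k * DIM('a))) * (\<integral>\<^sup>+y. indicator (dyadic_cube k x) y * ennreal ((f y)\<^sup>2) \<partial>lborel)"
proof -
  let ?c = "2 ^ (k * DIM('a)) :: real" and ?I = "\<integral>y. indicator (dyadic_cube k x) y * f y \<partial>lborel"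
  have "ennreal ((?c * ?I)\<^sup>2) = ennreal (?c\<^sup>2) * ennreal (?I\<^sup>2)"
    by (simp add: power_mult_distrib ennreal_mult)
  also have "\<dots> \<le> ennreal (?c\<^sup>2) * (emeasure lborel (dyadic_cube k x) * (\<integral>\<^sup>+y. indicator (dyadic_cube k x) y * ennreal ((f y)\<^sup>2) \<partial>lborel))"
    by (intro mult_left_mono integral_indicator_sq_le) auto
  also have "\<dots> = (ennreal (?c\<^sup>2) * ennreal (1 / ?c)) * (\<integral>\<^sup>+y. indicator (dyadic_cube k x) y * ennreal ((f y)\<^sup>2) \<partial>lborel)"
    by (simp add: emeasure_dyadic_cube mult.assoc)
  also have "ennreal (?c\<^sup>2) * ennreal (1 / ?c) = ennreal (?c\<^sup>2 * (1 / ?c))"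
    by (rule ennreal_mult[symmetric]) auto
  also have "?c\<^sup>2 * (1 / ?c) = ?c" by (simp add: power2_eq_square)
  finally show ?thesis .
qed

lemma dyadic_average_bound:
  fixes u :: "'a::euclidean_space \<Rightarrow> real"
  assumes "square_integrable u"
  shows "(dyadic_average k u x)\<^sup>2 \<le> 2 ^ (k * DIM('a)) * L2_inner u u"
proof -
  note [measurable] = square_integrable_measurable[OF assms]
  have "ennreal ((dyadic_average k u x)\<^sup>2)
      \<le> ennreal (2 ^ (k * DIM('a))) * (\<integral>\<^sup>+y. indicator (dyadic_cube k x) y * ennreal ((u y)\<^sup>2) \<partial>lborel)"
    unfolding dyadic_average_def by (rule dyadic_average_sq_le) measurable
  also have "\<dots> \<le> ennreal (2 ^ (k * DIM('a))) * (\<integral>\<^sup>+y. ennreal ((norm (u y))\<^sup>2) \<partial>lborel)"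
    by (intro mult_left_mono nn_integral_mono) (auto simp: indicator_def)
  also have "\<dots> = ennreal (2 ^ (k * DIM('a)) * L2_inner u u)"
    by (simp only: nn_integral_norm_sq[OF assms]) (simp add: ennreal_mult)
  finally show ?thesis by simp
qed

text \<open>Jensen's inequality on every cube, then Fubini. Membership in a common cube is
  symmetric, so the inner integral over \<open>x\<close> is the volume of the cube of
  \<open>y\<close> and cancels the remaining factor.\<close>

lemma dyadic_average_contraction:
  fixes u :: "'a::euclidean_space \<Rightarrow> real"
  assumes "square_integrable u"
  shows "square_integrable (dyadic_average k u)"
    "L2_inner (dyadic_average k u) (dyadic_average k u) \<le> L2_inner u u"
proof -
  note [measurable] = square_integrable_measurable[OF assms]
  let ?c = "ennreal (2 ^ (k * DIM('a)))"
  have "(\<integral>\<^sup>+x. ennreal ((norm (dyadic_average k u x))\<^sup>2) \<partial>lborel)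
      \<le> (\<integral>\<^sup>+x. ?c * (\<integral>\<^sup>+y. indicator (dyadic_cube k x) y * ennreal ((u y)\<^sup>2) \<partial>lborel) \<partial>lborel)"
    unfolding dyadic_average_def real_norm_def power2_abs
    by (intro nn_integral_mono dyadic_average_sq_le) measurable
  also have "\<dots> = ?c * (\<integral>\<^sup>+x. \<integral>\<^sup>+y. indicator (dyadic_cube k x) y * ennreal ((u y)\<^sup>2) \<partial>lborel \<partial>lborel)"
    by (rule nn_integral_cmult) measurable
  also have "(\<integral>\<^sup>+x. \<integral>\<^sup>+y. indicator (dyadic_cube k x) y * ennreal ((u y)\<^sup>2) \<partial>lborel \<partial>lborel)
      = (\<integral>\<^sup>+y. \<integral>\<^sup>+x. indicator (dyadic_cube k x) y * ennreal ((u y)\<^sup>2) \<partial>lborel \<partial>lborel)"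
    by (rule lborel_pair.Fubini'[symmetric]) measurable
  also have "\<dots> = (\<integral>\<^sup>+y. ennreal (1 / 2 ^ (k * DIM('a))) * ennreal ((u y)\<^sup>2) \<partial>lborel)"
  proof (rule nn_integral_cong)
    fix y
    have "(\<integral>\<^sup>+x. indicator (dyadic_cube k x) y * ennreal ((u y)\<^sup>2) \<partial>lborel)
        = (\<integral>\<^sup>+x. ennreal ((u y)\<^sup>2) * indicator (dyadic_cube k y) x \<partial>lborel)"
      using dyadic_cube_commute[of y k] by (intro nn_integral_cong) (auto simp: indicator_def)
    also have "\<dots> = ennreal ((u y)\<^sup>2) * emeasure lborel (dyadic_cube k y)"
      by (rule nn_integral_cmult_indicator) simp
    also have "\<dots> = ennreal (1 / 2 ^ (k * DIM('a))) * ennreal ((u y)\<^sup>2)"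
      by (simp add: emeasure_dyadic_cube mult.commute)
    finally show "(\<integral>\<^sup>+x. indicator (dyadic_cube k x) y * ennreal ((u y)\<^sup>2) \<partial>lborel)
        = ennreal (1 / 2 ^ (k * DIM('a))) * ennreal ((u y)\<^sup>2)" .
  qed
  also have "\<dots> = ennreal (1 / 2 ^ (k * DIM('a))) * ennreal (L2_inner u u)"
    using nn_integral_norm_sq[OF assms] by (simp add: nn_integral_cmult)
  also have "?c * \<dots> = ennreal (L2_inner u u)"
  proof -
    have "?c * ennreal (1 / 2 ^ (k * DIM('a))) = ennreal (2 ^ (k * DIM('a)) * (1 / 2 ^ (k * DIM('a))))"
      by (rule ennreal_mult[symmetric]) auto
    also have "\<dots> = 1" by simp
    finally show ?thesis by (metis mult.assoc mult_1)
  qed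
  finally have *: "(\<integral>\<^sup>+x. ennreal ((norm (dyadic_average k u x))\<^sup>2) \<partial>lborel) \<le> ennreal (L2_inner u u)" .
  have "dyadic_average k u \<in> borel_measurable lborel" by measurable
  from square_integrable_nn_integralI[OF this *]
  show "square_integrable (dyadic_average k u)"
    "L2_inner (dyadic_average k u) (dyadic_average k u) \<le> L2_inner u u" by auto
qed

lemma integrable_dyadic_cube:
  assumes "square_integrable u"
  shows "integrable lborel (\<lambda>y. indicator (dyadic_cube k x) y * u y :: real)"
  using integrable_inner[OF square_integrable_indicator[OF dyadic_cube_bounded dyadic_cube_borel] assms] by simp

lemma dyadic_average_diff:
  assumes "square_integrable u" "square_integrable v"
  shows "dyadic_average k (\<lambda>x. u x - v x) x = dyadic_average k u x - dyadic_average k v x"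
  unfolding dyadic_average_def
  using integrable_dyadic_cube[OF assms(1), of k x] integrable_dyadic_cube[OF assms(2), of k x]
  by (simp add: right_diff_distrib)

lemma dyadic_average_constant:
  fixes u :: "'a::euclidean_space \<Rightarrow> real"
  assumes "\<And>y. y \<in> dyadic_cube k x \<Longrightarrow> u y = c"
  shows "dyadic_average k u x = c"
proof -
  have "(\<lambda>y. indicator (dyadic_cube k x) y * u y) = (\<lambda>y. indicator (dyadic_cube k x) y * c)"
    using assms by (auto simp: indicator_def)
  then show ?thesis by (simp add: dyadic_average_def measure_def emeasure_dyadic_cube)
qed

lemma dyadic_average_cong_cube:
  "y \<in> dyadic_cube k x \<Longrightarrow> dyadic_average k u y = dyadic_average k u x"
  by (simp add: dyadic_average_def dyadic_cube_eq)

text \<open>The coarse average is constant on the finer cubes, so the increment is the fine average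
  of the remainder. It thereby inherits the smallness that the Poincare inequality gives for the
  remainder, together with a pointwise bound.\<close>

lemma dyadic_average_step:
  fixes u :: "'a::euclidean_space \<Rightarrow> real"
  assumes "square_integrable u"
  shows "dyadic_average (Suc k) u x - dyadic_average k u x
      = dyadic_average (Suc k) (\<lambda>x. u x - dyadic_average k u x) x"
proof -
  have "dyadic_average (Suc k) (dyadic_average k u) x = dyadic_average k u x"
    by (rule dyadic_average_constant) (metis dyadic_average_cong_cube dyadic_cube_Suc_subset subsetD)
  then show ?thesis
    using dyadic_average_diff[OF assms dyadic_average_contraction(1)[OF assms]] by metis
qed

text \<open>With \<open>N = DIM('a)\<close>, \<open>2 ^ N\<close> is the volume of the box of
  shifts, of side \<open>2 * 2^-k\<close>, divided by that of a cube; \<open>N^2\<close> comes from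
  \<open>norm h \<le> N * 2^-k\<close> on that box.\<close>

definition poincare_const :: "'a::euclidean_space itself \<Rightarrow> real" where
  "poincare_const _ = 2 ^ DIM('a) * (real DIM('a))\<^sup>2"

text \<open>Jensen's inequality on every cube reduces the estimate to the differences \<open>u (x + h) - u x\<close>
  with \<open>h\<close> in a fixed box.\<close>

lemma dyadic_poincare:
  fixes u :: "'a::euclidean_space \<Rightarrow> real"
  assumes wg: "weak_gradient u g" and u: "square_integrable u" and g: "square_integrable g"
  shows "L2_inner (\<lambda>x. u x - dyadic_average k u x) (\<lambda>x. u x - dyadic_average k u x)
    \<le> poincare_const TYPE('a) * (1/4) ^ k * L2_inner g g"
proof -
  note [measurable] = u[THEN square_integrable_measurable]
  let ?c = "2 ^ (k * DIM('a)) :: real"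
  \<comment> \<open>Contains every difference of two points of a common cube. One box for all
    \<open>x\<close> is what allows the integral over \<open>h\<close> to be taken outside.\<close>
  define W where "W = cbox (- ((1/2) ^ k *\<^sub>R One)) ((1/2) ^ k *\<^sub>R One :: 'a)"
  have W: "emeasure lborel W = ennreal ((2 * (1/2) ^ k) ^ DIM('a))"
  proof -
    have "(\<Prod>e\<in>Basis. ((1/2) ^ k *\<^sub>R One - - ((1/2) ^ k *\<^sub>R One :: 'a)) \<bullet> e) = (\<Prod>e\<in>(Basis :: 'a set). 2 * (1/2) ^ k)"
      by (rule prod.cong) (simp_all add: inner_add_left)
    then show ?thesis
      unfolding W_def by (subst emeasure_lborel_cbox_eq) (simp add: power_mult_distrib)
  qed
  have [measurable]: "W \<in> sets borel" by (simp add: W_def)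
  define B where "B = (real DIM('a))\<^sup>2 * (1/4) ^ k * L2_inner g g"
  have B: "B \<ge> 0" by (simp add: B_def)
  have pt: "ennreal ((norm (u x - dyadic_average k u x))\<^sup>2)
      \<le> ennreal ?c * (\<integral>\<^sup>+h. indicator W h * ennreal ((u (x + h) - u x)\<^sup>2) \<partial>lborel)" for x
  proof -
    have "u x - dyadic_average k u x = - (?c * (\<integral>y. indicator (dyadic_cube k x) y * (u y - u x) \<partial>lborel))"
    proof -
      have "integrable lborel (\<lambda>y. indicator (dyadic_cube k x) y * u x)"
        by (simp add: emeasure_dyadic_cube integrable_indicator_iff)
      then have "(\<integral>y. indicator (dyadic_cube k x) y * (u y - u x) \<partial>lborel)
          = (\<integral>y. indicator (dyadic_cube k x) y * u y \<partial>lborel) - (\<integral>y. indicator (dyadic_cube k x) y * u x \<partial>lborel)"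
        using integrable_dyadic_cube[OF u, of k x] by (simp add: right_diff_distrib)
      also have "(\<integral>y. indicator (dyadic_cube k x) y * u x \<partial>lborel) = u x / ?c"
        using integral_indicator_dyadic_cube[of k x] by simp
      finally show ?thesis by (simp add: dyadic_average_def field_simps)
    qed
    then have "ennreal ((norm (u x - dyadic_average k u x))\<^sup>2)
        = ennreal ((?c * (\<integral>y. indicator (dyadic_cube k x) y * (u y - u x) \<partial>lborel))\<^sup>2)"
      by simp
    also have "\<dots> \<le> ennreal ?c * (\<integral>\<^sup>+y. indicator (dyadic_cube k x) y * ennreal ((u y - u x)\<^sup>2) \<partial>lborel)"
      by (rule dyadic_average_sq_le) measurable
    also have "(\<integral>\<^sup>+y. indicator (dyadic_cube k x) y * ennreal ((u y - u x)\<^sup>2) \<partial>lborel)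
        = (\<integral>\<^sup>+h. indicator (dyadic_cube k x) (h + x) * ennreal ((u (h + x) - u x)\<^sup>2) \<partial>lborel)"
      by (rule nn_integral_translate[symmetric]) measurable
    also have "\<dots> \<le> (\<integral>\<^sup>+h. indicator W h * ennreal ((u (x + h) - u x)\<^sup>2) \<partial>lborel)"
    proof (rule nn_integral_mono)
      fix h
      have "h \<in> W" if "h + x \<in> dyadic_cube k x"
        using dyadic_cube_dist[OF that] by (auto simp: W_def mem_box abs_le_iff minus_le_iff)
      then show "indicator (dyadic_cube k x) (h + x) * ennreal ((u (h + x) - u x)\<^sup>2)
          \<le> indicator W h * ennreal ((u (x + h) - u x)\<^sup>2)"
        by (auto simp: indicator_def add.commute)
    qed
    finally show ?thesis by (simp add: mult_left_mono)
  qed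
  have "(\<integral>\<^sup>+x. ennreal ((norm (u x - dyadic_average k u x))\<^sup>2) \<partial>lborel)
      \<le> (\<integral>\<^sup>+x. ennreal ?c * (\<integral>\<^sup>+h. indicator W h * ennreal ((u (x + h) - u x)\<^sup>2) \<partial>lborel) \<partial>lborel)"
    by (intro nn_integral_mono pt)
  also have "\<dots> = ennreal ?c * (\<integral>\<^sup>+x. \<integral>\<^sup>+h. indicator W h * ennreal ((u (x + h) - u x)\<^sup>2) \<partial>lborel \<partial>lborel)"
    by (rule nn_integral_cmult) measurable
  also have "(\<integral>\<^sup>+x. \<integral>\<^sup>+h. indicator W h * ennreal ((u (x + h) - u x)\<^sup>2) \<partial>lborel \<partial>lborel)
      = (\<integral>\<^sup>+h. \<integral>\<^sup>+x. indicator W h * ennreal ((u (x + h) - u x)\<^sup>2) \<partial>lborel \<partial>lborel)"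
    by (rule lborel_pair.Fubini'[symmetric]) measurable
  also have "\<dots> \<le> (\<integral>\<^sup>+h. ennreal B * indicator W h \<partial>lborel)"
  proof (rule nn_integral_mono)
    fix h
    show "(\<integral>\<^sup>+x. indicator W h * ennreal ((u (x + h) - u x)\<^sup>2) \<partial>lborel) \<le> ennreal B * indicator W h"
    proof (cases "h \<in> W")
      case True
      have "norm h \<le> (\<Sum>e\<in>Basis. \<bar>h \<bullet> e\<bar>)" by (rule norm_le_l1)
      also have "\<dots> \<le> (\<Sum>e\<in>(Basis :: 'a set). (1/2) ^ k)"
        using True by (intro sum_mono) (auto simp: W_def mem_box abs_le_iff minus_le_iff)
      finally have "(norm h)\<^sup>2 \<le> (real DIM('a) * (1/2) ^ k)\<^sup>2" by (intro power_mono) auto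
      also have "\<dots> = (real DIM('a))\<^sup>2 * (1/4) ^ k"
      proof -
        have "((1/2) ^ k)\<^sup>2 = (1/4 :: real) ^ k" by (simp add: power2_eq_square flip: power_mult_distrib)
        then show ?thesis by (simp only: power_mult_distrib)
      qed
      finally have hB: "(norm h)\<^sup>2 * L2_inner g g \<le> B" by (simp add: B_def mult_right_mono)
      have "square_integrable (\<lambda>x. u (x + h) - u x)"
        by (intro square_integrable_diff square_integrable_translate u)
      from nn_integral_norm_sq[OF this]
      have "(\<integral>\<^sup>+x. ennreal ((u (x + h) - u x)\<^sup>2) \<partial>lborel) = ennreal (L2_inner (\<lambda>x. u (x + h) - u x) (\<lambda>x. u (x + h) - u x))"
        by simp
      also have "\<dots> \<le> ennreal B"
        using H1_difference_quotient[OF wg u g, of h] hB by (intro ennreal_leI) linarith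
      finally show ?thesis using True by simp
    qed simp
  qed
  also have "\<dots> = ennreal B * ennreal ((2 * (1/2) ^ k) ^ DIM('a))"
    by (simp add: nn_integral_cmult W)
  also have "ennreal ?c * \<dots> = ennreal (?c * (B * (2 * (1/2) ^ k) ^ DIM('a)))"
    using B by (simp add: ennreal_mult)
  also have "?c * (B * (2 * (1/2) ^ k) ^ DIM('a)) = poincare_const TYPE('a) * (1/4) ^ k * L2_inner g g"
  proof -
    have "?c * (2 * (1/2) ^ k) ^ DIM('a) = (2 ^ k * (2 * (1/2) ^ k)) ^ DIM('a)"
      by (simp add: power_mult power_mult_distrib)
    also have "2 ^ k * (2 * (1/2) ^ k) = (2::real)" by (simp add: power_one_over)
    finally show ?thesis by (simp add: B_def poincare_const_def)
  qed
  finally have "(\<integral>\<^sup>+x. ennreal ((norm (u x - dyadic_average k u x))\<^sup>2) \<partial>lborel)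
      \<le> ennreal (poincare_const TYPE('a) * (1/4) ^ k * L2_inner g g)" by (simp add: mult_left_mono)
  then show ?thesis
    by (rule square_integrable_nn_integralI(2)[rotated]) (auto simp: poincare_const_def)
qed

section \<open>The Sobolev inequality in dimension at most three\<close>

lemma nn_integral_pow4_le:
  assumes f: "square_integrable f" and M: "\<And>x. (f x)\<^sup>2 \<le> M" "0 \<le> M"
  shows "(\<integral>\<^sup>+x. ennreal ((f x) ^ 4) \<partial>lborel) \<le> ennreal (M * L2_inner f f)"
proof -
  note [measurable] = square_integrable_measurable[OF f]
  have "(\<integral>\<^sup>+x. ennreal ((f x) ^ 4) \<partial>lborel) \<le> (\<integral>\<^sup>+x. ennreal M * ennreal ((norm (f x))\<^sup>2) \<partial>lborel)"
  proof (rule nn_integral_mono)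
    fix x
    have "(f x) ^ 4 = (f x)\<^sup>2 * (f x)\<^sup>2" by (simp add: power4_eq_xxxx power2_eq_square)
    also have "\<dots> \<le> M * (f x)\<^sup>2" by (intro mult_right_mono M) simp
    finally have "ennreal ((f x) ^ 4) \<le> ennreal (M * (f x)\<^sup>2)" by (rule ennreal_leI)
    then show "ennreal ((f x) ^ 4) \<le> ennreal M * ennreal ((norm (f x))\<^sup>2)"
      using M(2) by (simp add: ennreal_mult)
  qed
  also have "\<dots> = ennreal M * ennreal (L2_inner f f)"
    by (subst nn_integral_cmult) (simp_all only: nn_integral_norm_sq[OF f], measurable)
  also have "\<dots> = ennreal (M * L2_inner f f)"
    using M(2) by (simp add: ennreal_mult)
  finally show ?thesis .
qed

lemma L4_nn_integralI:
  assumes "f \<in> borel_measurable lborel" "(\<integral>\<^sup>+x. ennreal ((f x) ^ 4) \<partial>lborel) \<le> ennreal c" "0 \<le> c"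
  shows "L4 f" "(\<integral>x. (f x) ^ 4 \<partial>lborel) \<le> c"
proof -
  note [measurable] = assms(1)
  have int: "integrable lborel (\<lambda>x. (f x) ^ 4)"
    using assms(2) by (intro integrableI_nonneg) (auto simp: less_top[symmetric] top_unique)
  then show "L4 f" by (simp add: L4_def assms(1))
  have "ennreal (\<integral>x. (f x) ^ 4 \<partial>lborel) = (\<integral>\<^sup>+x. ennreal ((f x) ^ 4) \<partial>lborel)"
    by (rule nn_integral_eq_integral[symmetric]) (use int in auto)
  also have "\<dots> \<le> ennreal c" by (rule assms(2))
  finally show "(\<integral>x. (f x) ^ 4 \<partial>lborel) \<le> c" using assms(3) by (simp add: ennreal_le_iff)
qed

text \<open>A bounded square integrable function has an integrable fourth power. The constant grows
  with the level, so this serves for the averages at one fixed level, while the tail beyond that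
  level is estimated through increments.\<close>

lemma dyadic_average_L4:
  fixes u :: "'a::euclidean_space \<Rightarrow> real"
  assumes u: "square_integrable u"
  shows "L4 (dyadic_average k u)"
    "(\<integral>x. (dyadic_average k u x) ^ 4 \<partial>lborel) \<le> 2 ^ (k * DIM('a)) * (L2_inner u u)\<^sup>2"
proof -
  note [measurable] = square_integrable_measurable[OF u]
  have "(\<integral>\<^sup>+x. ennreal ((dyadic_average k u x) ^ 4) \<partial>lborel)
      \<le> ennreal ((2 ^ (k * DIM('a)) * L2_inner u u) * L2_inner (dyadic_average k u) (dyadic_average k u))"
    by (rule nn_integral_pow4_le) (auto intro!: dyadic_average_contraction dyadic_average_bound u)
  also have "\<dots> \<le> ennreal ((2 ^ (k * DIM('a)) * L2_inner u u) * L2_inner u u)"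
    by (intro ennreal_leI mult_left_mono dyadic_average_contraction u) auto
  finally have *: "(\<integral>\<^sup>+x. ennreal ((dyadic_average k u x) ^ 4) \<partial>lborel)
      \<le> ennreal (2 ^ (k * DIM('a)) * (L2_inner u u)\<^sup>2)" by (simp add: power2_eq_square mult.assoc)
  have "dyadic_average k u \<in> borel_measurable lborel" by measurable
  from L4_nn_integralI[OF this *]
  show "L4 (dyadic_average k u)"
    "(\<integral>x. (dyadic_average k u x) ^ 4 \<partial>lborel) \<le> 2 ^ (k * DIM('a)) * (L2_inner u u)\<^sup>2" by auto
qed

text \<open>The restriction on the dimension enters here: \<open>2 ^ N / 16 \<le> 1 / 2\<close> exactly for \<open>N \<le> 3\<close>.\<close>

lemma dyadic_increment_pow4:
  fixes u :: "'a::euclidean_space \<Rightarrow> real"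
  assumes dim: "DIM('a) \<le> 3" and wg: "weak_gradient u g" and u: "square_integrable u" and g: "square_integrable g"
  shows "(\<integral>\<^sup>+x. ennreal ((dyadic_average (Suc k) u x - dyadic_average k u x) ^ 4) \<partial>lborel)
    \<le> ennreal (8 * (poincare_const TYPE('a) * L2_inner g g)\<^sup>2 * (1/2) ^ k)"
proof -
  let ?v = "\<lambda>x. u x - dyadic_average k u x"
  define \<delta> where "\<delta> = poincare_const TYPE('a) * (1/4) ^ k * L2_inner g g"
  have v: "square_integrable ?v"
    by (intro square_integrable_diff u dyadic_average_contraction)
  have \<delta>: "L2_inner ?v ?v \<le> \<delta>" unfolding \<delta>_def by (rule dyadic_poincare[OF wg u g])
  have \<delta>0: "0 \<le> \<delta>" by (simp add: \<delta>_def poincare_const_def)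
  note w = dyadic_average_contraction[OF v, of "Suc k"]
  let ?c = "2 ^ (Suc k * DIM('a)) :: real"
  have "(\<integral>\<^sup>+x. ennreal ((dyadic_average (Suc k) u x - dyadic_average k u x) ^ 4) \<partial>lborel)
      = (\<integral>\<^sup>+x. ennreal ((dyadic_average (Suc k) ?v x) ^ 4) \<partial>lborel)"
    by (simp only: dyadic_average_step[OF u])
  also have "\<dots> \<le> ennreal ((?c * \<delta>) * L2_inner (dyadic_average (Suc k) ?v) (dyadic_average (Suc k) ?v))"
  proof (rule nn_integral_pow4_le[OF w(1)])
    show "(dyadic_average (Suc k) ?v x)\<^sup>2 \<le> ?c * \<delta>" for x
      by (rule order_trans[OF dyadic_average_bound[OF v]]) (intro mult_left_mono \<delta>, simp)
    show "0 \<le> ?c * \<delta>" using \<delta>0 by simp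
  qed
  also have "\<dots> \<le> ennreal ((?c * \<delta>) * \<delta>)"
    using w(2) \<delta> \<delta>0 by (intro ennreal_leI mult_left_mono) auto
  also have "(?c * \<delta>) * \<delta> \<le> 8 * (poincare_const TYPE('a) * L2_inner g g)\<^sup>2 * (1/2) ^ k"
  proof -
    have "?c \<le> 2 ^ (Suc k * 3)" using dim by (intro power_increasing mult_le_mono) auto
    also have "(2::real) ^ (Suc k * 3) = (2 ^ 3) ^ Suc k"
      by (simp only: mult.commute[of "Suc k"] power_mult)
    also have "\<dots> = 8 * 8 ^ k" by simp
    finally have c: "?c \<le> 8 * 8 ^ k" .
    have "(?c * \<delta>) * \<delta> = ?c * ((poincare_const TYPE('a) * L2_inner g g)\<^sup>2 * (1/16) ^ k)"
    proof -
      have "(1/4) ^ k * (1/4) ^ k = (1/16 :: real) ^ k" by (subst power_mult_distrib[symmetric]) simp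
      moreover have "(?c * \<delta>) * \<delta> = ?c * ((poincare_const TYPE('a) * L2_inner g g)\<^sup>2 * ((1/4) ^ k * (1/4) ^ k))"
        by (simp add: \<delta>_def power2_eq_square mult_ac)
      ultimately show ?thesis by simp
    qed
    also have "\<dots> \<le> (8 * 8 ^ k) * ((poincare_const TYPE('a) * L2_inner g g)\<^sup>2 * (1/16) ^ k)"
      by (intro mult_right_mono c) auto
    also have "\<dots> = 8 * (poincare_const TYPE('a) * L2_inner g g)\<^sup>2 * (8 ^ k * (1/16) ^ k)" by simp
    also have "8 ^ k * (1/16) ^ k = (1/2 :: real) ^ k" by (subst power_mult_distrib[symmetric]) simp
    finally show ?thesis .
  qed
  then have "ennreal ((?c * \<delta>) * \<delta>) \<le> ennreal (8 * (poincare_const TYPE('a) * L2_inner g g)\<^sup>2 * (1/2) ^ k)"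
    by (rule ennreal_leI)
  finally show ?thesis .
qed

lemma geometric_sum_atLeastLessThan_le:
  fixes x :: real
  assumes "0 \<le> x" "x < 1"
  shows "(\<Sum>k\<in>{K..<m}. x ^ k) \<le> x ^ K / (1 - x)"
proof (cases "K \<le> m")
  case True
  have "(1 - x) * (\<Sum>k\<in>{K..<m}. x ^ k) = x ^ K - x ^ m"
    using True by (induction m rule: dec_induct) (auto simp: distrib_left left_diff_distrib)
  also have "\<dots> \<le> x ^ K" using assms by simp
  finally show ?thesis using assms by (simp add: field_simps)
qed (use assms in simp)

text \<open>A weighted Hoelder inequality with exponents 4/3 and 4, obtained from two uses of
  Cauchy-Schwarz. Being pointwise, it allows the fourth power of a telescoping sum to be integrated
  term by term.\<close>

lemma sum_pow4_weighted_le: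
  fixes d :: "nat \<Rightarrow> real"
  assumes s: "s > 0"
  shows "(\<Sum>k\<in>A. d k) ^ 4 \<le> (\<Sum>k\<in>A. (s\<^sup>2) ^ k) ^ 3 * (\<Sum>k\<in>A. (d k) ^ 4 / (s ^ 6) ^ k)"
proof -
  let ?S = "\<Sum>k\<in>A. (s\<^sup>2) ^ k"
  have S: "?S \<ge> 0" by (intro sum_nonneg) simp
  have sq: "(s ^ k)\<^sup>2 = (s\<^sup>2) ^ k" for k by (simp add: mult.commute flip: power_mult)
  have pos: "s ^ k > 0" for k using s by simp
  have "(\<Sum>k\<in>A. s ^ k * (d k / s ^ k))\<^sup>2 \<le> (\<Sum>k\<in>A. (s ^ k)\<^sup>2) * (\<Sum>k\<in>A. (d k / s ^ k)\<^sup>2)"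
    by (rule Cauchy_Schwarz_ineq_sum)
  then have 1: "(\<Sum>k\<in>A. d k)\<^sup>2 \<le> ?S * (\<Sum>k\<in>A. (d k / s ^ k)\<^sup>2)"
    using s by (simp add: sq)
  have "(\<Sum>k\<in>A. s ^ k * ((d k / s ^ k)\<^sup>2 / s ^ k))\<^sup>2 \<le> (\<Sum>k\<in>A. (s ^ k)\<^sup>2) * (\<Sum>k\<in>A. ((d k / s ^ k)\<^sup>2 / s ^ k)\<^sup>2)"
    by (rule Cauchy_Schwarz_ineq_sum)
  then have 2: "(\<Sum>k\<in>A. (d k / s ^ k)\<^sup>2)\<^sup>2 \<le> ?S * (\<Sum>k\<in>A. ((d k / s ^ k)\<^sup>2 / s ^ k)\<^sup>2)"
    using s by (simp add: sq)
  have eq: "((d k / s ^ k)\<^sup>2 / s ^ k)\<^sup>2 = (d k) ^ 4 / (s ^ 6) ^ k" for k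
  proof -
    have "((a / t)\<^sup>2 / t)\<^sup>2 = a ^ 4 / t ^ 6" for a t :: real
      by (simp add: eval_nat_numeral)
    then have "((d k / s ^ k)\<^sup>2 / s ^ k)\<^sup>2 = (d k) ^ 4 / (s ^ k) ^ 6" by blast
    also have "(s ^ k) ^ 6 = (s ^ 6) ^ k" by (simp add: mult.commute flip: power_mult)
    finally show ?thesis .
  qed
  have "(\<Sum>k\<in>A. d k) ^ 4 = ((\<Sum>k\<in>A. d k)\<^sup>2)\<^sup>2" by simp
  also have "\<dots> \<le> (?S * (\<Sum>k\<in>A. (d k / s ^ k)\<^sup>2))\<^sup>2" by (rule power_mono[OF 1]) simp
  also have "\<dots> = ?S\<^sup>2 * (\<Sum>k\<in>A. (d k / s ^ k)\<^sup>2)\<^sup>2" by (simp add: power_mult_distrib)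
  also have "\<dots> \<le> ?S\<^sup>2 * (?S * (\<Sum>k\<in>A. ((d k / s ^ k)\<^sup>2 / s ^ k)\<^sup>2))" by (intro mult_left_mono 2) simp
  also have "\<dots> = ?S ^ 3 * (\<Sum>k\<in>A. (d k) ^ 4 / (s ^ 6) ^ k)" unfolding eq by (simp add: power2_eq_square power3_eq_cube mult.assoc)
  finally show ?thesis .
qed

text \<open>\<open>40000 = 8 * 5000\<close>: the \<open>8\<close> comes from
  \<open>dyadic_increment_pow4\<close>, and \<open>5000\<close> bounds
  \<open>1 / ((1 - s^2)^3 * (1 - q))\<close>, the factor left by the two geometric series in the
  telescoping estimate.\<close>

definition tail_const :: "'a::euclidean_space itself \<Rightarrow> real" where
  "tail_const _ = 40000 * (poincare_const TYPE('a))\<^sup>2"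

text \<open>The ratio \<open>19/20\<close> of the weights only has to satisfy \<open>1/2 < s ^ 6 < 1\<close>.\<close>

lemma dyadic_telescope_pow4:
  fixes u :: "'a::euclidean_space \<Rightarrow> real"
  assumes dim: "DIM('a) \<le> 3" and wg: "weak_gradient u g" and u: "square_integrable u" and g: "square_integrable g"
    and "K \<le> m"
  shows "(\<integral>\<^sup>+x. ennreal ((dyadic_average m u x - dyadic_average K u x) ^ 4) \<partial>lborel)
    \<le> ennreal (tail_const TYPE('a) * (1/2) ^ K * (L2_inner g g)\<^sup>2)"
proof -
  note [measurable] = square_integrable_measurable[OF u]
  define s :: real where "s = 19/20"
  define C where "C = 8 * (poincare_const TYPE('a) * L2_inner g g)\<^sup>2"
  define d where "d k x = dyadic_average (Suc k) u x - dyadic_average k u x" for k x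
  have [measurable]: "d k \<in> borel_measurable borel" for k unfolding d_def[abs_def] by measurable
  have C: "C \<ge> 0" by (simp add: C_def)
  define S where "S = (\<Sum>k\<in>{K..<m}. (s\<^sup>2) ^ k) ^ 3"
  have S: "0 \<le> S" "S \<le> ((s\<^sup>2) ^ K / (1 - s\<^sup>2)) ^ 3"
  proof -
    have "(\<Sum>k\<in>{K..<m}. (s\<^sup>2) ^ k) \<le> (s\<^sup>2) ^ K / (1 - s\<^sup>2)"
      by (rule geometric_sum_atLeastLessThan_le) (auto simp: s_def power2_eq_square)
    moreover have "0 \<le> (\<Sum>k\<in>{K..<m}. (s\<^sup>2) ^ k)" by (intro sum_nonneg) simp
    ultimately show "0 \<le> S" "S \<le> ((s\<^sup>2) ^ K / (1 - s\<^sup>2)) ^ 3"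
      unfolding S_def by (auto intro: power_mono)
  qed
  have tele: "dyadic_average m u x - dyadic_average K u x = (\<Sum>k\<in>{K..<m}. d k x)" for x
    unfolding d_def using \<open>K \<le> m\<close> by (simp add: sum_Suc_diff'[of K m "\<lambda>k. dyadic_average k u x"])
  have "(\<integral>\<^sup>+x. ennreal ((dyadic_average m u x - dyadic_average K u x) ^ 4) \<partial>lborel)
      \<le> (\<integral>\<^sup>+x. (\<Sum>k\<in>{K..<m}. ennreal (S / (s ^ 6) ^ k) * ennreal ((d k x) ^ 4)) \<partial>lborel)"
  proof (rule nn_integral_mono)
    fix x
    have "(\<Sum>k\<in>{K..<m}. d k x) ^ 4 \<le> S * (\<Sum>k\<in>{K..<m}. (d k x) ^ 4 / (s ^ 6) ^ k)"
      unfolding S_def by (rule sum_pow4_weighted_le) (simp add: s_def)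
    also have "\<dots> = (\<Sum>k\<in>{K..<m}. S / (s ^ 6) ^ k * (d k x) ^ 4)" by (simp add: sum_distrib_left)
    finally have "ennreal ((\<Sum>k\<in>{K..<m}. d k x) ^ 4) \<le> ennreal (\<Sum>k\<in>{K..<m}. S / (s ^ 6) ^ k * (d k x) ^ 4)"
      by (rule ennreal_leI)
    also have "\<dots> = (\<Sum>k\<in>{K..<m}. ennreal (S / (s ^ 6) ^ k * (d k x) ^ 4))"
      using S(1) by (intro sum_ennreal[symmetric]) (auto simp: s_def)
    also have "\<dots> = (\<Sum>k\<in>{K..<m}. ennreal (S / (s ^ 6) ^ k) * ennreal ((d k x) ^ 4))"
      using S(1) by (intro sum.cong refl ennreal_mult) (auto simp: s_def)
    finally show "ennreal ((dyadic_average m u x - dyadic_average K u x) ^ 4)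
        \<le> (\<Sum>k\<in>{K..<m}. ennreal (S / (s ^ 6) ^ k) * ennreal ((d k x) ^ 4))"
      by (simp only: tele)
  qed
  also have "\<dots> = (\<Sum>k\<in>{K..<m}. ennreal (S / (s ^ 6) ^ k) * (\<integral>\<^sup>+x. ennreal ((d k x) ^ 4) \<partial>lborel))"
    by (subst nn_integral_sum) (auto intro!: sum.cong nn_integral_cmult)
  also have "\<dots> \<le> (\<Sum>k\<in>{K..<m}. ennreal (S / (s ^ 6) ^ k) * ennreal (C * (1/2) ^ k))"
    unfolding d_def C_def by (intro sum_mono mult_left_mono dyadic_increment_pow4 assms) auto
  also have "\<dots> = (\<Sum>k\<in>{K..<m}. ennreal (S / (s ^ 6) ^ k * (C * (1/2) ^ k)))"
    using S(1) C by (intro sum.cong refl ennreal_mult[symmetric]) (auto simp: s_def)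
  also have "\<dots> = ennreal (\<Sum>k\<in>{K..<m}. S / (s ^ 6) ^ k * (C * (1/2) ^ k))"
    using S(1) C by (intro sum_ennreal) (auto simp: s_def)
  also have "(\<Sum>k\<in>{K..<m}. S / (s ^ 6) ^ k * (C * (1/2) ^ k)) \<le> tail_const TYPE('a) * (1/2) ^ K * (L2_inner g g)\<^sup>2"
  proof -
    \<comment> \<open>Ratio of the series of weighted increments: \<open>(1/2) ^ k\<close> from the
      increments against \<open>(s ^ 6) ^ k\<close> from the weights. It is below \<open>1\<close>,
      and \<open>s ^ 6 * q = 1/2\<close> restores the decay in \<open>K\<close>.\<close>
    define q where "q = 1 / (2 * s ^ 6)"
    have q: "0 \<le> q" "q < 1" by (simp_all add: q_def s_def power_numeral_reduce)
    have "(\<Sum>k\<in>{K..<m}. S / (s ^ 6) ^ k * (C * (1/2) ^ k)) = S * C * (\<Sum>k\<in>{K..<m}. q ^ k)"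
      by (simp add: sum_distrib_left q_def power_mult_distrib power_divide mult.commute)
    also have "\<dots> \<le> S * C * (q ^ K / (1 - q))"
      using S(1) C by (intro mult_left_mono geometric_sum_atLeastLessThan_le q) auto
    also have "\<dots> \<le> (((s\<^sup>2) ^ K / (1 - s\<^sup>2)) ^ 3) * C * (q ^ K / (1 - q))"
      using S C q by (intro mult_right_mono) auto
    also have "\<dots> = (((s\<^sup>2) ^ K) ^ 3 * q ^ K) * (C / ((1 - s\<^sup>2) ^ 3 * (1 - q)))"
      by (simp add: power_divide)
    also have "((s\<^sup>2) ^ K) ^ 3 * q ^ K = (s ^ 6 * q) ^ K"
      by (simp add: power_mult_distrib mult_ac flip: power_mult)
    also have "s ^ 6 * q = 1/2" by (simp add: q_def s_def)
    also have "C / ((1 - s\<^sup>2) ^ 3 * (1 - q)) \<le> C * 5000"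
    proof -
      have "1 / ((1 - s\<^sup>2) ^ 3 * (1 - q)) \<le> 5000" by (simp add: q_def s_def power_numeral_reduce)
      from mult_left_mono[OF this C] show ?thesis by simp
    qed
    then have "(1/2) ^ K * (C / ((1 - s\<^sup>2) ^ 3 * (1 - q))) \<le> (1/2) ^ K * (C * 5000)"
      by (intro mult_left_mono) auto
    also have "(1/2) ^ K * (C * 5000) = tail_const TYPE('a) * (1/2) ^ K * (L2_inner g g)\<^sup>2"
      by (simp add: C_def tail_const_def power_mult_distrib)
    finally show ?thesis .
  qed
  then have "ennreal (\<Sum>k\<in>{K..<m}. S / (s ^ 6) ^ k * (C * (1/2) ^ k)) \<le> ennreal (tail_const TYPE('a) * (1/2) ^ K * (L2_inner g g)\<^sup>2)"
    by (rule ennreal_leI)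
  finally show ?thesis .
qed

text \<open>The squared errors in the Poincare inequality are summable over the levels, so the
  errors tend to zero at almost every point.\<close>

lemma dyadic_average_AE_tendsto:
  fixes u :: "'a::euclidean_space \<Rightarrow> real"
  assumes wg: "weak_gradient u g" and u: "square_integrable u" and g: "square_integrable g"
  shows "AE x in lborel. (\<lambda>k. dyadic_average k u x) \<longlonglongrightarrow> u x"
proof -
  note [measurable] = square_integrable_measurable[OF u]
  have "AE x in lborel. summable (\<lambda>k. (norm (u x - dyadic_average k u x))\<^sup>2)"
  proof (rule AE_summable_if_integrals_summable)
    fix k
    have "square_integrable (\<lambda>x. u x - dyadic_average k u x)"
      by (intro square_integrable_diff u dyadic_average_contraction)
    from nn_integral_norm_sq[OF this]
    show "(\<integral>\<^sup>+x. ennreal ((norm (u x - dyadic_average k u x))\<^sup>2) \<partial>lborel)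
        \<le> ennreal (poincare_const TYPE('a) * (1/4) ^ k * L2_inner g g)"
      using dyadic_poincare[OF wg u g, of k] by (simp add: ennreal_leI)
    show "(\<lambda>x. (norm (u x - dyadic_average k u x))\<^sup>2) \<in> borel_measurable lborel" by measurable
  next
    show "summable (\<lambda>k. poincare_const TYPE('a) * (1/4) ^ k * L2_inner g g)"
      by (intro summable_mult summable_mult2 summable_geometric) auto
  qed (auto simp: poincare_const_def)
  then show ?thesis
  proof eventually_elim
    case (elim x)
    from tendsto_real_sqrt[OF summable_LIMSEQ_zero[OF elim]]
    have "(\<lambda>k. u x - dyadic_average k u x) \<longlonglongrightarrow> 0" by (simp add: tendsto_rabs_zero_iff)
    from tendsto_diff[OF tendsto_const[of "u x"] this] show ?case by simp
  qed
qed

text \<open>The telescoping bound is uniform in the upper level \<open>m\<close>, so Fatou's lemma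
  carries it to the limit.\<close>

lemma dyadic_tail_L4:
  fixes u :: "'a::euclidean_space \<Rightarrow> real"
  assumes dim: "DIM('a) \<le> 3" and wg: "weak_gradient u g" and u: "square_integrable u" and g: "square_integrable g"
  shows "L4 (\<lambda>x. u x - dyadic_average K u x)"
    "(\<integral>x. (u x - dyadic_average K u x) ^ 4 \<partial>lborel) \<le> tail_const TYPE('a) * (1/2) ^ K * (L2_inner g g)\<^sup>2"
proof -
  note [measurable] = square_integrable_measurable[OF u]
  let ?B = "tail_const TYPE('a) * (1/2) ^ K * (L2_inner g g)\<^sup>2"
  have "(\<integral>\<^sup>+x. ennreal ((u x - dyadic_average K u x) ^ 4) \<partial>lborel)
      = (\<integral>\<^sup>+x. liminf (\<lambda>m. ennreal ((dyadic_average m u x - dyadic_average K u x) ^ 4)) \<partial>lborel)"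
  proof (rule nn_integral_cong_AE)
    show "AE x in lborel. ennreal ((u x - dyadic_average K u x) ^ 4)
        = liminf (\<lambda>m. ennreal ((dyadic_average m u x - dyadic_average K u x) ^ 4))"
      using dyadic_average_AE_tendsto[OF wg u g]
    proof eventually_elim
      case (elim x)
      have "(\<lambda>m. ennreal ((dyadic_average m u x - dyadic_average K u x) ^ 4)) \<longlonglongrightarrow> ennreal ((u x - dyadic_average K u x) ^ 4)"
        by (intro tendsto_intros tendsto_ennrealI elim)
      from lim_imp_Liminf[OF _ this] show ?case by simp
    qed
  qed
  also have "\<dots> \<le> liminf (\<lambda>m. \<integral>\<^sup>+x. ennreal ((dyadic_average m u x - dyadic_average K u x) ^ 4) \<partial>lborel)"
    by (rule nn_integral_liminf) measurable
  also have "\<dots> \<le> limsup (\<lambda>m. \<integral>\<^sup>+x. ennreal ((dyadic_average m u x - dyadic_average K u x) ^ 4) \<partial>lborel)"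
    by (rule Liminf_le_Limsup) simp
  also have "\<dots> \<le> ennreal ?B"
  proof (rule Limsup_bounded)
    show "\<forall>\<^sub>F m in sequentially. (\<integral>\<^sup>+x. ennreal ((dyadic_average m u x - dyadic_average K u x) ^ 4) \<partial>lborel) \<le> ennreal ?B"
      using eventually_ge_at_top[of K] by eventually_elim (rule dyadic_telescope_pow4[OF assms])
  qed
  finally have *: "(\<integral>\<^sup>+x. ennreal ((u x - dyadic_average K u x) ^ 4) \<partial>lborel) \<le> ennreal ?B" .
  have "(\<lambda>x. u x - dyadic_average K u x) \<in> borel_measurable lborel" by measurable
  from L4_nn_integralI[OF this *]
  show "L4 (\<lambda>x. u x - dyadic_average K u x)"
    "(\<integral>x. (u x - dyadic_average K u x) ^ 4 \<partial>lborel) \<le> ?B" by (auto simp: tail_const_def)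
qed

lemma H1_dyadic_tail:
  fixes u :: "'a::euclidean_space \<Rightarrow> real"
  assumes dim: "DIM('a) \<le> 3" and lam: "0 < lam" and u: "u \<in> H1"
  shows "L4 (\<lambda>x. u x - dyadic_average K u x)"
    "(\<integral>x. (u x - dyadic_average K u x) ^ 4 \<partial>lborel) \<le> tail_const TYPE('a) * (1/2) ^ K * (H1_form lam u u)\<^sup>2"
proof -
  note tail = dyadic_tail_L4[OF dim weak_gradient_grad[OF u] H1_square_integrable[OF u] grad_square_integrable[OF u], of K]
  show "L4 (\<lambda>x. u x - dyadic_average K u x)" by (rule tail)
  have "(L2_inner (grad u) (grad u))\<^sup>2 \<le> (H1_form lam u u)\<^sup>2"
    by (rule power_mono) (use lam in \<open>auto simp: H1_form_def\<close>)
  then have "tail_const TYPE('a) * (1/2) ^ K * (L2_inner (grad u) (grad u))\<^sup>2 \<le> tail_const TYPE('a) * (1/2) ^ K * (H1_form lam u u)\<^sup>2"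
    by (intro mult_left_mono) (auto simp: tail_const_def)
  with tail(2) show "(\<integral>x. (u x - dyadic_average K u x) ^ 4 \<partial>lborel) \<le> tail_const TYPE('a) * (1/2) ^ K * (H1_form lam u u)\<^sup>2"
    by linarith
qed

lemma L2_inner_le_H1_form: "0 < lam \<Longrightarrow> L2_inner u u \<le> H1_form lam u u / lam"
  by (simp add: H1_form_def field_simps)

text \<open>Split at level \<open>0\<close>: the gradient controls the tail, the L2 norm controls
  the average over unit cubes.\<close>

theorem Sobolev_L4:
  assumes dim: "DIM('a::euclidean_space) \<le> 3" and lam: "0 < lam"
  obtains C where "C > 0"
    "\<And>u :: 'a \<Rightarrow> real. u \<in> H1 \<Longrightarrow> L4 u \<and> (\<integral>x. (u x) ^ 4 \<partial>lborel) \<le> C * (H1_form lam u u)\<^sup>2"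
proof
  \<comment> \<open>The \<open>8\<close> is that of \<open>L4_add\<close>;
    \<open>1 / lam\<^sup>2\<close> is the square of the constant in
    \<open>L2_inner_le_H1_form\<close>.\<close>
  let ?C = "8 * (tail_const TYPE('a) + 1 / lam\<^sup>2) :: real"
  show "?C > 0" using lam by (simp add: tail_const_def add_nonneg_pos)
  fix u :: "'a \<Rightarrow> real" assume u: "u \<in> H1"
  note a = dyadic_average_L4[OF H1_square_integrable[OF u], of 0] and t = H1_dyadic_tail[OF dim lam u, of 0]
  have eq: "u = (\<lambda>x. (u x - dyadic_average 0 u x) + dyadic_average 0 u x)" by simp
  have "L4 u" using L4_add(1)[OF t(1) a(1)] by simp
  moreover have "(\<integral>x. (u x) ^ 4 \<partial>lborel) \<le> ?C * (H1_form lam u u)\<^sup>2"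
  proof -
    have "(\<integral>x. (u x) ^ 4 \<partial>lborel) \<le> 8 * ((\<integral>x. (u x - dyadic_average 0 u x) ^ 4 \<partial>lborel) + (\<integral>x. (dyadic_average 0 u x) ^ 4 \<partial>lborel))"
      using L4_add(2)[OF t(1) a(1)] by simp
    also have "\<dots> \<le> 8 * (tail_const TYPE('a) * (H1_form lam u u)\<^sup>2 + (H1_form lam u u / lam)\<^sup>2)"
    proof -
      have "(L2_inner u u)\<^sup>2 \<le> (H1_form lam u u / lam)\<^sup>2"
        by (rule power_mono[OF L2_inner_le_H1_form[OF lam]]) simp
      then show ?thesis using a(2) t(2) by simp
    qed
    also have "\<dots> = ?C * (H1_form lam u u)\<^sup>2" by (simp add: power_divide algebra_simps)
    finally show ?thesis .
  qed
  ultimately show "L4 u \<and> (\<integral>x. (u x) ^ 4 \<partial>lborel) \<le> ?C * (H1_form lam u u)\<^sup>2" ..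
qed

section \<open>Minimizing sequences and weak limits\<close>

text \<open>The Sobolev inequality makes the infimum positive, and \<open>v0\<close> makes the
  constraint set nonempty. Approximate minimizers are all that is provided here: by translation
  invariance they may drift away.\<close>

lemma sobolev_quotient_infimum:
  fixes v0 :: "'a::euclidean_space \<Rightarrow> real"
  assumes dim: "DIM('a) \<le> 3" and lam: "0 < lam" and v0: "v0 \<in> H1" "\<not> (AE x in lborel. v0 x = 0)"
  obtains S where "S > 0"
    "\<And>u :: 'a \<Rightarrow> real. u \<in> H1 \<Longrightarrow> S * sqrt (\<integral>x. (u x) ^ 4 \<partial>lborel) \<le> H1_form lam u u"
    "\<And>e. e > 0 \<Longrightarrow> \<exists>v :: 'a \<Rightarrow> real. v \<in> H1 \<and> (\<integral>x. (v x) ^ 4 \<partial>lborel) = 1 \<and> H1_form lam v v < S + e"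
proof -
  obtain C where C: "C > 0" and sob: "\<And>u :: 'a \<Rightarrow> real. u \<in> H1 \<Longrightarrow> L4 u \<and> (\<integral>x. (u x) ^ 4 \<partial>lborel) \<le> C * (H1_form lam u u)\<^sup>2"
    using Sobolev_L4[OF dim lam] by blast
  define V where "V = {v :: 'a \<Rightarrow> real. v \<in> H1 \<and> (\<integral>x. (v x) ^ 4 \<partial>lborel) = 1}"
  define S where "S = (INF v\<in>V. H1_form lam v v)"
  have normalize: "(\<lambda>x. 1 / L4_norm u * u x) \<in> V"
    "H1_form lam (\<lambda>x. 1 / L4_norm u * u x) (\<lambda>x. 1 / L4_norm u * u x) = H1_form lam u u / sqrt (\<integral>x. (u x) ^ 4 \<partial>lborel)"
    if u: "u \<in> H1" and pos: "(\<integral>x. (u x) ^ 4 \<partial>lborel) > 0" for u :: "'a \<Rightarrow> real"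
  proof -
    have n: "L4_norm u > 0" using pos by (simp add: L4_norm_def)
    have "(\<integral>x. (1 / L4_norm u * u x) ^ 4 \<partial>lborel) = (1 / L4_norm u) ^ 4 * L4_norm u ^ 4"
      unfolding power_mult_distrib L4_norm_pow4 by simp
    also have "\<dots> = 1" using n by (simp flip: power_mult_distrib)
    finally show "(\<lambda>x. 1 / L4_norm u * u x) \<in> V" using u by (simp only: V_def mem_Collect_eq H1_mult(1))
    have "H1_form lam (\<lambda>x. 1 / L4_norm u * u x) (\<lambda>x. 1 / L4_norm u * u x) = H1_form lam u u / (L4_norm u)\<^sup>2"
      using H1_form_mult_left[OF u H1_mult(1)[OF u, of "1 / L4_norm u"], of lam "1 / L4_norm u"]
        H1_form_mult_right[OF u u, of lam "1 / L4_norm u"]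
      by (simp add: power2_eq_square)
    also have "(L4_norm u)\<^sup>2 = sqrt (\<integral>x. (u x) ^ 4 \<partial>lborel)" by (simp add: L4_norm_def)
    finally show "H1_form lam (\<lambda>x. 1 / L4_norm u * u x) (\<lambda>x. 1 / L4_norm u * u x) = H1_form lam u u / sqrt (\<integral>x. (u x) ^ 4 \<partial>lborel)" .
  qed
  have "(\<integral>x. (v0 x) ^ 4 \<partial>lborel) \<noteq> 0"
  proof
    assume "(\<integral>x. (v0 x) ^ 4 \<partial>lborel) = 0"
    then have "AE x in lborel. (v0 x) ^ 4 = 0"
      using sob[OF v0(1)] by (subst (asm) integral_nonneg_eq_0_iff_AE) (auto simp: L4_def)
    then show False using v0(2) by simp
  qed
  moreover have "(\<integral>x. (v0 x) ^ 4 \<partial>lborel) \<ge> 0" by (intro integral_nonneg_AE) simp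
  ultimately have "V \<noteq> {}" using normalize(1)[OF v0(1)] by fastforce
  have lower: "H1_form lam v v \<ge> 1 / sqrt C" if "v \<in> V" for v
  proof -
    have "1 \<le> C * (H1_form lam v v)\<^sup>2" using sob[of v] that by (simp add: V_def)
    then have "sqrt 1 \<le> sqrt (C * (H1_form lam v v)\<^sup>2)" by (rule real_sqrt_le_mono)
    then have "1 \<le> sqrt C * H1_form lam v v"
      using H1_form_ge_0[of lam v] lam by (simp add: real_sqrt_mult)
    then show ?thesis using C by (simp add: field_simps)
  qed
  have bdd: "bdd_below ((\<lambda>v. H1_form lam v v) ` V)" using lower by (auto intro!: bdd_belowI)
  have "S \<ge> 1 / sqrt C" unfolding S_def by (rule cINF_greatest) (use \<open>V \<noteq> {}\<close> lower in auto)
  then have "S > 0" using C by (meson less_le_trans real_sqrt_gt_zero zero_less_divide_1_iff)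
  show ?thesis
  proof (rule that[OF \<open>S > 0\<close>])
    fix u :: "'a \<Rightarrow> real" assume u: "u \<in> H1"
    have "(\<integral>x. (u x) ^ 4 \<partial>lborel) \<ge> 0" by (intro integral_nonneg_AE) simp
    then consider "(\<integral>x. (u x) ^ 4 \<partial>lborel) = 0" | "(\<integral>x. (u x) ^ 4 \<partial>lborel) > 0" by linarith
    then show "S * sqrt (\<integral>x. (u x) ^ 4 \<partial>lborel) \<le> H1_form lam u u"
    proof cases
      case 1
      then show ?thesis using lam by (simp add: H1_form_ge_0)
    next
      case 2
      have "S \<le> H1_form lam u u / sqrt (\<integral>x. (u x) ^ 4 \<partial>lborel)"
        using cINF_lower[OF bdd normalize(1)[OF u 2]] unfolding S_def normalize(2)[OF u 2] .
      then show ?thesis using 2 by (simp add: pos_le_divide_eq)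
    qed
  next
    fix e :: real assume "e > 0"
    then have "(INF v\<in>V. H1_form lam v v) < S + e" by (simp add: S_def)
    then obtain v where "v \<in> V" "H1_form lam v v < S + e"
      using cINF_less_iff[OF \<open>V \<noteq> {}\<close> bdd] by blast
    then show "\<exists>v :: 'a \<Rightarrow> real. v \<in> H1 \<and> (\<integral>x. (v x) ^ 4 \<partial>lborel) = 1 \<and> H1_form lam v v < S + e"
      by (auto simp: V_def)
  qed
qed

text \<open>Rules out that a minimizing sequence spreads out: at a level where the tail is small,
  uniformly small averages would leave a fourth power integral below \<open>1\<close>.\<close>

lemma nonvanishing_average:
  assumes dim: "DIM('a::euclidean_space) \<le> 3" and lam: "0 < lam"
  obtains K c where "c > 0"
    "\<And>v :: 'a \<Rightarrow> real. v \<in> H1 \<Longrightarrow> (\<integral>x. (v x) ^ 4 \<partial>lborel) = 1 \<Longrightarrow> H1_form lam v v \<le> B \<Longrightarrow>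
      \<exists>x. c \<le> (dyadic_average K v x)\<^sup>2"
proof -
  define B' where "B' = max B 1"
  have B': "B' > 0" by (simp add: B'_def)
  have "(\<lambda>K. tail_const TYPE('a) * (1/2) ^ K * B'\<^sup>2) \<longlonglongrightarrow> tail_const TYPE('a) * 0 * B'\<^sup>2"
    by (intro tendsto_intros LIMSEQ_power_zero) simp
  from order_tendstoD(2)[OF this, of "1/16"]
  obtain K where K: "tail_const TYPE('a) * (1/2) ^ K * B'\<^sup>2 < 1/16"
    by (auto simp: eventually_sequentially)
  \<comment> \<open>Chosen so that small averages contribute at most \<open>1/32\<close>; with less
    than \<open>1/16\<close> from the tail, \<open>8 * (1/16 + 1/32) < 1\<close> is the
    contradiction.\<close>
  define c where "c = lam / (32 * B')"
  have c: "c > 0" using lam B' by (simp add: c_def)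
  show ?thesis
  proof (rule that[OF c])
    fix v :: "'a \<Rightarrow> real" assume v: "v \<in> H1" "(\<integral>x. (v x) ^ 4 \<partial>lborel) = 1" "H1_form lam v v \<le> B"
    note sq = H1_square_integrable[OF v(1)]
    note a = dyadic_average_L4(1)[OF sq, of K] and t = H1_dyadic_tail[OF dim lam v(1), of K]
    show "\<exists>x. c \<le> (dyadic_average K v x)\<^sup>2"
    proof (rule ccontr)
      assume "\<not> ?thesis"
      then have less: "(dyadic_average K v x)\<^sup>2 \<le> c" for x using linear by blast
      have "(\<integral>\<^sup>+x. ennreal ((dyadic_average K v x) ^ 4) \<partial>lborel) \<le> ennreal (c * L2_inner (dyadic_average K v) (dyadic_average K v))"
        by (rule nn_integral_pow4_le[OF dyadic_average_contraction(1)[OF sq] less]) (use c in simp)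
      then have "(\<integral>x. (dyadic_average K v x) ^ 4 \<partial>lborel) \<le> c * L2_inner (dyadic_average K v) (dyadic_average K v)"
        using L4_measurable[OF a] c by (intro L4_nn_integralI(2)) auto
      also have "\<dots> \<le> c * (B' / lam)"
      proof (intro mult_left_mono)
        have "L2_inner v v \<le> B' / lam"
        proof -
          have "H1_form lam v v \<le> B'" using v(3) by (simp add: B'_def)
          then have "H1_form lam v v / lam \<le> B' / lam" using lam by (intro divide_right_mono) auto
          then show ?thesis using L2_inner_le_H1_form[OF lam, of v] by linarith
        qed
        then show "L2_inner (dyadic_average K v) (dyadic_average K v) \<le> B' / lam"
          using dyadic_average_contraction(2)[OF sq, of K] by linarith
      qed (use c in simp)
      also have "\<dots> = 1/32" using B' lam by (simp add: c_def)
      finally have av: "(\<integral>x. (dyadic_average K v x) ^ 4 \<partial>lborel) \<le> 1/32" .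
      have "(H1_form lam v v)\<^sup>2 \<le> B'\<^sup>2"
        using v(3) H1_form_ge_0[of lam v] lam by (intro power_mono) (auto simp: B'_def)
      then have "tail_const TYPE('a) * (1/2) ^ K * (H1_form lam v v)\<^sup>2 \<le> tail_const TYPE('a) * (1/2) ^ K * B'\<^sup>2"
        by (intro mult_left_mono) (auto simp: tail_const_def)
      then have "(\<integral>x. (v x - dyadic_average K v x) ^ 4 \<partial>lborel) < 1/16" using t(2) K by linarith
      moreover have "1 \<le> 8 * ((\<integral>x. (v x - dyadic_average K v x) ^ 4 \<partial>lborel) + (\<integral>x. (dyadic_average K v x) ^ 4 \<partial>lborel))"
        using L4_add(2)[OF t(1) a] v(2) by simp
      moreover have "False" if "a < 1/16" "1 \<le> 8 * (a + b)" "b \<le> 1/32" for a b :: real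
        using that by simp
      ultimately show False using av by blast
    qed
  qed
qed

section \<open>Lattice points and a diagonal subsequence\<close>

definition dyadic_corner :: "nat \<Rightarrow> 'a::euclidean_space \<Rightarrow> 'a" where
  "dyadic_corner k x = (\<Sum>e\<in>Basis. (\<lfloor>2 ^ k * (x \<bullet> e)\<rfloor> / 2 ^ k) *\<^sub>R e)"

lemma dyadic_corner_inner: "e \<in> Basis \<Longrightarrow> 2 ^ k * (dyadic_corner k x \<bullet> e) = \<lfloor>2 ^ k * (x \<bullet> e)\<rfloor>"
  by (simp add: dyadic_corner_def)

lemma dyadic_average_corner: "dyadic_average k u (dyadic_corner k x) = dyadic_average k u x"
  by (rule dyadic_average_cong_cube) (simp add: dyadic_cube_def dyadic_corner_inner)

text \<open>Shifting by a lattice point maps the grid of level \<open>k\<close> to itself, so an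
  average found on any cube can be moved to the cube of the origin unchanged.\<close>

lemma dyadic_average_translate_corner:
  fixes u :: "'a::euclidean_space \<Rightarrow> real"
  assumes [measurable]: "u \<in> borel_measurable borel"
  shows "dyadic_average k (\<lambda>y. u (y + dyadic_corner k x)) 0 = dyadic_average k u x"
proof -
  let ?p = "dyadic_corner k x"
  have "y \<in> dyadic_cube k 0 \<longleftrightarrow> y + ?p \<in> dyadic_cube k x" for y
    unfolding dyadic_cube_def mem_Collect_eq
    by (intro ball_cong refl) (simp add: inner_add_left distrib_left dyadic_corner_inner)
  then have "indicator (dyadic_cube k 0) y = (indicator (dyadic_cube k x) (y + ?p) :: real)" for y
    by (simp add: indicator_def)
  then show ?thesis
    unfolding dyadic_average_def
    using integral_translate[of "\<lambda>y. indicator (dyadic_cube k x) y * u y" ?p] by simp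
qed

lemma countable_range_dyadic_corner: "countable (range (dyadic_corner k :: 'a::euclidean_space \<Rightarrow> 'a))"
proof (rule countable_subset)
  let ?g = "\<lambda>f. \<Sum>e\<in>(Basis :: 'a set). (real_of_int (f e) / 2 ^ k) *\<^sub>R e"
  show "range (dyadic_corner k :: 'a \<Rightarrow> 'a) \<subseteq> ?g ` (Basis \<rightarrow>\<^sub>E UNIV)"
  proof safe
    fix x :: 'a
    show "dyadic_corner k x \<in> ?g ` (Basis \<rightarrow>\<^sub>E UNIV)"
      by (rule image_eqI[of _ _ "restrict (\<lambda>e. \<lfloor>2 ^ k * (x \<bullet> e)\<rfloor>) Basis"]) (auto simp: dyadic_corner_def)
  qed
  show "countable (?g ` (Basis \<rightarrow>\<^sub>E UNIV))"
    by (intro countable_image countable_PiE) auto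
qed

text \<open>An average depends on the point only through the corner of its cube, so there are
  countably many sequences to make convergent and a diagonal argument treats them together.\<close>

lemma dyadic_averages_convergent_subsequence:
  fixes v :: "nat \<Rightarrow> 'a::euclidean_space \<Rightarrow> real"
  assumes v: "\<And>n. square_integrable (v n)" "\<And>n. L2_inner (v n) (v n) \<le> B"
  obtains r :: "nat \<Rightarrow> nat" where "strict_mono r" "\<And>k x. convergent (\<lambda>n. dyadic_average k (v (r n)) x)"
proof -
  let ?I = "SIGMA k:UNIV. range (dyadic_corner k :: 'a \<Rightarrow> 'a)"
  \<comment> \<open>The divisor removes the growth of \<open>dyadic_average_bound\<close> with the
    level, because the diagonal argument asks for one bound for all indices.\<close>
  define f where "f n = (\<lambda>(k, p). dyadic_average k (v n) p / sqrt (2 ^ (k * DIM('a))))" for n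
  have "countable ?I" by (intro countable_SIGMA countable_range_dyadic_corner) simp
  moreover have "norm (f n i) \<le> sqrt B" for n i
  proof -
    obtain k p where i: "i = (k, p)" by (cases i)
    have "\<bar>dyadic_average k (v n) p\<bar> = sqrt ((dyadic_average k (v n) p)\<^sup>2)" by simp
    also have "\<dots> \<le> sqrt (2 ^ (k * DIM('a)) * B)"
      using dyadic_average_bound[OF v(1), of k n p] v(2)[of n]
      by (intro real_sqrt_le_mono) (meson mult_left_mono order_trans zero_le_numeral zero_le_power)
    finally show ?thesis
      by (simp add: i f_def abs_divide pos_divide_le_eq real_sqrt_mult mult.commute)
  qed
  ultimately obtain r :: "nat \<Rightarrow> nat" where r: "strict_mono r" "\<And>i. i \<in> ?I \<Longrightarrow> \<exists>l. (\<lambda>n. f (r n) i) \<longlonglongrightarrow> l"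
    using function_convergent_subsequence[of ?I f "sqrt B"] by blast
  show ?thesis
  proof (rule that[OF r(1)])
    fix k :: nat and x :: 'a
    obtain l where "(\<lambda>n. f (r n) (k, dyadic_corner k x)) \<longlonglongrightarrow> l" using r(2) by blast
    then have "(\<lambda>n. f (r n) (k, dyadic_corner k x) * sqrt (2 ^ (k * DIM('a)))) \<longlonglongrightarrow> l * sqrt (2 ^ (k * DIM('a)))"
      by (intro tendsto_intros)
    then show "convergent (\<lambda>n. dyadic_average k (v (r n)) x)"
      by (auto simp: f_def dyadic_average_corner convergent_def)
  qed
qed

text \<open>Closure under midpoints is all that the parallelogram argument below needs from a convex
  hull.\<close>

inductive_set midpoint_hull :: "('a \<Rightarrow> real) set \<Rightarrow> ('a \<Rightarrow> real) set" for V where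
  base: "v \<in> V \<Longrightarrow> v \<in> midpoint_hull V"
| midpoint: "f \<in> midpoint_hull V \<Longrightarrow> g \<in> midpoint_hull V \<Longrightarrow> (\<lambda>x. 1/2 * (f x + g x)) \<in> midpoint_hull V"

lemma midpoint_hull_mono: "f \<in> midpoint_hull V \<Longrightarrow> V \<subseteq> W \<Longrightarrow> f \<in> midpoint_hull W"
proof (induction rule: midpoint_hull.induct)
  case (midpoint f g)
  then show ?case by (intro midpoint_hull.midpoint)
qed (auto intro: midpoint_hull.base)

lemma midpoint_hull_H1: "f \<in> midpoint_hull V \<Longrightarrow> V \<subseteq> H1 \<Longrightarrow> f \<in> H1"
proof (induction rule: midpoint_hull.induct)
  case (midpoint f g)
  then show ?case by (intro H1_mult(1) H1_add(1))
qed auto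

text \<open>An interval around \<open>L\<close> is convex: once it contains the values on a tail of
  \<open>v\<close>, it contains the values on the whole hull of that tail.\<close>

lemma midpoint_hull_tendsto:
  fixes v :: "nat \<Rightarrow> 'a::euclidean_space \<Rightarrow> real" and l :: "('a \<Rightarrow> real) \<Rightarrow> real"
  assumes v: "\<And>n. v n \<in> H1" and z: "\<And>n. z n \<in> midpoint_hull (v ` {n..})"
    and mid: "\<And>f g. f \<in> H1 \<Longrightarrow> g \<in> H1 \<Longrightarrow> l (\<lambda>x. 1/2 * (f x + g x)) = (l f + l g) / 2"
    and lim: "(\<lambda>n. l (v n)) \<longlonglongrightarrow> L"
  shows "(\<lambda>n. l (z n)) \<longlonglongrightarrow> L"
proof (rule LIMSEQ_I)
  fix e :: real assume "e > 0"
  then obtain N where N: "\<And>n. n \<ge> N \<Longrightarrow> \<bar>l (v n) - L\<bar> < e"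
    using LIMSEQ_D[OF lim] by auto
  have "\<bar>l f - L\<bar> < e" if "f \<in> midpoint_hull (v ` {N..})" for f
    using that
  proof induction
    case (base f)
    then show ?case using N by auto
  next
    case (midpoint f g)
    have "f \<in> H1" "g \<in> H1" using midpoint(1,2) v by (auto intro: midpoint_hull_H1)
    have "\<bar>(a + b) / 2 - L\<bar> < e" if "\<bar>a - L\<bar> < e" "\<bar>b - L\<bar> < e" for a b
      using that by (auto simp: abs_less_iff field_simps)
    from this[OF midpoint.IH] have "\<bar>(l f + l g) / 2 - L\<bar> < e" .
    then show ?case by (simp only: mid \<open>f \<in> H1\<close> \<open>g \<in> H1\<close>)
  qed
  then have "\<bar>l (z n) - L\<bar> < e" if "n \<ge> N" for n
    using midpoint_hull_mono[OF z[of n]] that by (meson image_mono atLeast_subset_iff)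
  then show "\<exists>no. \<forall>n\<ge>no. norm (l (z n) - L) < e" by auto
qed

text \<open>Elements of nearly least form in the hulls of the tails are Cauchy by the parallelogram
  identity, as in the projection onto a closed convex set. Together with
  \<open>midpoint_hull_tendsto\<close> the strong limit serves as a weak limit of
  \<open>v\<close>.\<close>

theorem H1_weak_limit:
  fixes v :: "nat \<Rightarrow> 'a::euclidean_space \<Rightarrow> real"
  assumes v: "\<And>n. v n \<in> H1" and lam: "0 < lam"
    and bound: "\<And>n. H1_form lam (v n) (v n) \<le> e n" and e: "e \<longlonglongrightarrow> S"
  obtains z Z where "\<And>n. z n \<in> midpoint_hull (v ` {n..})" "Z \<in> H1" "H1_form lam Z Z \<le> S"
    "(\<lambda>n. H1_form lam (\<lambda>x. z n x - Z x) (\<lambda>x. z n x - Z x)) \<longlonglongrightarrow> 0"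
proof -
  let ?E = "\<lambda>f. H1_form lam f f"
  define H where "H n = midpoint_hull (v ` {n..})" for n
  have H1: "f \<in> H1" if "f \<in> H n" for f n using that v unfolding H_def by (auto intro: midpoint_hull_H1)
  have vH: "v m \<in> H n" if "m \<ge> n" for m n using that by (auto simp: H_def intro: midpoint_hull.base)
  have anti: "H m \<subseteq> H n" if "n \<le> m" for m n
    using that midpoint_hull_mono unfolding H_def by (metis atLeast_subset_iff image_mono subsetI)
  define d where "d n = (INF f\<in>H n. ?E f)" for n
  have ne: "H n \<noteq> {}" for n using vH[of n n] by blast
  have bdd: "bdd_below (?E ` H n)" for n
    using lam by (auto intro!: bdd_belowI[of _ 0] H1_form_ge_0)
  have d_le: "d n \<le> ?E f" if "f \<in> H n" for n f
    unfolding d_def by (rule cINF_lower[OF bdd that])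
  \<comment> \<open>Shrinking hulls have increasing infima, and these stay below \<open>S\<close>
    because each hull contains all later \<open>v m\<close>.\<close>
  have "incseq d"
    unfolding incseq_def d_def by (auto intro!: cINF_superset_mono bdd ne anti)
  have d_le_S: "d n \<le> S" for n
  proof (rule LIMSEQ_le_const[OF e])
    show "\<exists>N. \<forall>m\<ge>N. d n \<le> e m" using d_le[OF vH] bound by (intro exI[of _ n]) (meson order_trans)
  qed
  obtain D where D: "d \<longlonglongrightarrow> D" "\<And>n. d n \<le> D"
    using incseq_convergent[OF \<open>incseq d\<close>, of S] d_le_S by blast
  have "\<exists>f. f \<in> H n \<and> ?E f < d n + 1 / (real n + 1)" for n
  proof -
    have "(INF f\<in>H n. ?E f) < d n + 1 / (real n + 1)" by (simp add: d_def)
    then show ?thesis using cINF_less_iff[OF ne bdd] by blast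
  qed
  then obtain z where z: "\<And>n. z n \<in> H n" "\<And>n. ?E (z n) < d n + 1 / (real n + 1)" by metis
  have inv: "(\<lambda>n. 1 / (real n + 1)) \<longlonglongrightarrow> 0"
    using LIMSEQ_inverse_real_of_nat by (simp add: inverse_eq_divide add.commute)
  have est: "?E (\<lambda>x. z m x - z n x) \<le> 4 * (D - d n0) + 4 / (real n0 + 1)" if "m \<ge> n0" "n \<ge> n0" for m n n0
  proof -
    have zH: "z m \<in> H1" "z n \<in> H1" using H1 z by blast+
    have "(\<lambda>x. 1/2 * (z m x + z n x)) \<in> H n0"
      using anti[OF that(1)] anti[OF that(2)] z(1) unfolding H_def by (blast intro: midpoint_hull.midpoint)
    \<comment> \<open>The midpoint lies in the hull, so its form is at least \<open>d n0\<close>;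
      the factor \<open>4\<close> undoes the two halves.\<close>
    from d_le[OF this] have mid: "4 * d n0 \<le> ?E (\<lambda>x. z m x + z n x)"
      by (simp only: H1_form_mult_left H1_form_mult_right H1_mult H1_add zH)
    have par: "?E (\<lambda>x. z m x - z n x) + ?E (\<lambda>x. z m x + z n x) = 2 * ?E (z m) + 2 * ?E (z n)"
      by (simp add: H1_form_diff_left H1_form_diff_right H1_form_add_left H1_form_add_right H1_diff H1_add zH)
    have "1 / (real k + 1) \<le> 1 / (real n0 + 1)" if "k \<ge> n0" for k
      using that by (intro divide_left_mono) auto
    then have "?E (z m) \<le> D + 1 / (real n0 + 1)" "?E (z n) \<le> D + 1 / (real n0 + 1)"
      using z(2)[of m] z(2)[of n] D(2)[of m] D(2)[of n] that by (meson add_mono less_imp_le order_trans)+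
    then show ?thesis using mid par by simp
  qed
  obtain Z where Z: "Z \<in> H1" "(\<lambda>n. ?E (\<lambda>x. z n x - Z x)) \<longlonglongrightarrow> 0"
  proof (rule H1_complete[of z lam])
    show "z n \<in> H1" for n using H1 z by blast
    fix \<epsilon> :: real assume "\<epsilon> > 0"
    have "(\<lambda>n. 4 * (D - d n) + 4 * (1 / (real n + 1))) \<longlonglongrightarrow> 4 * (D - D) + 4 * 0"
      by (intro tendsto_intros D inv)
    from order_tendstoD(2)[OF this, of \<epsilon>] \<open>\<epsilon> > 0\<close>
    obtain n0 where "4 * (D - d n0) + 4 * (1 / (real n0 + 1)) < \<epsilon>"
      by (auto simp: eventually_sequentially)
    then have "?E (\<lambda>x. z m x - z n x) \<le> \<epsilon>" if "m \<ge> n0" "n \<ge> n0" for m n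
      using est[OF that] by simp
    then show "\<exists>n0. \<forall>m\<ge>n0. \<forall>n\<ge>n0. ?E (\<lambda>x. z m x - z n x) \<le> \<epsilon>" by blast
  qed (use lam that in auto)
  have "?E Z \<le> D"
  proof (rule LIMSEQ_le)
    show "(\<lambda>n. ?E (z n)) \<longlonglongrightarrow> ?E Z"
      by (rule H1_form_tendsto(2)[OF _ Z(1) Z(1) lam Z(2)]) (use H1 z in blast)
    show "(\<lambda>n. d n + 1 / (real n + 1)) \<longlonglongrightarrow> D" using tendsto_add[OF D(1) inv] by simp
    show "\<exists>N. \<forall>n\<ge>N. ?E (z n) \<le> d n + 1 / (real n + 1)" using z(2) less_imp_le by blast
  qed
  also have "D \<le> S" by (rule LIMSEQ_le_const2[OF D(1)]) (use d_le_S in blast)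
  finally show ?thesis using that[of z Z] z(1) Z unfolding H_def by blast
qed

section \<open>Passing to the limit in the scalar equation\<close>

text \<open>Local compactness. A high enough level makes the tails small uniformly in
  \<open>n\<close>; at that fixed level the averages are bounded and tend to zero pointwise, so
  dominated convergence applies on the bounded set \<open>U\<close>.\<close>

lemma local_L4_tendsto_0:
  fixes w :: "nat \<Rightarrow> 'a::euclidean_space \<Rightarrow> real"
  assumes dim: "DIM('a) \<le> 3" and lam: "0 < lam" and w: "\<And>n. w n \<in> H1" "\<And>n. H1_form lam (w n) (w n) \<le> B"
    and avg: "\<And>k x. (\<lambda>n. dyadic_average k (w n) x) \<longlonglongrightarrow> 0"
    and U: "bounded U" "U \<in> sets borel"
  shows "(\<lambda>n. \<integral>x. (indicator U x * w n x) ^ 4 \<partial>lborel) \<longlonglongrightarrow> 0"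
proof (rule LIMSEQ_I)
  fix \<epsilon> :: real assume \<epsilon>: "\<epsilon> > 0"
  note [measurable] = U(2) H1_square_integrable[OF w(1), THEN square_integrable_measurable]
  have B: "B \<ge> 0" using w(2)[of 0] H1_form_ge_0[of lam "w 0"] lam by linarith
  have "(\<lambda>k. tail_const TYPE('a) * (1/2) ^ k * B\<^sup>2) \<longlonglongrightarrow> tail_const TYPE('a) * 0 * B\<^sup>2"
    by (intro tendsto_intros LIMSEQ_power_zero) simp
  \<comment> \<open>Tail and average get \<open>\<epsilon> / 16\<close> each, which the factor
    \<open>8\<close> of \<open>L4_add\<close> turns into \<open>\<epsilon>\<close>.\<close>
  from order_tendstoD(2)[OF this, of "\<epsilon> / 16"] \<epsilon>
  obtain k where k: "tail_const TYPE('a) * (1/2) ^ k * B\<^sup>2 < \<epsilon> / 16"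
    by (auto simp: eventually_sequentially)
  let ?A = "\<lambda>n x. indicator U x * dyadic_average k (w n) x"
  define M where "M = 2 ^ (k * DIM('a)) * (B / lam)"
  have Ub: "square_integrable (indicator U :: 'a \<Rightarrow> real)" by (rule square_integrable_indicator[OF U])
  have "(\<lambda>n. \<integral>x. (?A n x) ^ 4 \<partial>lborel) \<longlonglongrightarrow> (\<integral>x. 0 \<partial>(lborel :: 'a measure))"
  proof (rule integral_dominated_convergence[where w = "\<lambda>x. M\<^sup>2 * (norm (indicator U x :: real))\<^sup>2"])
    show "integrable lborel (\<lambda>x. M\<^sup>2 * (norm (indicator U x :: real))\<^sup>2)"
      using Ub by (simp add: square_integrable_def)
    show "AE x in lborel. (\<lambda>n. (?A n x) ^ 4) \<longlonglongrightarrow> 0"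
    proof (rule AE_I2)
      fix x
      have "(\<lambda>n. (?A n x) ^ 4) \<longlonglongrightarrow> (indicator U x * 0) ^ 4" by (intro tendsto_intros avg)
      then show "(\<lambda>n. (?A n x) ^ 4) \<longlonglongrightarrow> 0" by simp
    qed
    show "AE x in lborel. norm ((?A n x) ^ 4) \<le> M\<^sup>2 * (norm (indicator U x :: real))\<^sup>2" for n
    proof (rule AE_I2)
      fix x
      have "(dyadic_average k (w n) x)\<^sup>2 \<le> 2 ^ (k * DIM('a)) * L2_inner (w n) (w n)"
        by (rule dyadic_average_bound[OF H1_square_integrable[OF w(1)]])
      also have "\<dots> \<le> M"
      proof -
        have "L2_inner (w n) (w n) \<le> B / lam"
          using L2_inner_le_H1_form[OF lam, of "w n"] divide_right_mono[OF w(2)[of n], of lam] lam by linarith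
        then show ?thesis unfolding M_def by (intro mult_left_mono) auto
      qed
      finally have "((dyadic_average k (w n) x)\<^sup>2)\<^sup>2 \<le> M\<^sup>2" by (rule power_mono) simp
      then have "(dyadic_average k (w n) x) ^ 4 \<le> M\<^sup>2" by simp
      then show "norm ((?A n x) ^ 4) \<le> M\<^sup>2 * (norm (indicator U x :: real))\<^sup>2"
        by (simp add: indicator_def)
    qed
  qed measurable
  from LIMSEQ_D[OF this, of "\<epsilon> / 16"] \<epsilon>
  obtain N where N: "\<And>n. n \<ge> N \<Longrightarrow> \<bar>\<integral>x. (?A n x) ^ 4 \<partial>lborel\<bar> < \<epsilon> / 16" by auto
  have "\<bar>\<integral>x. (indicator U x * w n x) ^ 4 \<partial>lborel\<bar> < \<epsilon>" if "n \<ge> N" for n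
  proof -
    note sq = H1_square_integrable[OF w(1), of n]
    note tail = H1_dyadic_tail[OF dim lam w(1), of n k]
    let ?T = "\<lambda>x. indicator U x * (w n x - dyadic_average k (w n) x)"
    have "?T \<in> borel_measurable lborel" "\<bar>?T x\<bar> \<le> \<bar>w n x - dyadic_average k (w n) x\<bar>" for x
      by (measurable, simp add: indicator_def)
    note T = L4_bound[OF tail(1) this]
    have A: "L4 (?A n)"
      by (rule L4_bound(1)[OF dyadic_average_L4(1)[OF sq, of k]]) (measurable, simp add: indicator_def)
    have "(H1_form lam (w n) (w n))\<^sup>2 \<le> B\<^sup>2"
      using lam w(2) by (intro power_mono H1_form_ge_0) auto
    then have "tail_const TYPE('a) * (1/2) ^ k * (H1_form lam (w n) (w n))\<^sup>2 \<le> tail_const TYPE('a) * (1/2) ^ k * B\<^sup>2"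
      by (intro mult_left_mono) (auto simp: tail_const_def)
    then have t16: "(\<integral>x. (?T x) ^ 4 \<partial>lborel) < \<epsilon> / 16" using T(2) tail(2) k by linarith
    have a16: "(\<integral>x. (?A n x) ^ 4 \<partial>lborel) < \<epsilon> / 16" using N[OF that] by linarith
    have "(\<lambda>x. (indicator U x * w n x) ^ 4) = (\<lambda>x. (?T x + ?A n x) ^ 4)" by (simp add: right_diff_distrib)
    then have le: "(\<integral>x. (indicator U x * w n x) ^ 4 \<partial>lborel) \<le> 8 * ((\<integral>x. (?T x) ^ 4 \<partial>lborel) + (\<integral>x. (?A n x) ^ 4 \<partial>lborel))"
      using L4_add(2)[OF T(1) A] by simp
    have ge: "(\<integral>x. (indicator U x * w n x) ^ 4 \<partial>lborel) \<ge> 0" by (intro integral_nonneg_AE) simp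
    have "\<bar>c\<bar> < \<epsilon>" if "a < \<epsilon> / 16" "b < \<epsilon> / 16" "c \<le> 8 * (a + b)" "0 \<le> c" for a b c :: real
      using that by simp
    from this[OF t16 a16 le ge] show ?thesis .
  qed
  then show "\<exists>no. \<forall>n\<ge>no. norm ((\<integral>x. (indicator U x * w n x) ^ 4 \<partial>lborel) - 0) < \<epsilon>" by auto
qed

lemma L4_outside_ball_tendsto_0:
  fixes \<phi> :: "'a::euclidean_space \<Rightarrow> real"
  assumes "L4 \<phi>"
  shows "(\<lambda>R. \<integral>x. (indicator (- ball 0 (real R)) x * \<phi> x) ^ 4 \<partial>lborel) \<longlonglongrightarrow> 0"
proof -
  note [measurable] = L4_measurable[OF assms]
  have "(\<lambda>R. \<integral>x. (indicator (- ball 0 (real R)) x * \<phi> x) ^ 4 \<partial>lborel) \<longlonglongrightarrow> (\<integral>x. 0 \<partial>(lborel :: 'a measure))"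
  proof (rule integral_dominated_convergence[where w = "\<lambda>x. (\<phi> x) ^ 4"])
    show "integrable lborel (\<lambda>x. (\<phi> x) ^ 4)" using assms by (simp add: L4_def)
    show "AE x in lborel. (\<lambda>R. (indicator (- ball 0 (real R)) x * \<phi> x) ^ 4) \<longlonglongrightarrow> 0"
    proof (rule AE_I2, rule tendsto_eventually)
      fix x :: 'a
      obtain N :: nat where "norm x < real N" using reals_Archimedean2 by blast
      then show "\<forall>\<^sub>F R in sequentially. (indicator (- ball 0 (real R)) x * \<phi> x) ^ 4 = 0"
        by (intro eventually_sequentiallyI[of N]) (auto simp: indicator_def)
    qed
  qed (auto simp: indicator_def)
  then show ?thesis by simp
qed

lemma L4_norm_tendsto_0:
  "(\<lambda>n. \<integral>x. (f n x) ^ 4 \<partial>lborel) \<longlonglongrightarrow> 0 \<Longrightarrow> (\<lambda>n. L4_norm (f n)) \<longlonglongrightarrow> 0"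
  using tendsto_real_sqrt[OF tendsto_real_sqrt] by (fastforce simp: L4_norm_def)

text \<open>The difference of cubes is \<open>(v - Z) * (v^2 + v Z + Z^2)\<close>. On a large ball
  the first factor tends to zero in L4 by local compactness; outside it \<phi> is small in L4 and
  the other factors stay bounded.\<close>

lemma cubic_integral_tendsto:
  fixes v :: "nat \<Rightarrow> 'a::euclidean_space \<Rightarrow> real"
  assumes dim: "DIM('a) \<le> 3" and lam: "0 < lam" and v: "\<And>n. v n \<in> H1" "\<And>n. H1_form lam (v n) (v n) \<le> B"
    and Z: "Z \<in> H1" and avg: "\<And>k x. (\<lambda>n. dyadic_average k (v n) x) \<longlonglongrightarrow> dyadic_average k Z x"
    and \<phi>: "\<phi> \<in> H1"
  shows "(\<lambda>n. \<integral>x. (v n x) ^ 3 * \<phi> x \<partial>lborel) \<longlonglongrightarrow> (\<integral>x. (Z x) ^ 3 * \<phi> x \<partial>lborel)"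
proof -
  obtain C where C: "C > 0" and sob: "\<And>u :: 'a \<Rightarrow> real. u \<in> H1 \<Longrightarrow> L4 u \<and> (\<integral>x. (u x) ^ 4 \<partial>lborel) \<le> C * (H1_form lam u u)\<^sup>2"
    using Sobolev_L4[OF dim lam] by blast
  have L4H: "L4 u" if "u \<in> H1" for u :: "'a \<Rightarrow> real" using sob[OF that] by blast
  have L4H_norm: "L4_norm u \<le> sqrt (sqrt C * b)" if "u \<in> H1" "H1_form lam u u \<le> b" for u :: "'a \<Rightarrow> real" and b
  proof -
    have "0 \<le> H1_form lam u u" using lam by (simp add: H1_form_ge_0)
    then have "(H1_form lam u u)\<^sup>2 \<le> b\<^sup>2" using that(2) by (intro power_mono) auto
    then have "C * (H1_form lam u u)\<^sup>2 \<le> C * b\<^sup>2" using C by (intro mult_left_mono) auto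
    then have "(\<integral>x. (u x) ^ 4 \<partial>lborel) \<le> C * b\<^sup>2" using sob[OF that(1)] by linarith
    then have "sqrt (\<integral>x. (u x) ^ 4 \<partial>lborel) \<le> sqrt C * \<bar>b\<bar>"
      using real_sqrt_le_mono[of "\<integral>x. (u x) ^ 4 \<partial>lborel" "C * b\<^sup>2"] by (simp add: real_sqrt_mult)
    then show ?thesis using \<open>0 \<le> H1_form lam u u\<close> that(2) by (simp add: L4_norm_def)
  qed
  define e where "e n = (\<lambda>x. v n x - Z x)" for n
  have e: "e n \<in> H1" for n unfolding e_def by (intro H1_diff v Z)
  \<comment> \<open>The bound on the form of \<open>v n - Z\<close> that the parallelogram identity
    gives.\<close>
  define B' where "B' = 2 * B + 2 * H1_form lam Z Z"
  have eB: "H1_form lam (e n) (e n) \<le> B'" for n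
  proof -
    have "H1_form lam (e n) (e n) + H1_form lam (\<lambda>x. v n x + Z x) (\<lambda>x. v n x + Z x) = 2 * H1_form lam (v n) (v n) + 2 * H1_form lam Z Z"
      unfolding e_def using v(1)[of n] Z
      by (simp add: H1_form_diff_left H1_form_diff_right H1_form_add_left H1_form_add_right H1_diff H1_add)
    moreover have "0 \<le> H1_form lam (\<lambda>x. v n x + Z x) (\<lambda>x. v n x + Z x)" using lam by (simp add: H1_form_ge_0)
    ultimately show ?thesis using v(2)[of n] by (simp add: B'_def)
  qed
  have e_avg: "(\<lambda>n. dyadic_average k (e n) x) \<longlonglongrightarrow> 0" for k x
  proof -
    have "dyadic_average k (e n) x = dyadic_average k (v n) x - dyadic_average k Z x" for n
      unfolding e_def by (intro dyadic_average_diff H1_square_integrable v Z)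
    then show ?thesis using tendsto_diff[OF avg[of k x] tendsto_const[of "dyadic_average k Z x"]] by simp
  qed
  define P where "P = max (sqrt (sqrt C * B)) (L4_norm Z)"
  have P: "L4_norm (v n) \<le> P" "L4_norm Z \<le> P" "0 \<le> P" for n
    using L4H_norm[OF v(1) v(2), of n] by (auto simp: P_def le_max_iff_disj)
  define Q where "Q = sqrt (sqrt C * B')"
  have Q: "L4_norm (e n) \<le> Q" for n unfolding Q_def by (rule L4H_norm[OF e eB])
  have Q0: "0 \<le> Q" using Q[of 0] L4_norm_ge_0[of "e 0"] by linarith
  have three: "\<bar>\<integral>x. p x * q x * (v n x * v n x + v n x * Z x + Z x * Z x) \<partial>lborel\<bar> \<le> L4_norm p * L4_norm q * (3 * P\<^sup>2)"
    "integrable lborel (\<lambda>x. p x * q x * (v n x * v n x + v n x * Z x + Z x * Z x))"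
    if p: "L4 p" and q: "L4 q" for p q n
  proof -
    note vn = L4H[OF v(1), of n] and z = L4H[OF Z]
    note h = L4_Hoelder[OF p q vn vn] L4_Hoelder[OF p q vn z] L4_Hoelder[OF p q z z]
    have bd: "L4_norm p * L4_norm q * (L4_norm a * L4_norm b) \<le> L4_norm p * L4_norm q * P\<^sup>2"
      if "L4_norm a \<le> P" "L4_norm b \<le> P" for a b
      unfolding power2_eq_square using that P(3) by (intro mult_left_mono mult_mono) auto
    have split: "(\<lambda>x. p x * q x * (v n x * v n x + v n x * Z x + Z x * Z x))
        = (\<lambda>x. p x * q x * (v n x * v n x) + p x * q x * (v n x * Z x) + p x * q x * (Z x * Z x))"
      by (simp add: distrib_left)
    show "integrable lborel (\<lambda>x. p x * q x * (v n x * v n x + v n x * Z x + Z x * Z x))"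
      unfolding split by (intro Bochner_Integration.integrable_add h)
    have "(\<integral>x. p x * q x * (v n x * v n x + v n x * Z x + Z x * Z x) \<partial>lborel)
        = (\<integral>x. p x * q x * (v n x * v n x) \<partial>lborel) + (\<integral>x. p x * q x * (v n x * Z x) \<partial>lborel) + (\<integral>x. p x * q x * (Z x * Z x) \<partial>lborel)"
      unfolding split using h by simp
    then show "\<bar>\<integral>x. p x * q x * (v n x * v n x + v n x * Z x + Z x * Z x) \<partial>lborel\<bar> \<le> L4_norm p * L4_norm q * (3 * P\<^sup>2)"
      using h(2,4,6) bd[OF P(1)[of n] P(1)[of n]] bd[OF P(1)[of n] P(2)] bd[OF P(2) P(2)] by linarith
  qed
  note \<phi>4 = L4H[OF \<phi>]
  show ?thesis
  proof (rule LIM_zero_cancel, rule LIMSEQ_I)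
    fix \<epsilon> :: real assume \<epsilon>: "\<epsilon> > 0"
    have "(\<lambda>R. Q * L4_norm (\<lambda>x. indicator (- ball 0 (real R)) x * \<phi> x) * (3 * P\<^sup>2)) \<longlonglongrightarrow> Q * 0 * (3 * P\<^sup>2)"
      by (intro tendsto_intros L4_norm_tendsto_0 L4_outside_ball_tendsto_0 \<phi>4)
    from order_tendstoD(2)[OF this, of "\<epsilon> / 2"] \<epsilon>
    obtain R where R: "Q * L4_norm (\<lambda>x. indicator (- ball 0 (real R)) x * \<phi> x) * (3 * P\<^sup>2) < \<epsilon> / 2"
      by (auto simp: eventually_sequentially)
    let ?U = "ball (0::'a) (real R)"
    have "(\<lambda>n. L4_norm (\<lambda>x. indicator ?U x * e n x) * L4_norm \<phi> * (3 * P\<^sup>2)) \<longlonglongrightarrow> 0 * L4_norm \<phi> * (3 * P\<^sup>2)"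
      by (intro tendsto_intros L4_norm_tendsto_0 local_L4_tendsto_0[OF dim lam e eB e_avg]) auto
    from order_tendstoD(2)[OF this, of "\<epsilon> / 2"] \<epsilon>
    obtain N where N: "\<And>n. n \<ge> N \<Longrightarrow> L4_norm (\<lambda>x. indicator ?U x * e n x) * L4_norm \<phi> * (3 * P\<^sup>2) < \<epsilon> / 2"
      by (auto simp: eventually_sequentially)
    have "\<bar>(\<integral>x. (v n x) ^ 3 * \<phi> x \<partial>lborel) - (\<integral>x. (Z x) ^ 3 * \<phi> x \<partial>lborel)\<bar> < \<epsilon>" if "n \<ge> N" for n
    proof -
      note en = L4H[OF e, of n] and vn = L4H[OF v(1), of n] and z = L4H[OF Z]
      note [measurable] = en[THEN L4_measurable] \<phi>4[THEN L4_measurable]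
      have p1: "L4 (\<lambda>x. indicator ?U x * e n x)"
      proof (rule L4_bound(1)[OF en])
        show "(\<lambda>x. indicator ?U x * e n x) \<in> borel_measurable lborel"
          using L4_measurable[OF en] by (intro borel_measurable_times borel_measurable_indicator) auto
      qed (simp add: indicator_def)
      have q2: "L4 (\<lambda>x. indicator (- ?U) x * \<phi> x)"
        by (rule L4_bound(1)[OF \<phi>4]) (measurable, simp add: indicator_def)
      note t1 = three[OF p1 \<phi>4, of n] and t2 = three[OF en q2, of n]
      have i1: "integrable lborel (\<lambda>x. (v n x) ^ 3 * \<phi> x)" "integrable lborel (\<lambda>x. (Z x) ^ 3 * \<phi> x)"
        using L4_Hoelder(1)[OF vn vn vn \<phi>4] L4_Hoelder(1)[OF z z z \<phi>4] by (simp_all add: power3_eq_cube mult.assoc)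
      have "(\<integral>x. (v n x) ^ 3 * \<phi> x \<partial>lborel) - (\<integral>x. (Z x) ^ 3 * \<phi> x \<partial>lborel)
          = (\<integral>x. (v n x) ^ 3 * \<phi> x - (Z x) ^ 3 * \<phi> x \<partial>lborel)"
        using i1 by simp
      \<comment> \<open>The indicator is attached to \<open>e n\<close> inside the ball and to
        \<phi> outside, so each part has one small factor and fits \<open>three\<close>.\<close>
      also have "(\<lambda>x. (v n x) ^ 3 * \<phi> x - (Z x) ^ 3 * \<phi> x)
          = (\<lambda>x. indicator ?U x * e n x * \<phi> x * (v n x * v n x + v n x * Z x + Z x * Z x)
              + e n x * (indicator (- ?U) x * \<phi> x) * (v n x * v n x + v n x * Z x + Z x * Z x))"
        by (rule ext) (auto simp: indicator_def e_def power3_eq_cube algebra_simps)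
      also have "(\<integral>x. indicator ?U x * e n x * \<phi> x * (v n x * v n x + v n x * Z x + Z x * Z x)
              + e n x * (indicator (- ?U) x * \<phi> x) * (v n x * v n x + v n x * Z x + Z x * Z x) \<partial>lborel)
          = (\<integral>x. indicator ?U x * e n x * \<phi> x * (v n x * v n x + v n x * Z x + Z x * Z x) \<partial>lborel)
            + (\<integral>x. e n x * (indicator (- ?U) x * \<phi> x) * (v n x * v n x + v n x * Z x + Z x * Z x) \<partial>lborel)"
        by (rule Bochner_Integration.integral_add[OF t1(2) t2(2)])
      finally have eq: "(\<integral>x. (v n x) ^ 3 * \<phi> x \<partial>lborel) - (\<integral>x. (Z x) ^ 3 * \<phi> x \<partial>lborel) = \<dots>" .
      have "L4_norm (e n) * L4_norm (\<lambda>x. indicator (- ?U) x * \<phi> x) * (3 * P\<^sup>2)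
          \<le> Q * L4_norm (\<lambda>x. indicator (- ?U) x * \<phi> x) * (3 * P\<^sup>2)"
        by (intro mult_right_mono Q) auto
      then show ?thesis unfolding eq using t1(1) t2(1) N[OF that] R by linarith
    qed
    then show "\<exists>no. \<forall>n\<ge>no. norm ((\<integral>x. (v n x) ^ 3 * \<phi> x \<partial>lborel) - (\<integral>x. (Z x) ^ 3 * \<phi> x \<partial>lborel) - 0) < \<epsilon>"
      by auto
  qed
qed

text \<open>The second order Taylor polynomial is a lower bound on the whole domain of the root, so
  it applies as soon as the perturbed fourth power integral is known to be nonnegative.\<close>

lemma sqrt_ge_quadratic:
  assumes "-1 \<le> x"
  shows "1 + x / 2 - x\<^sup>2 / 2 \<le> sqrt (1 + x)"
proof -
  define y where "y = sqrt (1 + x)"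
  have y: "0 \<le> y" "x = y\<^sup>2 - 1" using assms by (auto simp: y_def)
  \<comment> \<open>In terms of \<open>y\<close> twice the gap is a polynomial with a double root at
    \<open>1\<close>; this is its factorization.\<close>
  have "0 \<le> (y - 1)\<^sup>2 * (y * (y + 2))" using y(1) by simp
  also have "\<dots> = 2 * (y - (1 + x / 2 - x\<^sup>2 / 2))" unfolding y(2) by (simp add: power2_eq_square field_simps)
  finally show ?thesis by (simp add: y_def)
qed

text \<open>The infimum property is tested at \<open>v \<plusminus> t \<phi>\<close>, with an expansion to second order in \<open>t\<close>.\<close>

lemma almost_minimizer_almost_critical:
  fixes \<phi> :: "'a::euclidean_space \<Rightarrow> real"
  assumes S: "S > 0" and inf: "\<And>u :: 'a \<Rightarrow> real. u \<in> H1 \<Longrightarrow> S * sqrt (\<integral>x. (u x) ^ 4 \<partial>lborel) \<le> H1_form lam u u"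
    and L4H: "\<And>u :: 'a \<Rightarrow> real. u \<in> H1 \<Longrightarrow> L4 u" and \<phi>: "\<phi> \<in> H1" and lam: "lam > 0"
  obtains C where "\<And>v t \<epsilon>. v \<in> H1 \<Longrightarrow> (\<integral>x. (v x) ^ 4 \<partial>lborel) = 1 \<Longrightarrow> H1_form lam v v \<le> S + \<epsilon> \<Longrightarrow> 0 < t \<Longrightarrow> t \<le> 1 \<Longrightarrow>
    2 * t * \<bar>H1_form lam v \<phi> - S * (\<integral>x. (v x) ^ 3 * \<phi> x \<partial>lborel)\<bar> \<le> \<epsilon> + C * t\<^sup>2"
proof
  define F where "F = L4_norm \<phi>"
  \<comment> \<open>Bounds the terms of order at least two in the expansion of the fourth power,
    relative to the square of \<open>t\<close>, for \<open>t \<le> 1\<close> and a normalized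
    \<open>v\<close>. The summands of \<open>C\<close> below come from the form of \<phi>, the
    linear term of the root bound and its quadratic term.\<close>
  define X where "X = 6 * F\<^sup>2 + 4 * F ^ 3 + F ^ 4"
  define C where "C = H1_form lam \<phi> \<phi> + S * X / 2 + S * (4 * F + X)\<^sup>2 / 2"
  have F: "F \<ge> 0" by (simp add: F_def)
  have X: "X \<ge> 0" using F by (simp add: X_def)
  fix v :: "'a \<Rightarrow> real" and t \<epsilon> :: real
  assume v: "v \<in> H1" "(\<integral>x. (v x) ^ 4 \<partial>lborel) = 1" "H1_form lam v v \<le> S + \<epsilon>" and t: "0 < t" "t \<le> 1"
  note v4 = L4H[OF v(1)] and \<phi>4 = L4H[OF \<phi>]
  have nv: "L4_norm v = 1" by (simp add: L4_norm_def v(2))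
  define p q r where "p = (\<integral>x. v x * v x * (v x * \<phi> x) \<partial>lborel)" and "q = (\<integral>x. v x * v x * (\<phi> x * \<phi> x) \<partial>lborel)"
    and "r = (\<integral>x. v x * \<phi> x * (\<phi> x * \<phi> x) \<partial>lborel)"
  note h = L4_Hoelder[OF v4 v4 v4 \<phi>4] L4_Hoelder[OF v4 v4 \<phi>4 \<phi>4] L4_Hoelder[OF v4 \<phi>4 \<phi>4 \<phi>4]
  have pqr: "\<bar>p\<bar> \<le> F" "\<bar>q\<bar> \<le> F\<^sup>2" "\<bar>r\<bar> \<le> F ^ 3"
    using h(2,4,6) by (simp_all add: p_def q_def r_def nv F_def power2_eq_square power3_eq_cube)
  define a where "a = H1_form lam v \<phi>"
  \<comment> \<open>Both signs of \<open>s\<close> together give the absolute value in the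
    conclusion.\<close>
  have key: "2 * (s * (S * p - a)) \<le> \<epsilon> + C * t\<^sup>2" if s: "s = t \<or> s = - t" for s
  proof -
    have s2: "s\<^sup>2 = t\<^sup>2" "\<bar>s\<bar> = t" "s ^ 4 = t ^ 4" "\<bar>s ^ 3\<bar> = t ^ 3" using s t by (auto simp: power_abs)
    let ?u = "\<lambda>x. v x + s * \<phi> x"
    have u: "?u \<in> H1" by (intro H1_add H1_mult v \<phi>)
    have E: "H1_form lam ?u ?u = H1_form lam v v + 2 * s * a + s\<^sup>2 * H1_form lam \<phi> \<phi>"
      using v(1) \<phi> H1_form_commute[of lam \<phi> v]
      by (simp add: H1_form_add_left H1_form_add_right H1_form_mult_left H1_form_mult_right H1_mult H1_add a_def power2_eq_square algebra_simps)
    have exp: "(?u x) ^ 4 = (v x) ^ 4 + 4 * s * (v x * v x * (v x * \<phi> x)) + 6 * s\<^sup>2 * (v x * v x * (\<phi> x * \<phi> x))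
        + 4 * s ^ 3 * (v x * \<phi> x * (\<phi> x * \<phi> x)) + s ^ 4 * (\<phi> x) ^ 4" for x
      by (simp add: power2_eq_square power3_eq_cube power4_eq_xxxx algebra_simps)
    have M: "(\<integral>x. (?u x) ^ 4 \<partial>lborel) = 1 + 4 * s * p + 6 * s\<^sup>2 * q + 4 * s ^ 3 * r + s ^ 4 * F ^ 4"
      unfolding exp p_def q_def r_def F_def L4_norm_pow4 using h(1,3,5) v4 \<phi>4 v(2)
      by (simp add: L4_def)
    define y where "y = 6 * s\<^sup>2 * q + 4 * s ^ 3 * r + s ^ 4 * F ^ 4"
    define x where "x = 4 * s * p + y"
    have y: "\<bar>y\<bar> \<le> t\<^sup>2 * X"
    proof -
      have "\<bar>y\<bar> \<le> \<bar>6 * s\<^sup>2 * q\<bar> + \<bar>4 * s ^ 3 * r\<bar> + \<bar>s ^ 4 * F ^ 4\<bar>" unfolding y_def by linarith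
      also have "\<dots> = 6 * t\<^sup>2 * \<bar>q\<bar> + 4 * t ^ 3 * \<bar>r\<bar> + t ^ 4 * F ^ 4"
        using t F s2 by (simp add: abs_mult)
      also have "\<dots> \<le> 6 * t\<^sup>2 * F\<^sup>2 + 4 * t\<^sup>2 * F ^ 3 + t\<^sup>2 * F ^ 4"
      proof (intro add_mono)
        have "t ^ 3 \<le> t\<^sup>2" "t ^ 4 \<le> t\<^sup>2" using t by (auto intro!: power_decreasing)
        then show "4 * t ^ 3 * \<bar>r\<bar> \<le> 4 * t\<^sup>2 * F ^ 3" "t ^ 4 * F ^ 4 \<le> t\<^sup>2 * F ^ 4"
          using t F pqr by (auto intro!: mult_mono mult_right_mono)
        show "6 * t\<^sup>2 * \<bar>q\<bar> \<le> 6 * t\<^sup>2 * F\<^sup>2" using pqr by (intro mult_left_mono) auto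
      qed
      finally show ?thesis by (simp add: X_def algebra_simps)
    qed
    have x: "x\<^sup>2 \<le> t\<^sup>2 * (4 * F + X)\<^sup>2"
    proof -
      have "\<bar>x\<bar> \<le> 4 * (t * \<bar>p\<bar>) + \<bar>y\<bar>" unfolding x_def s2(2)[symmetric] abs_mult[symmetric] by linarith
      also have "\<dots> \<le> 4 * (t * F) + t * X"
      proof -
        have "t\<^sup>2 * X \<le> t * X" using t X by (intro mult_right_mono) (auto simp: power2_eq_square)
        moreover have "t * \<bar>p\<bar> \<le> t * F" using t pqr by (intro mult_left_mono) auto
        ultimately show ?thesis using y by linarith
      qed
      also have "\<dots> = t * (4 * F + X)" by (simp add: algebra_simps)
      finally have "\<bar>x\<bar>\<^sup>2 \<le> (t * (4 * F + X))\<^sup>2" by (rule power_mono) simp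
      then show ?thesis by (simp add: power_mult_distrib)
    qed
    have "(\<integral>x. (?u x) ^ 4 \<partial>lborel) \<ge> 0" by (intro integral_nonneg_AE) simp
    then have x1: "-1 \<le> x" unfolding M x_def y_def by linarith
    have "S * (1 + x / 2 - x\<^sup>2 / 2) \<le> S * sqrt (1 + x)"
      using S sqrt_ge_quadratic[OF x1] by (intro mult_left_mono) auto
    also have "1 + x = (\<integral>x. (?u x) ^ 4 \<partial>lborel)" unfolding M x_def y_def by simp
    also have "S * sqrt (\<integral>x. (?u x) ^ 4 \<partial>lborel) \<le> H1_form lam ?u ?u" by (rule inf[OF u])
    also have "\<dots> \<le> S + \<epsilon> + 2 * s * a + t\<^sup>2 * H1_form lam \<phi> \<phi>" using E v(3) s2 by simp
    finally have "S * (1 + x / 2 - x\<^sup>2 / 2) \<le> S + \<epsilon> + 2 * s * a + t\<^sup>2 * H1_form lam \<phi> \<phi>" .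
    moreover have "S * (1 + x / 2 - x\<^sup>2 / 2) = S + 2 * (s * (S * p)) + S * y / 2 - S * x\<^sup>2 / 2"
      by (simp add: x_def algebra_simps)
    moreover have "- (S * (t\<^sup>2 * X)) \<le> S * y"
      using mult_left_mono[of "- (t\<^sup>2 * X)" y S] y S by simp
    moreover have "S * x\<^sup>2 \<le> S * (t\<^sup>2 * (4 * F + X)\<^sup>2)" using x S by (intro mult_left_mono) auto
    moreover have "C * t\<^sup>2 = t\<^sup>2 * H1_form lam \<phi> \<phi> + S * (t\<^sup>2 * X) / 2 + S * (t\<^sup>2 * (4 * F + X)\<^sup>2) / 2"
      by (simp add: C_def algebra_simps)
    moreover have "2 * (s * (S * p - a)) = 2 * (s * (S * p)) - 2 * s * a" by (simp add: algebra_simps)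
    ultimately show ?thesis by linarith
  qed
  have peq: "(\<integral>x. (v x) ^ 3 * \<phi> x \<partial>lborel) = p" by (simp add: p_def power3_eq_cube mult.assoc)
  have "2 * t * \<bar>a - S * p\<bar> \<le> \<epsilon> + C * t\<^sup>2"
    using key[of t] key[of "- t"] by (cases "a - S * p \<ge> 0") (auto simp: algebra_simps)
  then show "2 * t * \<bar>H1_form lam v \<phi> - S * (\<integral>x. (v x) ^ 3 * \<phi> x \<partial>lborel)\<bar> \<le> \<epsilon> + C * t\<^sup>2"
    by (simp add: a_def peq)
qed

text \<open>The equation is obtained along two sequences: the cubic term converges along the
  minimizing sequence \<open>v\<close>, the form along the midpoint combinations \<open>z\<close>.
  The form is linear in its first argument, so both limits coincide.\<close>

theorem scalar_ground_state:
  fixes v0 :: "'a::euclidean_space \<Rightarrow> real"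
  assumes dim: "DIM('a) \<le> 3" and lam: "0 < lam" and v0: "v0 \<in> H1" "\<not> (AE x in lborel. v0 x = 0)"
  obtains S w where "S > 0"
    "\<And>u :: 'a \<Rightarrow> real. u \<in> H1 \<Longrightarrow> S * sqrt (\<integral>x. (u x) ^ 4 \<partial>lborel) \<le> H1_form lam u u"
    "w \<in> H1" "\<not> (AE x in lborel. w x = 0)" "H1_form lam w w \<le> S"
    "\<And>\<phi> :: 'a \<Rightarrow> real. \<phi> \<in> H1 \<Longrightarrow> H1_form lam w \<phi> = S * (\<integral>x. (w x) ^ 3 * \<phi> x \<partial>lborel)"
proof -
  obtain S where S: "S > 0"
    and inf: "\<And>u :: 'a \<Rightarrow> real. u \<in> H1 \<Longrightarrow> S * sqrt (\<integral>x. (u x) ^ 4 \<partial>lborel) \<le> H1_form lam u u"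
    and approx: "\<And>e. e > 0 \<Longrightarrow> \<exists>v :: 'a \<Rightarrow> real. v \<in> H1 \<and> (\<integral>x. (v x) ^ 4 \<partial>lborel) = 1 \<and> H1_form lam v v < S + e"
    using sobolev_quotient_infimum[OF assms] by blast
  obtain C where sob: "\<And>u :: 'a \<Rightarrow> real. u \<in> H1 \<Longrightarrow> L4 u \<and> (\<integral>x. (u x) ^ 4 \<partial>lborel) \<le> C * (H1_form lam u u)\<^sup>2"
    using Sobolev_L4[OF dim lam] by blast
  obtain K c where c: "c > 0"
    and nonvan: "\<And>v :: 'a \<Rightarrow> real. v \<in> H1 \<Longrightarrow> (\<integral>x. (v x) ^ 4 \<partial>lborel) = 1 \<Longrightarrow> H1_form lam v v \<le> S + 1 \<Longrightarrow>
      \<exists>x. c \<le> (dyadic_average K v x)\<^sup>2"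
    using nonvanishing_average[OF dim lam] by blast
  have "\<exists>v :: 'a \<Rightarrow> real. v \<in> H1 \<and> (\<integral>x. (v x) ^ 4 \<partial>lborel) = 1 \<and> H1_form lam v v \<le> S + 1 / (real n + 1)
      \<and> c \<le> (dyadic_average K v 0)\<^sup>2" for n
  proof -
    obtain v :: "'a \<Rightarrow> real" where v: "v \<in> H1" "(\<integral>x. (v x) ^ 4 \<partial>lborel) = 1" "H1_form lam v v < S + 1 / (real n + 1)"
      using approx[of "1 / (real n + 1)"] by auto
    have "1 / (real n + 1) \<le> 1" by simp
    then obtain x where x: "c \<le> (dyadic_average K v x)\<^sup>2" using nonvan[OF v(1,2)] v(3) by fastforce
    note [measurable] = square_integrable_measurable[OF H1_square_integrable[OF v(1)]]
    \<comment> \<open>Places the cube with a large average at the origin, so that the lower bound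
      refers to one cube for all \<open>n\<close> and survives in the limit.\<close>
    let ?v = "\<lambda>y. v (y + dyadic_corner K x)"
    have "(\<integral>x. (?v x) ^ 4 \<partial>lborel) = 1"
      using integral_translate[of "\<lambda>x. (v x) ^ 4" "dyadic_corner K x"] v(2) by simp
    then show ?thesis
      using H1_translate(1)[OF v(1)] H1_form_translate[OF v(1)] v(3) x dyadic_average_translate_corner[of v K x]
      by (intro exI[of _ ?v]) auto
  qed
  \<comment> \<open>From here on \<open>v0\<close> denotes the translated minimizing sequence, no
    longer the given nonzero function.\<close>
  then obtain v0 :: "nat \<Rightarrow> 'a \<Rightarrow> real" where v0: "\<And>n. v0 n \<in> H1" "\<And>n. (\<integral>x. (v0 n x) ^ 4 \<partial>lborel) = 1"
    "\<And>n. H1_form lam (v0 n) (v0 n) \<le> S + 1 / (real n + 1)" "\<And>n. c \<le> (dyadic_average K (v0 n) 0)\<^sup>2"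
    by metis
  have v0B: "H1_form lam (v0 n) (v0 n) \<le> S + 1" for n
    using v0(3)[of n] by (smt (verit) divide_le_eq_1_pos of_nat_0_le_iff)
  have "L2_inner (v0 n) (v0 n) \<le> (S + 1) / lam" for n
    using L2_inner_le_H1_form[OF lam, of "v0 n"] divide_right_mono[OF v0B[of n], of lam] lam by linarith
  then obtain r :: "nat \<Rightarrow> nat" where r: "strict_mono r" "\<And>k x. convergent (\<lambda>n. dyadic_average k (v0 (r n)) x)"
    using dyadic_averages_convergent_subsequence[of v0 "(S + 1) / lam"] H1_square_integrable[OF v0(1)] by blast
  define v where "v n = v0 (r n)" for n
  have v: "v n \<in> H1" "(\<integral>x. (v n x) ^ 4 \<partial>lborel) = 1" "c \<le> (dyadic_average K (v n) 0)\<^sup>2" "H1_form lam (v n) (v n) \<le> S + 1" for n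
    by (auto simp: v_def v0 v0B)
  have vE: "H1_form lam (v n) (v n) \<le> S + 1 / (real n + 1)" for n
  proof -
    have "1 / (real (r n) + 1) \<le> 1 / (real n + 1)"
      using seq_suble[OF r(1), of n] by (intro divide_left_mono) auto
    then show ?thesis using v0(3)[of "r n"] by (simp add: v_def)
  qed
  have inv: "(\<lambda>n. 1 / (real n + 1)) \<longlonglongrightarrow> 0"
    using LIMSEQ_inverse_real_of_nat by (simp add: inverse_eq_divide add.commute)
  have "(\<lambda>n. S + 1 / (real n + 1)) \<longlonglongrightarrow> S" using tendsto_add[OF tendsto_const[of S] inv] by simp
  then obtain z Z where z: "\<And>n. z n \<in> midpoint_hull (v ` {n..})" and Z: "Z \<in> H1" "H1_form lam Z Z \<le> S"
    and zZ: "(\<lambda>n. H1_form lam (\<lambda>x. z n x - Z x) (\<lambda>x. z n x - Z x)) \<longlonglongrightarrow> 0"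
    using H1_weak_limit[of v lam "\<lambda>n. S + 1 / (real n + 1)" S, OF v(1) lam vE] by blast
  have zH: "z n \<in> H1" for n by (rule midpoint_hull_H1[OF z]) (use v in auto)
  \<comment> \<open>Averages respect midpoints, so \<open>z\<close> inherits the limit along
    \<open>v\<close>, and the strong convergence of \<open>z\<close> identifies it as the average of
    \<open>Z\<close>.\<close>
  have avg: "(\<lambda>n. dyadic_average k (v n) x) \<longlonglongrightarrow> dyadic_average k Z x" for k x
  proof -
    obtain l where l: "(\<lambda>n. dyadic_average k (v n) x) \<longlonglongrightarrow> l"
      using r(2)[of k x] by (auto simp: v_def convergent_def)
    have "(\<lambda>n. dyadic_average k (z n) x) \<longlonglongrightarrow> l"
    proof (rule midpoint_hull_tendsto[where l = "\<lambda>f. dyadic_average k f x", OF v(1) z _ l])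
      fix f g :: "'a \<Rightarrow> real" assume "f \<in> H1" "g \<in> H1"
      then have "integrable lborel (\<lambda>y. indicator (dyadic_cube k x) y * f y)" "integrable lborel (\<lambda>y. indicator (dyadic_cube k x) y * g y)"
        by (auto intro!: integrable_dyadic_cube H1_square_integrable)
      then have "(\<integral>y. indicator (dyadic_cube k x) y * f y + indicator (dyadic_cube k x) y * g y \<partial>lborel)
          = (\<integral>y. indicator (dyadic_cube k x) y * f y \<partial>lborel) + (\<integral>y. indicator (dyadic_cube k x) y * g y \<partial>lborel)"
        by (rule Bochner_Integration.integral_add)
      moreover have "(\<lambda>y. indicator (dyadic_cube k x) y * (1/2 * (f y + g y)))
          = (\<lambda>y. 1/2 * (indicator (dyadic_cube k x) y * f y + indicator (dyadic_cube k x) y * g y))"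
        by (simp add: fun_eq_iff distrib_left add_divide_distrib)
      then have "(\<integral>y. indicator (dyadic_cube k x) y * (1/2 * (f y + g y)) \<partial>lborel)
          = 1/2 * (\<integral>y. indicator (dyadic_cube k x) y * f y + indicator (dyadic_cube k x) y * g y \<partial>lborel)"
        by (simp only: Bochner_Integration.integral_mult_right_zero)
      ultimately show "dyadic_average k (\<lambda>x. 1/2 * (f x + g x)) x = (dyadic_average k f x + dyadic_average k g x) / 2"
        by (simp only: dyadic_average_def) (simp add: algebra_simps)
    qed
    moreover have "(\<lambda>n. dyadic_average k (z n) x) \<longlonglongrightarrow> dyadic_average k Z x"
    proof (rule LIM_zero_cancel, rule Lim_null_comparison)
      note d = H1_form_tendsto(3)[OF zH Z(1) Z(1) lam zZ]
      show "\<forall>\<^sub>F n in sequentially. norm (dyadic_average k (z n) x - dyadic_average k Z x)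
          \<le> sqrt (2 ^ (k * DIM('a)) * L2_inner (\<lambda>x. z n x - Z x) (\<lambda>x. z n x - Z x))"
      proof (intro always_eventually allI)
        fix n
        note sq = H1_square_integrable[OF zH, of n] H1_square_integrable[OF Z(1)]
        have "(dyadic_average k (z n) x - dyadic_average k Z x)\<^sup>2 \<le> 2 ^ (k * DIM('a)) * L2_inner (\<lambda>x. z n x - Z x) (\<lambda>x. z n x - Z x)"
          using dyadic_average_bound[OF square_integrable_diff[OF sq], of k x] dyadic_average_diff[OF sq, of k x] by simp
        from real_sqrt_le_mono[OF this]
        show "norm (dyadic_average k (z n) x - dyadic_average k Z x)
          \<le> sqrt (2 ^ (k * DIM('a)) * L2_inner (\<lambda>x. z n x - Z x) (\<lambda>x. z n x - Z x))" by simp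
      qed
      have "(\<lambda>n. sqrt (2 ^ (k * DIM('a)) * L2_inner (\<lambda>x. z n x - Z x) (\<lambda>x. z n x - Z x))) \<longlonglongrightarrow> sqrt (2 ^ (k * DIM('a)) * 0)"
        by (intro tendsto_intros d)
      then show "(\<lambda>n. sqrt (2 ^ (k * DIM('a)) * L2_inner (\<lambda>x. z n x - Z x) (\<lambda>x. z n x - Z x))) \<longlonglongrightarrow> 0" by simp
    qed
    ultimately show ?thesis using l LIMSEQ_unique by blast
  qed
  show ?thesis
  proof (rule that[OF S inf Z(1) _ Z(2)])
    show "\<not> (AE x in lborel. Z x = 0)"
    proof
      assume "AE x in lborel. Z x = 0"
      then have "L2_inner Z Z = 0" by (simp add: L2_inner_eq_0_iff H1_square_integrable[OF Z(1)])
      then have "dyadic_average K Z 0 = 0"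
        using dyadic_average_bound[OF H1_square_integrable[OF Z(1)], of K 0] by simp
      moreover have "(\<lambda>n. (dyadic_average K (v n) 0)\<^sup>2) \<longlonglongrightarrow> (dyadic_average K Z 0)\<^sup>2"
        by (intro tendsto_intros avg)
      then have "c \<le> (dyadic_average K Z 0)\<^sup>2" by (rule LIMSEQ_le_const) (use v(3) in auto)
      ultimately show False using c by simp
    qed
    fix \<phi> :: "'a \<Rightarrow> real" assume \<phi>: "\<phi> \<in> H1"
    obtain C' where C': "\<And>v t \<epsilon>. v \<in> H1 \<Longrightarrow> (\<integral>x. (v x) ^ 4 \<partial>lborel) = 1 \<Longrightarrow> H1_form lam v v \<le> S + \<epsilon> \<Longrightarrow> 0 < t \<Longrightarrow> t \<le> 1 \<Longrightarrow>
        2 * t * \<bar>H1_form lam v \<phi> - S * (\<integral>x. (v x) ^ 3 * \<phi> x \<partial>lborel)\<bar> \<le> \<epsilon> + C' * t\<^sup>2"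
      using almost_minimizer_almost_critical[OF S inf _ \<phi> lam] sob by blast
    have crit: "(\<lambda>n. H1_form lam (v n) \<phi> - S * (\<integral>x. (v n x) ^ 3 * \<phi> x \<partial>lborel)) \<longlonglongrightarrow> 0"
    proof (rule Lim_null_comparison)
      show "\<forall>\<^sub>F n in sequentially. norm (H1_form lam (v n) \<phi> - S * (\<integral>x. (v n x) ^ 3 * \<phi> x \<partial>lborel))
          \<le> (1 + C') / 2 * sqrt (1 / (real n + 1))"
      proof (intro always_eventually allI)
        fix n
        \<comment> \<open>The excess of the form over \<open>S\<close> is at most
          \<open>1 / (n + 1)\<close>. Matching the square of \<open>t\<close> to it makes both error
          terms of that order, and dividing by \<open>t\<close> leaves a null sequence.\<close>
        define t where "t = sqrt (1 / (real n + 1))"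
        have t: "0 < t" "t \<le> 1" "t\<^sup>2 = 1 / (real n + 1)" by (auto simp: t_def)
        have "2 * t * \<bar>H1_form lam (v n) \<phi> - S * (\<integral>x. (v n x) ^ 3 * \<phi> x \<partial>lborel)\<bar> \<le> t\<^sup>2 + C' * t\<^sup>2"
          by (rule C'[OF v(1,2) _ t(1,2)]) (use vE t in simp)
        also have "\<dots> = 2 * t * ((1 + C') / 2 * t)" by (simp add: power2_eq_square algebra_simps)
        finally show "norm (H1_form lam (v n) \<phi> - S * (\<integral>x. (v n x) ^ 3 * \<phi> x \<partial>lborel)) \<le> (1 + C') / 2 * sqrt (1 / (real n + 1))"
          using t(1) by (simp add: t_def[symmetric])
      qed
      have "(\<lambda>n. (1 + C') / 2 * sqrt (1 / (real n + 1))) \<longlonglongrightarrow> (1 + C') / 2 * sqrt 0"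
        by (intro tendsto_intros inv)
      then show "(\<lambda>n. (1 + C') / 2 * sqrt (1 / (real n + 1))) \<longlonglongrightarrow> 0" by simp
    qed
    have cub: "(\<lambda>n. \<integral>x. (v n x) ^ 3 * \<phi> x \<partial>lborel) \<longlonglongrightarrow> (\<integral>x. (Z x) ^ 3 * \<phi> x \<partial>lborel)"
      by (rule cubic_integral_tendsto[OF dim lam v(1,4) Z(1) avg \<phi>])
    have "(\<lambda>n. H1_form lam (v n) \<phi> - S * (\<integral>x. (v n x) ^ 3 * \<phi> x \<partial>lborel) + S * (\<integral>x. (v n x) ^ 3 * \<phi> x \<partial>lborel))
        \<longlonglongrightarrow> 0 + S * (\<integral>x. (Z x) ^ 3 * \<phi> x \<partial>lborel)"
      by (intro tendsto_add tendsto_mult_left crit cub)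
    then have lim: "(\<lambda>n. H1_form lam (v n) \<phi>) \<longlonglongrightarrow> S * (\<integral>x. (Z x) ^ 3 * \<phi> x \<partial>lborel)" by simp
    have "(\<lambda>n. H1_form lam (z n) \<phi>) \<longlonglongrightarrow> S * (\<integral>x. (Z x) ^ 3 * \<phi> x \<partial>lborel)"
    proof (rule midpoint_hull_tendsto[where l = "\<lambda>f. H1_form lam f \<phi>", OF v(1) z _ lim])
      fix f g :: "'a \<Rightarrow> real" assume "f \<in> H1" "g \<in> H1"
      then show "H1_form lam (\<lambda>x. 1/2 * (f x + g x)) \<phi> = (H1_form lam f \<phi> + H1_form lam g \<phi>) / 2"
        by (simp only: H1_form_mult_left H1_form_add_left H1_add \<phi>)
    qed
    moreover have "(\<lambda>n. H1_form lam (z n) \<phi>) \<longlonglongrightarrow> H1_form lam Z \<phi>"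
      by (rule H1_form_tendsto(1)[OF zH Z(1) \<phi> lam zZ])
    ultimately show "H1_form lam Z \<phi> = S * (\<integral>x. (Z x) ^ 3 * \<phi> x \<partial>lborel)" using LIMSEQ_unique by blast
  qed
qed

section \<open>Quadratic forms on the simplex\<close>

definition quad_form :: "('d::finite \<Rightarrow> 'd \<Rightarrow> real) \<Rightarrow> ('d \<Rightarrow> real) \<Rightarrow> real" where
  "quad_form \<beta> y = (\<Sum>i\<in>UNIV. \<Sum>j\<in>UNIV. \<beta> i j * (y i * y j))"

definition simplex_maximizer :: "('d::finite \<Rightarrow> 'd \<Rightarrow> real) \<Rightarrow> ('d \<Rightarrow> real) \<Rightarrow> bool" where
  "simplex_maximizer \<beta> y \<longleftrightarrow> (\<forall>i. 0 \<le> y i) \<and> (\<Sum>i\<in>UNIV. y i) = 1 \<and>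
     (\<forall>z. (\<forall>i. 0 \<le> z i) \<longrightarrow> (\<Sum>i\<in>UNIV. z i) = 1 \<longrightarrow> quad_form \<beta> z \<le> quad_form \<beta> y)"

lemma simplex_maximizer_exists: "\<exists>y. simplex_maximizer (\<beta> :: 'd::finite \<Rightarrow> 'd \<Rightarrow> real) y"
proof -
  \<comment> \<open>Vectors in \<open>real ^ 'd\<close> supply the topology for the compactness
    argument.\<close>
  define K where "K = {x :: real ^ 'd. (\<forall>i. 0 \<le> x $ i) \<and> (\<Sum>i\<in>UNIV. x $ i) = 1}"
  have "compact K"
    unfolding compact_eq_bounded_closed
  proof
    have "norm x \<le> 1" if "x \<in> K" for x
      using norm_le_l1_cart[of x] that by (simp add: K_def)
    then show "bounded K" by (auto intro: boundedI)
    show "closed K" unfolding K_def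
      by (intro closed_Collect_conj closed_Collect_all closed_Collect_le closed_Collect_eq continuous_intros)
  qed
  moreover have "axis undefined 1 \<in> K" by (auto simp: K_def axis_def)
  moreover have "continuous_on K (\<lambda>x. quad_form \<beta> (\<lambda>i. x $ i))"
    unfolding quad_form_def by (intro continuous_intros)
  ultimately obtain x where x: "x \<in> K" "\<And>y. y \<in> K \<Longrightarrow> quad_form \<beta> (\<lambda>i. y $ i) \<le> quad_form \<beta> (\<lambda>i. x $ i)"
    using continuous_attains_sup[of K "\<lambda>x. quad_form \<beta> (\<lambda>i. x $ i)"] by blast
  have "simplex_maximizer \<beta> (\<lambda>i. x $ i)"
    unfolding simplex_maximizer_def
  proof (intro conjI allI impI)
    fix z :: "'d \<Rightarrow> real" assume "\<forall>i. 0 \<le> z i" "(\<Sum>i\<in>UNIV. z i) = 1"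
    then show "quad_form \<beta> z \<le> quad_form \<beta> (\<lambda>i. x $ i)"
      using x(2)[of "\<chi> i. z i"] by (simp add: K_def)
  qed (use x in \<open>auto simp: K_def\<close>)
  then show ?thesis by blast
qed

text \<open>First order optimality: moving mass \<open>t\<close> from \<open>p\<close> to
  \<open>i\<close> changes the form by \<open>2 * t * D + t\<^sup>2 * c\<close>, which is positive
  for small \<open>t\<close> if \<open>D > 0\<close>. The index \<open>p\<close> has to carry mass
  because it gives mass away.\<close>

lemma simplex_maximizer_exchange:
  fixes \<beta> :: "'d::finite \<Rightarrow> 'd \<Rightarrow> real"
  assumes sym: "\<And>i j. \<beta> i j = \<beta> j i" and y: "simplex_maximizer \<beta> y" and "y p > 0" "i \<noteq> p"
  shows "(\<Sum>j\<in>UNIV. \<beta> i j * y j) \<le> (\<Sum>j\<in>UNIV. \<beta> p j * y j)"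
proof (rule ccontr)
  define D where "D = (\<Sum>j\<in>UNIV. \<beta> i j * y j) - (\<Sum>j\<in>UNIV. \<beta> p j * y j)"
  define c where "c = \<beta> i i + \<beta> p p - 2 * \<beta> i p"
  assume "\<not> ?thesis"
  then have D: "D > 0" by (simp add: D_def)
  \<comment> \<open>The first bound keeps the entry at \<open>p\<close> nonnegative; the second lets
    the linear gain outweigh the quadratic term, with \<open>+ 1\<close> covering
    \<open>c = 0\<close>.\<close>
  define t where "t = min (y p) (D / (\<bar>c\<bar> + 1))"
  have "t \<le> D / (\<bar>c\<bar> + 1)" by (simp add: t_def)
  then have t: "0 < t" "t \<le> y p" "t * (\<bar>c\<bar> + 1) \<le> D"
  proof -
    show "0 < t" "t \<le> y p" using D \<open>y p > 0\<close> by (auto simp: t_def add_nonneg_pos)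
    show "t * (\<bar>c\<bar> + 1) \<le> D" using \<open>t \<le> D / (\<bar>c\<bar> + 1)\<close> by (simp add: pos_le_divide_eq add_nonneg_pos)
  qed
  define h :: "'d \<Rightarrow> real" where "h j = (if j = i then 1 else 0) - (if j = p then 1 else 0)" for j
  define z where "z j = y j + t * h j" for j
  have sum_h: "(\<Sum>j\<in>UNIV. f j * h j) = f i - f p" for f :: "'d \<Rightarrow> real"
  proof -
    have "f j * h j = (if j = i then f j else 0) - (if j = p then f j else 0)" for j
      by (simp add: h_def)
    then show ?thesis by (simp add: sum_subtractf)
  qed
  have "\<forall>j. 0 \<le> z j"
    using y t \<open>i \<noteq> p\<close> by (auto simp: z_def h_def simplex_maximizer_def)
  moreover have "(\<Sum>j\<in>UNIV. z j) = 1"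
    using y sum_h[of "\<lambda>_. t"] by (simp add: z_def simplex_maximizer_def sum.distrib)
  ultimately have le: "quad_form \<beta> z \<le> quad_form \<beta> y" using y by (simp add: simplex_maximizer_def)
  have "quad_form \<beta> z = quad_form \<beta> y + 2 * t * D + t\<^sup>2 * c"
  proof -
    have "quad_form \<beta> z = (\<Sum>k\<in>UNIV. \<Sum>j\<in>UNIV. \<beta> k j * (y k * y j)) + t * (\<Sum>k\<in>UNIV. \<Sum>j\<in>UNIV. \<beta> k j * (y k * h j))
        + t * (\<Sum>k\<in>UNIV. \<Sum>j\<in>UNIV. \<beta> k j * (h k * y j)) + t\<^sup>2 * (\<Sum>k\<in>UNIV. \<Sum>j\<in>UNIV. \<beta> k j * (h k * h j))"
      unfolding quad_form_def z_def
      by (simp add: sum_distrib_left algebra_simps power2_eq_square flip: sum.distrib)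
    also have "(\<Sum>k\<in>UNIV. \<Sum>j\<in>UNIV. \<beta> k j * (h k * y j)) = (\<Sum>k\<in>UNIV. (\<Sum>j\<in>UNIV. \<beta> k j * y j) * h k)"
      by (simp add: sum_distrib_left sum_distrib_right mult_ac)
    also have "\<dots> = D" unfolding sum_h D_def by simp
    also have "(\<Sum>k\<in>UNIV. \<Sum>j\<in>UNIV. \<beta> k j * (y k * h j)) = (\<Sum>j\<in>UNIV. \<Sum>k\<in>UNIV. \<beta> k j * (y k * h j))"
      by (rule sum.swap)
    also have "\<dots> = (\<Sum>j\<in>UNIV. (\<Sum>k\<in>UNIV. \<beta> j k * y k) * h j)"
      using sym by (simp add: sum_distrib_left sum_distrib_right mult_ac)
    also have "\<dots> = D" unfolding sum_h D_def by simp
    also have "(\<Sum>k\<in>UNIV. \<Sum>j\<in>UNIV. \<beta> k j * (h k * h j)) = (\<Sum>k\<in>UNIV. (\<Sum>j\<in>UNIV. \<beta> k j * h j) * h k)"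
      by (simp add: sum_distrib_left sum_distrib_right mult_ac)
    also have "\<dots> = c" unfolding sum_h c_def using sym[of p i] by simp
    finally show ?thesis by (simp add: quad_form_def algebra_simps)
  qed
  moreover have "2 * t * D + t\<^sup>2 * c > 0"
  proof -
    have "- (t * c) \<le> t * (\<bar>c\<bar> + 1)" using t(1) by (simp add: abs_if algebra_simps)
    then have "2 * D + t * c > 0" using t(3) D by linarith
    then have "t * (2 * D + t * c) > 0" using t(1) by simp
    then show ?thesis by (simp add: power2_eq_square algebra_simps)
  qed
  ultimately show False using le by simp
qed

text \<open>If a component vanished, moving mass to it from the largest component would increase the
  form: the gain \<open>\<alpha>\<close> on the diagonal beats the at most \<open>d - 2\<close> losses of size \<open>\<delta>\<close>.\<close>

lemma simplex_maximizer_pos: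
  fixes \<beta> :: "'d::finite \<Rightarrow> 'd \<Rightarrow> real"
  assumes sym: "\<And>i j. \<beta> i j = \<beta> j i" and y: "simplex_maximizer \<beta> y"
    and diag: "\<And>i p. i \<noteq> p \<Longrightarrow> \<alpha> \<le> \<beta> i p - \<beta> p p"
    and off: "\<And>i j p. i \<noteq> j \<Longrightarrow> j \<noteq> p \<Longrightarrow> i \<noteq> p \<Longrightarrow> \<bar>\<beta> j i - \<beta> j p\<bar> \<le> \<delta>"
    and \<delta>: "0 \<le> \<delta>" "\<delta> * (real CARD('d) - 2) < \<alpha>"
  shows "y i > 0"
proof (rule ccontr)
  have nonneg: "0 \<le> y j" for j using y by (simp add: simplex_maximizer_def)
  assume "\<not> y i > 0"
  then have yi: "y i = 0" using nonneg[of i] by simp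
  \<comment> \<open>With the largest entry at \<open>p\<close>, every loss
    \<open>\<delta> * y j\<close> is at most \<open>\<delta> * y p\<close> and can be compared with
    the gain at \<open>p\<close>.\<close>
  obtain p where p: "\<And>j. y j \<le> y p"
  proof -
    have "Max (range y) \<in> range y" by (rule Max_in) auto
    then obtain p where "y p = Max (range y)" by force
    then show ?thesis using that by (metis Max_ge finite_class.finite_UNIV finite_imageI rangeI)
  qed
  have yp: "y p > 0"
  proof (rule ccontr)
    assume "\<not> y p > 0"
    then have "y j = 0" for j using p[of j] nonneg[of j] by simp
    then show False using y by (simp add: simplex_maximizer_def)
  qed
  then have ip: "i \<noteq> p" using yi by auto
  have "(\<Sum>j\<in>UNIV. \<beta> i j * y j) - (\<Sum>j\<in>UNIV. \<beta> p j * y j) = (\<Sum>j\<in>UNIV. (\<beta> i j - \<beta> p j) * y j)"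
    by (simp add: sum_subtractf left_diff_distrib)
  also have "\<dots> = (\<beta> i p - \<beta> p p) * y p + (\<beta> i i - \<beta> p i) * y i + (\<Sum>j\<in>UNIV - {p} - {i}. (\<beta> i j - \<beta> p j) * y j)"
    using ip by (simp add: sum.remove[of UNIV p] sum.remove[of "UNIV - {p}" i])
  also have "\<dots> \<ge> \<alpha> * y p + 0 + (\<Sum>j\<in>UNIV - {p} - {i}. - (\<delta> * y p))"
  proof (intro add_mono sum_mono)
    show "\<alpha> * y p \<le> (\<beta> i p - \<beta> p p) * y p" using diag[OF ip] yp by (intro mult_right_mono) auto
    show "0 \<le> (\<beta> i i - \<beta> p i) * y i" by (simp add: yi)
    fix j assume j: "j \<in> UNIV - {p} - {i}"
    have "- \<delta> \<le> \<beta> i j - \<beta> p j" using off[of i j p] j ip sym[of i j] sym[of p j] by auto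
    then have "- \<delta> * y j \<le> (\<beta> i j - \<beta> p j) * y j" using nonneg by (intro mult_right_mono) auto
    moreover have "\<delta> * y j \<le> \<delta> * y p" using p \<delta> by (intro mult_left_mono) auto
    ultimately show "- (\<delta> * y p) \<le> (\<beta> i j - \<beta> p j) * y j" by simp
  qed
  also have "\<alpha> * y p + 0 + (\<Sum>j\<in>UNIV - {p} - {i}. - (\<delta> * y p)) = (\<alpha> - \<delta> * (real CARD('d) - 2)) * y p"
  proof -
    have "2 \<le> CARD('d)" using card_mono[of UNIV "{i, p}"] ip by simp
    then have card: "real (card (UNIV - {p} - {i} :: 'd set)) = real CARD('d) - 2"
      using ip by (simp add: card_Diff_subset of_nat_diff)
    show ?thesis unfolding sum_constant card by (simp add: algebra_simps)
  qed
  finally have "(\<alpha> - \<delta> * (real CARD('d) - 2)) * y p \<le> (\<Sum>j\<in>UNIV. \<beta> i j * y j) - (\<Sum>j\<in>UNIV. \<beta> p j * y j)" .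
  moreover have "(\<alpha> - \<delta> * (real CARD('d) - 2)) * y p > 0" using \<delta> yp by simp
  ultimately show False using simplex_maximizer_exchange[OF sym y yp ip] by linarith
qed

lemma quad_form_scale: "quad_form \<beta> (\<lambda>i. r * y i) = r\<^sup>2 * quad_form \<beta> y"
  by (simp add: quad_form_def sum_distrib_left power2_eq_square mult_ac)

text \<open>With all entries positive, exchanges in both directions force the row sums to agree, a
  Lagrange condition. Homogeneity carries the bound from the simplex to all nonnegative vectors. In
  the last clause equality makes the normalized vector a maximizer too, hence positive.\<close>

lemma simplex_quadratic_form:
  fixes \<beta> :: "'d::finite \<Rightarrow> 'd \<Rightarrow> real"
  assumes sym: "\<And>i j. \<beta> i j = \<beta> j i" and pos: "\<And>i j. \<beta> i j > 0"
    and diag: "\<And>i p. i \<noteq> p \<Longrightarrow> \<alpha> \<le> \<beta> i p - \<beta> p p"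
    and off: "\<And>i j p. i \<noteq> j \<Longrightarrow> j \<noteq> p \<Longrightarrow> i \<noteq> p \<Longrightarrow> \<bar>\<beta> j i - \<beta> j p\<bar> \<le> \<delta>"
    and \<delta>: "0 \<le> \<delta>" "\<delta> * (real CARD('d) - 2) < \<alpha>"
  obtains M y where "M > 0" "\<And>i. y i > 0" "(\<Sum>i\<in>UNIV. y i) = 1" "\<And>i. (\<Sum>j\<in>UNIV. \<beta> i j * y j) = M"
    "\<And>z. (\<And>i. 0 \<le> z i) \<Longrightarrow> quad_form \<beta> z \<le> M * (\<Sum>i\<in>UNIV. z i)\<^sup>2"
    "\<And>z i. (\<And>i. 0 \<le> z i) \<Longrightarrow> 0 < (\<Sum>i\<in>UNIV. z i) \<Longrightarrow> M * (\<Sum>i\<in>UNIV. z i)\<^sup>2 \<le> quad_form \<beta> z \<Longrightarrow> 0 < z i"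
proof -
  obtain y where y: "simplex_maximizer \<beta> y" using simplex_maximizer_exists by blast
  have full: "z i > 0" if "simplex_maximizer \<beta> z" for z i
    by (rule simplex_maximizer_pos[OF sym that diag off \<delta>])
  have sum1: "(\<Sum>i\<in>UNIV. y i) = 1" using y by (simp add: simplex_maximizer_def)
  \<comment> \<open>The row \<open>undefined\<close> is just an arbitrary one, as all row sums
    agree.\<close>
  define M where "M = (\<Sum>j\<in>UNIV. \<beta> undefined j * y j)"
  have M: "(\<Sum>j\<in>UNIV. \<beta> i j * y j) = M" for i
    unfolding M_def
    using simplex_maximizer_exchange[OF sym y full[OF y], of i undefined]
      simplex_maximizer_exchange[OF sym y full[OF y], of undefined i] by (cases "i = undefined") auto
  have "M > 0" unfolding M_def by (intro sum_pos mult_pos_pos pos full[OF y]) auto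
  have qM: "quad_form \<beta> y = M"
  proof -
    have "quad_form \<beta> y = (\<Sum>i\<in>UNIV. y i * (\<Sum>j\<in>UNIV. \<beta> i j * y j))"
      by (simp add: quad_form_def sum_distrib_left mult_ac)
    also have "\<dots> = (\<Sum>i\<in>UNIV. y i) * M" by (simp add: M sum_distrib_right)
    finally show ?thesis by (simp add: sum1)
  qed
  have norm: "(\<forall>i. 0 \<le> 1 / s * z i) \<and> (\<Sum>i\<in>UNIV. 1 / s * z i) = 1 \<and> quad_form \<beta> (\<lambda>i. 1 / s * z i) = quad_form \<beta> z / s\<^sup>2"
    if "\<And>i. 0 \<le> z i" "s = (\<Sum>i\<in>UNIV. z i)" "0 < s" for z s
  proof (intro conjI allI)
    show "(\<Sum>i\<in>UNIV. 1 / s * z i) = 1" using that by (simp flip: sum_divide_distrib)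
    show "quad_form \<beta> (\<lambda>i. 1 / s * z i) = quad_form \<beta> z / s\<^sup>2"
      unfolding quad_form_scale by (simp add: power_divide)
    show "0 \<le> 1 / s * z i" for i using that by simp
  qed
  show ?thesis
  proof (rule that[OF \<open>M > 0\<close> full[OF y] sum1 M])
    fix z :: "'d \<Rightarrow> real" assume z: "\<And>i. 0 \<le> z i"
    define s where "s = (\<Sum>i\<in>UNIV. z i)"
    have "0 \<le> s" unfolding s_def by (intro sum_nonneg z)
    show "quad_form \<beta> z \<le> M * (\<Sum>i\<in>UNIV. z i)\<^sup>2"
    proof (cases "s = 0")
      case True
      then have "z i = 0" for i using z by (simp add: s_def sum_nonneg_eq_0_iff)
      then show ?thesis using \<open>M > 0\<close> by (simp add: quad_form_def)
    next
      case False
      then have s: "0 < s" using \<open>0 \<le> s\<close> by simp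
      have "quad_form \<beta> z / s\<^sup>2 \<le> M"
        using norm[OF z s_def s] y qM unfolding simplex_maximizer_def by metis
      then show ?thesis using s by (simp add: s_def pos_divide_le_eq)
    qed
  next
    fix z :: "'d \<Rightarrow> real" and i
    assume z: "\<And>i. 0 \<le> z i" and s0: "0 < (\<Sum>i\<in>UNIV. z i)" and ge: "M * (\<Sum>i\<in>UNIV. z i)\<^sup>2 \<le> quad_form \<beta> z"
    define s where "s = (\<Sum>i\<in>UNIV. z i)"
    have s: "0 < s" using s0 by (simp add: s_def)
    note n = norm[OF z s_def s]
    have "M \<le> quad_form \<beta> z / s\<^sup>2" using ge s by (simp add: s_def pos_le_divide_eq)
    then have "simplex_maximizer \<beta> (\<lambda>i. 1 / s * z i)"
      using n y qM unfolding simplex_maximizer_def by (metis order_trans)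
    from full[OF this, of i] show "0 < z i" using s by (simp add: zero_less_divide_iff)
  qed
qed

section \<open>Solutions of the system\<close>

definition coupling :: "('d \<Rightarrow> real) \<Rightarrow> ('d \<Rightarrow> 'd \<Rightarrow> real) \<Rightarrow> 'd \<Rightarrow> 'd \<Rightarrow> real" where
  "coupling \<mu> b i j = (if i = j then \<mu> i else b i j)"

text \<open>Ordered pairs count each \<open>i < j\<close> twice, so with \<open>coupling\<close> as
  \<beta> the two interaction terms of the energy combine into \<open>1/4 * quartic\<close>.\<close>

definition quartic :: "('d::finite \<Rightarrow> 'd \<Rightarrow> real) \<Rightarrow> ('d \<Rightarrow> 'a::euclidean_space \<Rightarrow> real) \<Rightarrow> real" where
  "quartic \<beta> u = (\<Sum>i\<in>UNIV. \<Sum>j\<in>UNIV. \<beta> i j * (\<integral>x. (u i x)\<^sup>2 * (u j x)\<^sup>2 \<partial>lborel))"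

lemma sum_symmetric_split:
  fixes f :: "'d::{finite,linorder} \<Rightarrow> 'd \<Rightarrow> real"
  assumes "\<And>i j. f i j = f j i"
  shows "(\<Sum>i\<in>UNIV. \<Sum>j\<in>UNIV. f i j) = (\<Sum>i\<in>UNIV. f i i) + 2 * (\<Sum>(i, j)\<in>{(i, j). i < j}. f i j)"
proof -
  let ?L = "{(i :: 'd, j). i < j}" and ?G = "{(i :: 'd, j). j < i}" and ?D = "(\<lambda>i :: 'd. (i, i)) ` UNIV"
  have "(\<Sum>i\<in>UNIV. \<Sum>j\<in>UNIV. f i j) = (\<Sum>(i, j)\<in>UNIV \<times> UNIV. f i j)"
    by (simp add: sum.cartesian_product)
  also have "UNIV \<times> UNIV = ?D \<union> (?L \<union> ?G)" by (auto simp: image_iff)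
  also have "(\<Sum>(i, j)\<in>?D \<union> (?L \<union> ?G). f i j) = (\<Sum>(i, j)\<in>?D. f i j) + (\<Sum>(i, j)\<in>?L \<union> ?G. f i j)"
    by (rule sum.union_disjoint) (auto intro: finite_subset[of _ UNIV])
  also have "(\<Sum>(i, j)\<in>?L \<union> ?G. f i j) = (\<Sum>(i, j)\<in>?L. f i j) + (\<Sum>(i, j)\<in>?G. f i j)"
    by (rule sum.union_disjoint) (auto intro: finite_subset[of _ UNIV])
  also have "(\<Sum>(i, j)\<in>?G. f i j) = (\<Sum>(i, j)\<in>?L. f i j)"
    by (rule sum.reindex_bij_witness[of _ prod.swap prod.swap]) (auto simp: assms)
  also have "(\<Sum>(i, j)\<in>?D. f i j) = (\<Sum>i\<in>UNIV. f i i)"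
    by (subst sum.reindex) (auto simp: inj_on_def)
  finally show ?thesis by simp
qed

lemma integral_grad_eq_H1_form:
  assumes "u \<in> H1"
  shows "(\<integral>x. (norm (grad u x))\<^sup>2 + lam * (u x)\<^sup>2 \<partial>lborel) = H1_form lam u u"
  using H1_square_integrable[OF assms] grad_square_integrable[OF assms]
  by (simp add: H1_form_def L2_inner_self square_integrable_def)

lemma energy_eq:
  fixes u :: "'d::{finite,linorder} \<Rightarrow> 'a::euclidean_space \<Rightarrow> real"
  assumes u: "u \<in> H1_vec" and sym: "\<And>i j. i \<noteq> j \<Longrightarrow> b i j = b j i"
  shows "energy (\<lambda>_. lam) \<mu> b u = 1/2 * (\<Sum>i\<in>UNIV. H1_form lam (u i) (u i)) - 1/4 * quartic (coupling \<mu> b) u"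
proof -
  let ?f = "\<lambda>i j. coupling \<mu> b i j * (\<integral>x. (u i x)\<^sup>2 * (u j x)\<^sup>2 \<partial>lborel)"
  have "quartic (coupling \<mu> b) u = (\<Sum>i\<in>UNIV. ?f i i) + 2 * (\<Sum>(i, j)\<in>{(i, j). i < j}. ?f i j)"
    unfolding quartic_def
    by (rule sum_symmetric_split) (use sym in \<open>auto simp: coupling_def mult.commute\<close>)
  also have "(\<Sum>i\<in>UNIV. ?f i i) = (\<Sum>i\<in>UNIV. \<mu> i * (\<integral>x. (u i x) ^ 4 \<partial>lborel))"
    by (simp add: coupling_def flip: power_add)
  also have "(\<Sum>(i, j)\<in>{(i, j). i < j}. ?f i j) = (\<Sum>(i, j)\<in>{(i, j). i < j}. b i j * (\<integral>x. (u i x)\<^sup>2 * (u j x)\<^sup>2 \<partial>lborel))"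
    by (rule sum.cong) (auto simp: coupling_def)
  finally have q: "quartic (coupling \<mu> b) u = (\<Sum>i\<in>UNIV. \<mu> i * (\<integral>x. (u i x) ^ 4 \<partial>lborel))
      + 2 * (\<Sum>(i, j)\<in>{(i, j). i < j}. b i j * (\<integral>x. (u i x)\<^sup>2 * (u j x)\<^sup>2 \<partial>lborel))" .
  have "(\<Sum>i\<in>UNIV. \<integral>x. (norm (grad (u i) x))\<^sup>2 + lam * (u i x)\<^sup>2 \<partial>lborel) = (\<Sum>i\<in>UNIV. H1_form lam (u i) (u i))"
    using u by (intro sum.cong refl integral_grad_eq_H1_form) (simp add: H1_vec_def)
  then show ?thesis unfolding energy_def q by (simp add: algebra_simps)
qed

lemma H1_norm_eq: "v \<in> H1_vec \<Longrightarrow> H1_norm v = sqrt (\<Sum>i\<in>UNIV. H1_form 1 (v i) (v i))"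
proof -
  assume "v \<in> H1_vec"
  then have "(\<integral>x. (norm (grad (v i) x))\<^sup>2 + (v i x)\<^sup>2 \<partial>lborel) = H1_form 1 (v i) (v i)" for i
    using integral_grad_eq_H1_form[of "v i" 1] by (simp add: H1_vec_def)
  then show ?thesis by (simp add: H1_norm_def)
qed

text \<open>Differentiate along the ray through \<open>u\<close>.\<close>

lemma nontrivial_solution_Nehari:
  fixes u :: "'d::{finite,linorder} \<Rightarrow> 'a::euclidean_space \<Rightarrow> real"
  assumes u: "u \<in> nontrivial_solutions (\<lambda>_. lam) \<mu> b" and sym: "\<And>i j. i \<noteq> j \<Longrightarrow> b i j = b j i"
  shows "(\<Sum>i\<in>UNIV. H1_form lam (u i) (u i)) = quartic (coupling \<mu> b) u"
    "energy (\<lambda>_. lam) \<mu> b u = 1/4 * (\<Sum>i\<in>UNIV. H1_form lam (u i) (u i))"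
proof -
  have uH: "u \<in> H1_vec" and crit: "has_H1_derivative (energy (\<lambda>_. lam) \<mu> b) (\<lambda>_. 0) u"
    using u by (auto simp: nontrivial_solutions_def)
  have ui: "u i \<in> H1" for i using uH by (simp add: H1_vec_def)
  let ?J = "energy (\<lambda>_. lam) \<mu> b"
  define A B where "A = (\<Sum>i\<in>UNIV. H1_form lam (u i) (u i))" and "B = quartic (coupling \<mu> b) u"
  define g where "g t = 1/2 * (1 + t)\<^sup>2 * A - 1/4 * (1 + t) ^ 4 * B" for t
  have scaleH: "(\<lambda>i x. r * u i x) \<in> H1_vec" for r using ui by (simp add: H1_vec_def H1_mult)
  have J: "?J (\<lambda>i x. u i x + t * u i x) = g t" for t
  proof -
    have eq: "(\<lambda>i x. u i x + t * u i x) = (\<lambda>i x. (1 + t) * u i x)" by (simp add: algebra_simps)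
    have "H1_form lam (\<lambda>x. (1 + t) * u i x) (\<lambda>x. (1 + t) * u i x) = (1 + t)\<^sup>2 * H1_form lam (u i) (u i)" for i
      by (simp only: H1_form_mult_left H1_form_mult_right H1_mult ui power2_eq_square mult.assoc)
    moreover have "quartic (coupling \<mu> b) (\<lambda>i x. (1 + t) * u i x) = (1 + t) ^ 4 * B"
    proof -
      have "(\<integral>x. ((1 + t) * u i x)\<^sup>2 * ((1 + t) * u j x)\<^sup>2 \<partial>lborel) = (1 + t) ^ 4 * (\<integral>x. (u i x)\<^sup>2 * (u j x)\<^sup>2 \<partial>lborel)" for i j
      proof -
        have "((1 + t) * u i x)\<^sup>2 * ((1 + t) * u j x)\<^sup>2 = (1 + t) ^ 4 * ((u i x)\<^sup>2 * (u j x)\<^sup>2)" for x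
        proof -
          have "(r * p)\<^sup>2 * (r * q)\<^sup>2 = r ^ 4 * (p\<^sup>2 * q\<^sup>2)" for r p q :: real
            by (simp add: power2_eq_square power4_eq_xxxx mult_ac)
          then show ?thesis .
        qed
        then show ?thesis by simp
      qed
      then show ?thesis by (simp add: quartic_def B_def sum_distrib_left mult_ac)
    qed
    moreover have "?J (\<lambda>i x. (1 + t) * u i x) = 1/2 * (\<Sum>i\<in>UNIV. H1_form lam (\<lambda>x. (1 + t) * u i x) (\<lambda>x. (1 + t) * u i x))
        - 1/4 * quartic (coupling \<mu> b) (\<lambda>i x. (1 + t) * u i x)"
      by (rule energy_eq[OF scaleH sym])
    ultimately show ?thesis
      unfolding eq g_def A_def by (simp add: sum_distrib_left)
  qed
  have Jg0: "?J u = g 0" using J[of 0] by simp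
  have nrm: "H1_norm (\<lambda>i x. t * u i x) = \<bar>t\<bar> * H1_norm u" for t
  proof -
    have "(\<Sum>i\<in>UNIV. H1_form 1 (\<lambda>x. t * u i x) (\<lambda>x. t * u i x)) = t\<^sup>2 * (\<Sum>i\<in>UNIV. H1_form 1 (u i) (u i))"
      by (simp only: H1_form_mult_left H1_form_mult_right H1_mult ui power2_eq_square mult.assoc sum_distrib_left)
    then show ?thesis by (simp add: H1_norm_eq scaleH uH real_sqrt_mult)
  qed
  define n where "n = H1_norm u"
  have n: "0 \<le> n" unfolding n_def H1_norm_def by (intro real_sqrt_ge_zero sum_nonneg integral_nonneg_AE) auto
  have "(g has_real_derivative 0) (at 0)"
    unfolding has_field_derivative_iff
  proof (rule LIM_I)
    fix r :: real assume r: "r > 0"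
    \<comment> \<open>The \<open>n + 1\<close> avoids division by a vanishing norm, and aiming at
      \<open>r / 2\<close> leaves room for the strict inequality.\<close>
    define \<epsilon> where "\<epsilon> = r / (2 * (n + 1))"
    have "\<epsilon> > 0" using r n by (simp add: \<epsilon>_def)
    then obtain \<delta> where \<delta>: "\<delta> > 0" "\<And>v. v \<in> H1_vec \<Longrightarrow> H1_norm v < \<delta> \<Longrightarrow>
        \<bar>?J (\<lambda>i x. u i x + v i x) - ?J u - 0\<bar> \<le> \<epsilon> * H1_norm v"
      using crit unfolding has_H1_derivative_def by blast
    show "\<exists>s>0. \<forall>x. x \<noteq> 0 \<and> norm (x - 0) < s \<longrightarrow> norm ((g x - g 0) / (x - 0) - 0) < r"
    proof (intro exI conjI allI impI)
      show "\<delta> / (n + 1) > 0" using \<delta> n by simp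
      fix t :: real assume t: "t \<noteq> 0 \<and> norm (t - 0) < \<delta> / (n + 1)"
      have "\<bar>t\<bar> * n \<le> \<bar>t\<bar> * (n + 1)" by (intro mult_left_mono) auto
      also have "\<dots> < \<delta>" using t n by (simp add: pos_less_divide_eq)
      finally have "H1_norm (\<lambda>i x. t * u i x) < \<delta>" by (simp add: nrm n_def)
      from \<delta>(2)[OF scaleH this] have "\<bar>g t - g 0\<bar> \<le> \<epsilon> * (\<bar>t\<bar> * n)"
        by (simp add: J Jg0 nrm n_def)
      also have "\<dots> = (\<epsilon> * n) * \<bar>t\<bar>" by simp
      also have "\<epsilon> * n \<le> r / 2" using n r by (simp add: \<epsilon>_def field_simps)
      finally have "\<bar>g t - g 0\<bar> \<le> r / 2 * \<bar>t\<bar>" by (simp add: mult_right_mono)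
      then have "\<bar>g t - g 0\<bar> / \<bar>t\<bar> \<le> r / 2" using t by (simp add: pos_divide_le_eq)
      then show "norm ((g t - g 0) / (t - 0) - 0) < r"
        using r unfolding diff_zero real_norm_def abs_divide by linarith
    qed
  qed
  moreover have "(g has_real_derivative (A - B)) (at 0)"
    unfolding g_def by (auto intro!: derivative_eq_intros)
  ultimately have AB: "A = B" using DERIV_unique by fastforce
  then show "(\<Sum>i\<in>UNIV. H1_form lam (u i) (u i)) = quartic (coupling \<mu> b) u" by (simp add: A_def B_def)
  show "energy (\<lambda>_. lam) \<mu> b u = 1/4 * (\<Sum>i\<in>UNIV. H1_form lam (u i) (u i))"
    using energy_eq[OF uH sym, where lam = lam and \<mu> = \<mu>] AB by (simp add: A_def B_def)
qed

text \<open>First order expansion with a quadratic remainder, as Frechet differentiability demands.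
  The bound \<open>s \<le> 1\<close> reduces the cubic and quartic remainders to the square of
  \<open>s\<close>; the coefficients are \<open>6 = 4 + 1 + 1\<close> for the terms quadratic in the
  increments, \<open>4 = 2 + 2\<close> for the cubic ones and \<open>1\<close> for the quartic
  one.\<close>

lemma square_product_expansion:
  fixes p q a c :: "'a::euclidean_space \<Rightarrow> real"
  assumes "L4 p" "L4 q" "L4 a" "L4 c"
    and P: "L4_norm p \<le> P" "L4_norm q \<le> P" and s: "L4_norm a \<le> s" "L4_norm c \<le> s" "s \<le> 1"
  shows "\<bar>(\<integral>x. (p x + a x)\<^sup>2 * (q x + c x)\<^sup>2 \<partial>lborel) - (\<integral>x. (p x)\<^sup>2 * (q x)\<^sup>2 \<partial>lborel)
      - 2 * (\<integral>x. p x * a x * (q x * q x) \<partial>lborel) - 2 * (\<integral>x. p x * p x * (q x * c x) \<partial>lborel)\<bar>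
    \<le> (6 * P\<^sup>2 + 4 * P + 1) * s\<^sup>2"
proof -
  have P0: "0 \<le> P" and s0: "0 \<le> s" using P(1) s(1) L4_norm_ge_0 order_trans by blast+
  note L = assms(1-4)
  note I = L4_Hoelder(1)
  have bound: "\<bar>\<integral>x. f x * g x * (h x * k x) \<partial>lborel\<bar> \<le> F * G * (H * K)"
    if "L4 f" "L4 g" "L4 h" "L4 k" "L4_norm f \<le> F" "L4_norm g \<le> G" "L4_norm h \<le> H" "L4_norm k \<le> K"
    for f g h k :: "'a \<Rightarrow> real" and F G H K
  proof -
    have "0 \<le> F" "0 \<le> G" "0 \<le> H" "0 \<le> K" using that(5-8) L4_norm_ge_0 order_trans by blast+
    then have "L4_norm f * L4_norm g * (L4_norm h * L4_norm k) \<le> F * G * (H * K)"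
      using that by (intro mult_mono mult_nonneg_nonneg) auto
    then show ?thesis using L4_Hoelder(2)[OF that(1-4)] by linarith
  qed
  have exp: "(p x + a x)\<^sup>2 * (q x + c x)\<^sup>2 = p x * p x * (q x * q x) + 2 * (p x * a x * (q x * q x)) + 2 * (p x * p x * (q x * c x))
     + 4 * (p x * a x * (q x * c x)) + p x * p x * (c x * c x) + a x * a x * (q x * q x)
     + 2 * (p x * a x * (c x * c x)) + 2 * (a x * a x * (q x * c x)) + a x * a x * (c x * c x)" for x
    by (simp add: power2_eq_square algebra_simps)
  have "(\<integral>x. (p x + a x)\<^sup>2 * (q x + c x)\<^sup>2 \<partial>lborel) = (\<integral>x. p x * p x * (q x * q x) \<partial>lborel)
      + 2 * (\<integral>x. p x * a x * (q x * q x) \<partial>lborel) + 2 * (\<integral>x. p x * p x * (q x * c x) \<partial>lborel)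
      + 4 * (\<integral>x. p x * a x * (q x * c x) \<partial>lborel) + (\<integral>x. p x * p x * (c x * c x) \<partial>lborel) + (\<integral>x. a x * a x * (q x * q x) \<partial>lborel)
      + 2 * (\<integral>x. p x * a x * (c x * c x) \<partial>lborel) + 2 * (\<integral>x. a x * a x * (q x * c x) \<partial>lborel) + (\<integral>x. a x * a x * (c x * c x) \<partial>lborel)"
    unfolding exp by (simp add: I L)
  moreover have "(\<integral>x. (p x)\<^sup>2 * (q x)\<^sup>2 \<partial>lborel) = (\<integral>x. p x * p x * (q x * q x) \<partial>lborel)"
    by (simp add: power2_eq_square)
  moreover have "\<bar>\<integral>x. p x * a x * (q x * c x) \<partial>lborel\<bar> \<le> P\<^sup>2 * s\<^sup>2"
    using bound[OF L(1,3,2,4) P(1) s(1) P(2) s(2)] by (simp add: power2_eq_square mult_ac)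
  moreover have "\<bar>\<integral>x. p x * p x * (c x * c x) \<partial>lborel\<bar> \<le> P\<^sup>2 * s\<^sup>2"
    using bound[OF L(1,1,4,4) P(1,1) s(2,2)] by (simp add: power2_eq_square mult_ac)
  moreover have "\<bar>\<integral>x. a x * a x * (q x * q x) \<partial>lborel\<bar> \<le> P\<^sup>2 * s\<^sup>2"
    using bound[OF L(3,3,2,2) s(1,1) P(2,2)] by (simp add: power2_eq_square mult_ac)
  moreover have "\<bar>\<integral>x. p x * a x * (c x * c x) \<partial>lborel\<bar> \<le> P * s\<^sup>2"
  proof -
    have "P * s * (s * s) \<le> P * 1 * (s * s)" using P0 s0 s(3) by (intro mult_right_mono mult_left_mono) auto
    then show ?thesis using bound[OF L(1,3,4,4) P(1) s(1,2,2)] by (simp add: power2_eq_square)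
  qed
  moreover have "\<bar>\<integral>x. a x * a x * (q x * c x) \<partial>lborel\<bar> \<le> P * s\<^sup>2"
  proof -
    have "s * s * (P * s) \<le> s * s * (P * 1)" using P0 s0 s(3) by (intro mult_left_mono) auto
    then show ?thesis using bound[OF L(3,3,2,4) s(1,1) P(2) s(2)] by (simp add: power2_eq_square mult_ac)
  qed
  moreover have "\<bar>\<integral>x. a x * a x * (c x * c x) \<partial>lborel\<bar> \<le> s\<^sup>2"
  proof -
    have "s * s \<le> 1" using s0 s(3) by (simp add: mult_le_one)
    then have "s * s * (s * s) \<le> 1 * (s * s)" by (intro mult_right_mono) auto
    then show ?thesis using bound[OF L(3,3,4,4) s(1,1,2,2)] by (simp add: power2_eq_square)
  qed
  moreover have "(6 * P\<^sup>2 + 4 * P + 1) * s\<^sup>2 = 6 * (P\<^sup>2 * s\<^sup>2) + 4 * (P * s\<^sup>2) + s\<^sup>2" by (simp add: algebra_simps)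
  ultimately show ?thesis by linarith
qed

text \<open>The condition on \<open>r\<close> makes the \<open>i\<close>-th equation
  \<open>r i\<close> times the scalar one. The first order terms of the energy then cancel, and its
  change is quadratic in \<open>H1_norm v\<close>.\<close>

lemma proportional_solution:
  fixes w :: "'a::euclidean_space \<Rightarrow> real" and r :: "'d::{finite,linorder} \<Rightarrow> real"
  assumes dim: "DIM('a) \<le> 3" and lam: "0 < lam" and sym: "\<And>i j. i \<noteq> j \<Longrightarrow> b i j = b j i"
    and w: "w \<in> H1" "\<not> (AE x in lborel. w x = 0)"
    and crit: "\<And>\<phi> :: 'a \<Rightarrow> real. \<phi> \<in> H1 \<Longrightarrow> H1_form lam w \<phi> = S * (\<integral>x. (w x) ^ 3 * \<phi> x \<partial>lborel)"
    and r: "\<And>i. (\<Sum>j\<in>UNIV. coupling \<mu> b i j * (r j)\<^sup>2) = S" "\<And>i. r i \<noteq> 0"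
  shows "(\<lambda>i x. r i * w x) \<in> nontrivial_solutions (\<lambda>_. lam) \<mu> b"
proof -
  let ?u = "\<lambda>i x. r i * w x" and ?\<beta> = "coupling \<mu> b" and ?J = "energy (\<lambda>_. lam) \<mu> b"
  have uH: "?u \<in> H1_vec" by (simp add: H1_vec_def H1_mult w)
  obtain C where C: "C > 0" and sob: "\<And>u :: 'a \<Rightarrow> real. u \<in> H1 \<Longrightarrow> L4 u \<and> (\<integral>x. (u x) ^ 4 \<partial>lborel) \<le> C * (H1_form 1 u u)\<^sup>2"
    using Sobolev_L4[OF dim, of 1] by auto
  define P where "P = (\<Sum>i\<in>UNIV. L4_norm (?u i))"
  have P: "L4_norm (?u i) \<le> P" for i unfolding P_def by (intro member_le_sum) auto
  define R where "R = 6 * P\<^sup>2 + 4 * P + 1"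
  define T where "T = (\<Sum>i\<in>UNIV. \<Sum>j\<in>UNIV. \<bar>?\<beta> i j\<bar>)"
  \<comment> \<open>\<open>1 + lam\<close> compares the form for \<open>lam\<close> with the form
    for \<open>1\<close> behind \<open>H1_norm\<close>; the other summand collects the remainders
    over all pairs, with the Sobolev constant converting fourth powers to the norm.\<close>
  define M where "M = 1/2 * (1 + lam) + 1/4 * (T * R * sqrt C)"
  have "0 \<le> P" unfolding P_def by (intro sum_nonneg) simp
  then have R: "0 \<le> R" by (simp add: R_def)
  have T: "0 \<le> T" unfolding T_def by (intro sum_nonneg) simp
  have M: "M > 0" using lam R T C by (simp add: M_def add_pos_nonneg)
  have estimate: "\<bar>?J (\<lambda>i x. ?u i x + v i x) - ?J ?u\<bar> \<le> M * (H1_norm v)\<^sup>2"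
    if v: "v \<in> H1_vec" and small: "sqrt C * (H1_norm v)\<^sup>2 \<le> 1" for v
  proof -
    have vi: "v i \<in> H1" for i using v by (simp add: H1_vec_def)
    have ui: "?u i \<in> H1" for i by (simp add: H1_mult w)
    have addH: "(\<lambda>i x. ?u i x + v i x) \<in> H1_vec" unfolding H1_vec_def mem_Collect_eq by (intro allI H1_add ui vi)
    define N2 where "N2 = (H1_norm v)\<^sup>2"
    have N2: "N2 = (\<Sum>i\<in>UNIV. H1_form 1 (v i) (v i))"
      unfolding N2_def H1_norm_eq[OF v] by (intro real_sqrt_pow2 sum_nonneg H1_form_ge_0) simp
    have E1: "H1_form 1 (v i) (v i) \<le> N2" for i
      unfolding N2 by (intro member_le_sum H1_form_ge_0) auto
    define s where "s = sqrt (sqrt C * N2)"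
    have s2: "s\<^sup>2 = sqrt C * N2" using C by (simp add: s_def N2_def)
    have s1: "s \<le> 1" using small C by (simp add: s_def N2_def)
    have s: "L4_norm (v i) \<le> s" for i
    proof -
      have "0 \<le> H1_form 1 (v i) (v i)" by (simp add: H1_form_ge_0)
      then have "(H1_form 1 (v i) (v i))\<^sup>2 \<le> N2\<^sup>2" using E1 by (intro power_mono) auto
      then have "C * (H1_form 1 (v i) (v i))\<^sup>2 \<le> C * N2\<^sup>2" using C by (intro mult_left_mono) auto
      then have "(\<integral>x. (v i x) ^ 4 \<partial>lborel) \<le> C * N2\<^sup>2" using sob[OF vi, of i] by linarith
      then have "sqrt (\<integral>x. (v i x) ^ 4 \<partial>lborel) \<le> sqrt (C * N2\<^sup>2)" by (rule real_sqrt_le_mono)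
      also have "\<dots> = sqrt C * \<bar>N2\<bar>" by (simp add: real_sqrt_mult)
      also have "\<bar>N2\<bar> = N2" by (simp add: N2_def)
      finally show ?thesis by (simp add: s_def L4_norm_def)
    qed
    note L4s = conjunct1[OF sob]
    define lin where "lin i = (\<integral>x. (w x) ^ 3 * v i x \<partial>lborel)" for i
    define D where "D i j = (\<integral>x. (?u i x + v i x)\<^sup>2 * (?u j x + v j x)\<^sup>2 \<partial>lborel) - (\<integral>x. (?u i x)\<^sup>2 * (?u j x)\<^sup>2 \<partial>lborel)
        - 2 * (r i * (r j)\<^sup>2 * lin i) - 2 * ((r i)\<^sup>2 * r j * lin j)" for i j
    have D: "\<bar>D i j\<bar> \<le> R * s\<^sup>2" for i j
    proof -
      have "(\<integral>x. ?u i x * v i x * (?u j x * ?u j x) \<partial>lborel) = r i * (r j)\<^sup>2 * lin i"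
        unfolding lin_def Bochner_Integration.integral_mult_right_zero[symmetric]
        by (intro Bochner_Integration.integral_cong refl) (simp add: power2_eq_square power3_eq_cube mult_ac)
      moreover have "(\<integral>x. ?u i x * ?u i x * (?u j x * v j x) \<partial>lborel) = (r i)\<^sup>2 * r j * lin j"
        unfolding lin_def Bochner_Integration.integral_mult_right_zero[symmetric]
        by (intro Bochner_Integration.integral_cong refl) (simp add: power2_eq_square power3_eq_cube mult_ac)
      ultimately show ?thesis
        using square_product_expansion[where p = "?u i" and q = "?u j" and a = "v i" and c = "v j",
            OF L4s[OF ui] L4s[OF ui] L4s[OF vi] L4s[OF vi] P P s s s1]
        by (simp only: D_def R_def)
    qed
    have \<beta>sym: "?\<beta> i j = ?\<beta> j i" for i j using sym by (auto simp: coupling_def)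
    \<comment> \<open>By symmetry of the coupling the two first order sums coincide, hence the
      factor \<open>4\<close>. Weighted by \<open>1/4\<close>, they cancel the first order term of
      the quadratic part of the energy.\<close>
    have quart: "quartic ?\<beta> (\<lambda>i x. ?u i x + v i x) - quartic ?\<beta> ?u
        = (\<Sum>i\<in>UNIV. \<Sum>j\<in>UNIV. ?\<beta> i j * D i j) + 4 * (\<Sum>i\<in>UNIV. S * (r i * lin i))"
    proof -
      have "quartic ?\<beta> (\<lambda>i x. ?u i x + v i x) - quartic ?\<beta> ?u
          = (\<Sum>i\<in>UNIV. \<Sum>j\<in>UNIV. ?\<beta> i j * D i j + (2 * (?\<beta> i j * (r j)\<^sup>2 * (r i * lin i)) + 2 * (?\<beta> i j * (r i)\<^sup>2 * (r j * lin j))))"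
        unfolding quartic_def sum_subtractf[symmetric] by (intro sum.cong refl) (simp add: D_def algebra_simps)
      also have "\<dots> = (\<Sum>i\<in>UNIV. \<Sum>j\<in>UNIV. ?\<beta> i j * D i j)
          + (2 * (\<Sum>i\<in>UNIV. \<Sum>j\<in>UNIV. ?\<beta> i j * (r j)\<^sup>2 * (r i * lin i))
            + 2 * (\<Sum>i\<in>UNIV. \<Sum>j\<in>UNIV. ?\<beta> i j * (r i)\<^sup>2 * (r j * lin j)))"
        by (simp only: sum.distrib sum_distrib_left)
      also have "(\<Sum>i\<in>UNIV. \<Sum>j\<in>UNIV. ?\<beta> i j * (r i)\<^sup>2 * (r j * lin j)) = (\<Sum>j\<in>UNIV. \<Sum>i\<in>UNIV. ?\<beta> j i * (r i)\<^sup>2 * (r j * lin j))"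
        by (subst sum.swap) (simp only: \<beta>sym[of _ _])
      also have "(\<Sum>i\<in>UNIV. \<Sum>j\<in>UNIV. ?\<beta> i j * (r j)\<^sup>2 * (r i * lin i)) = (\<Sum>i\<in>UNIV. S * (r i * lin i))"
        by (simp only: sum_distrib_right[symmetric] r(1))
      finally show ?thesis by simp
    qed
    have form: "H1_form lam (\<lambda>x. ?u i x + v i x) (\<lambda>x. ?u i x + v i x)
        = H1_form lam (?u i) (?u i) + 2 * (S * (r i * lin i)) + H1_form lam (v i) (v i)" for i
    proof -
      have "H1_form lam (?u i) (v i) = S * (r i * lin i)"
        using H1_form_mult_left[OF w(1) vi, of lam "r i" i] crit[OF vi, of i] by (simp add: lin_def)
      then show ?thesis
        using H1_form_commute[of lam "v i" "?u i"]
        by (simp add: H1_form_add_left[OF ui vi H1_add(1)[OF ui vi]] H1_form_add_right[OF ui vi ui] H1_form_add_right[OF ui vi vi])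
    qed
    have J: "?J u' = 1/2 * (\<Sum>i\<in>UNIV. H1_form lam (u' i) (u' i)) - 1/4 * quartic ?\<beta> u'" if "u' \<in> H1_vec" for u' :: "'d \<Rightarrow> 'a \<Rightarrow> real"
      by (rule energy_eq[OF that sym])
    have "?J (\<lambda>i x. ?u i x + v i x) - ?J ?u = 1/2 * (\<Sum>i\<in>UNIV. H1_form lam (v i) (v i)) - 1/4 * (\<Sum>i\<in>UNIV. \<Sum>j\<in>UNIV. ?\<beta> i j * D i j)"
    proof -
      have "1/2 * (e + 2 * s + f) - 1/4 * q1 - (1/2 * e - 1/4 * q2) = 1/2 * f - 1/4 * d" if "q1 - q2 = d + 4 * s" for e s f q1 q2 d :: real
        using that by (simp add: field_simps)
      from this[OF quart] show ?thesis
        unfolding J[OF addH] J[OF uH] form sum.distrib sum_distrib_left[of 2, symmetric] .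
    qed
    moreover have "0 \<le> (\<Sum>i\<in>UNIV. H1_form lam (v i) (v i))" using lam by (intro sum_nonneg H1_form_ge_0) simp
    moreover have "(\<Sum>i\<in>UNIV. H1_form lam (v i) (v i)) \<le> (1 + lam) * N2"
      unfolding N2 sum_distrib_left
    proof (rule sum_mono)
      fix i
      have "0 \<le> lam * L2_inner (grad (v i)) (grad (v i))" using lam by simp
      then show "H1_form lam (v i) (v i) \<le> (1 + lam) * H1_form 1 (v i) (v i)"
        using L2_inner_ge_0[of "v i"] by (simp add: H1_form_def algebra_simps)
    qed
    moreover have "\<bar>\<Sum>i\<in>UNIV. \<Sum>j\<in>UNIV. ?\<beta> i j * D i j\<bar> \<le> T * R * sqrt C * N2"
    proof -
      have "\<bar>\<Sum>i\<in>UNIV. \<Sum>j\<in>UNIV. ?\<beta> i j * D i j\<bar> \<le> (\<Sum>i\<in>UNIV. \<Sum>j\<in>UNIV. \<bar>?\<beta> i j * D i j\<bar>)"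
        by (intro order_trans[OF sum_abs] sum_mono sum_abs)
      also have "\<dots> \<le> (\<Sum>i\<in>UNIV. \<Sum>j\<in>UNIV. \<bar>?\<beta> i j\<bar> * (R * s\<^sup>2))"
        unfolding abs_mult by (intro sum_mono mult_left_mono D) simp
      also have "\<dots> = T * R * sqrt C * N2" by (simp add: T_def s2 sum_distrib_right mult.assoc)
      finally show ?thesis .
    qed
    moreover have "M * N2 = 1/2 * ((1 + lam) * N2) + 1/4 * (T * R * sqrt C * N2)" by (simp add: M_def algebra_simps)
    ultimately show ?thesis unfolding N2_def[symmetric] by linarith
  qed
  have "has_H1_derivative ?J (\<lambda>_. 0) ?u"
    unfolding has_H1_derivative_def
  proof (intro conjI allI impI)
    fix \<epsilon> :: real assume \<epsilon>: "\<epsilon> > 0"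
    \<comment> \<open>The second bound puts \<open>v\<close> in the range of
      \<open>estimate\<close>; the first turns the quadratic bound into one by
      \<open>\<epsilon> * H1_norm v\<close>.\<close>
    define \<delta> where "\<delta> = min (\<epsilon> / M) (1 / sqrt (sqrt C))"
    have \<delta>: "\<delta> > 0" using \<epsilon> M C by (simp add: \<delta>_def)
    have "\<bar>?J (\<lambda>i x. ?u i x + v i x) - ?J ?u - 0\<bar> \<le> \<epsilon> * H1_norm v" if v: "v \<in> H1_vec" "H1_norm v < \<delta>" for v
    proof -
      have n: "0 \<le> H1_norm v" unfolding H1_norm_def by (intro real_sqrt_ge_zero sum_nonneg integral_nonneg_AE) auto
      have "(H1_norm v)\<^sup>2 \<le> (1 / sqrt (sqrt C))\<^sup>2" using v(2) n by (intro power_mono) (auto simp: \<delta>_def)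
      also have "\<dots> = 1 / sqrt C" using C by (simp add: power_divide)
      finally have small: "sqrt C * (H1_norm v)\<^sup>2 \<le> 1" using C by (simp add: field_simps)
      have "M * H1_norm v \<le> \<epsilon>" using v(2) M by (simp add: \<delta>_def pos_less_divide_eq mult.commute less_imp_le)
      then have "M * H1_norm v * H1_norm v \<le> \<epsilon> * H1_norm v" using n by (rule mult_right_mono)
      then show ?thesis using estimate[OF v(1) small] by (simp add: power2_eq_square mult.assoc)
    qed
    then show "\<exists>\<delta>>0. \<forall>v\<in>H1_vec. H1_norm v < \<delta> \<longrightarrow> \<bar>?J (\<lambda>i x. ?u i x + v i x) - ?J ?u - 0\<bar> \<le> \<epsilon> * H1_norm v"
      using \<delta> by blast
  next
    show "\<exists>K. \<forall>v\<in>H1_vec. \<bar>0\<bar> \<le> K * H1_norm (v :: 'd \<Rightarrow> 'a \<Rightarrow> real)" by (intro exI[of _ 0]) simp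
  qed auto
  moreover have "\<not> (\<forall>i. AE x in lborel. ?u i x = 0)" using r(2) w(2) by simp
  ultimately show ?thesis using uH by (simp add: nontrivial_solutions_def)
qed

section \<open>Comparison of levels\<close>

theorem ground_states_fully_nontrivial:
  fixes \<mu> :: "'d::{finite,linorder} \<Rightarrow> real" and u :: "'d \<Rightarrow> 'a::euclidean_space \<Rightarrow> real"
  assumes dim: "DIM('a) \<le> 3" and lam: "lam > 0"
    and sym: "\<And>i j. i \<noteq> j \<Longrightarrow> b i j = b j i"
    and pos: "\<And>i j. coupling \<mu> b i j > 0"
    and diag: "\<And>i p. i \<noteq> p \<Longrightarrow> \<alpha> \<le> b i p - \<mu> p"
    and off: "\<And>i j p. i \<noteq> j \<Longrightarrow> j \<noteq> p \<Longrightarrow> i \<noteq> p \<Longrightarrow> \<bar>b j i - b j p\<bar> \<le> \<delta>"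
    and \<delta>: "0 \<le> \<delta>" "\<delta> * (real CARD('d) - 2) < \<alpha>"
    and u: "u \<in> ground_states (\<lambda>_. lam) \<mu> b"
  shows "\<not> (AE x in lborel. u i x = 0)"
proof -
  let ?\<beta> = "coupling \<mu> b" and ?J = "energy (\<lambda>_. lam) \<mu> b :: ('d \<Rightarrow> 'a \<Rightarrow> real) \<Rightarrow> real"
  let ?Sol = "nontrivial_solutions (\<lambda>_. lam) \<mu> b :: ('d \<Rightarrow> 'a \<Rightarrow> real) set"
  have \<beta>sym: "?\<beta> i j = ?\<beta> j i" for i j using sym by (auto simp: coupling_def)
  obtain M y where M: "M > 0" and y: "\<And>i. y i > 0" "(\<Sum>i\<in>UNIV. y i) = 1" "\<And>i. (\<Sum>j\<in>UNIV. ?\<beta> i j * y j) = M"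
    and quad_le: "\<And>z. (\<And>i. 0 \<le> z i) \<Longrightarrow> quad_form ?\<beta> z \<le> M * (\<Sum>i\<in>UNIV. z i)\<^sup>2"
    and quad_max: "\<And>z i. (\<And>i. 0 \<le> z i) \<Longrightarrow> 0 < (\<Sum>i\<in>UNIV. z i) \<Longrightarrow> M * (\<Sum>i\<in>UNIV. z i)\<^sup>2 \<le> quad_form ?\<beta> z \<Longrightarrow> 0 < z i"
  proof (rule simplex_quadratic_form[of ?\<beta> \<alpha> \<delta>])
    show "\<alpha> \<le> ?\<beta> i p - ?\<beta> p p" if "i \<noteq> p" for i p using diag[OF that] that by (simp add: coupling_def)
    show "\<bar>?\<beta> j i - ?\<beta> j p\<bar> \<le> \<delta>" if "i \<noteq> j" "j \<noteq> p" "i \<noteq> p" for i j p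
      using off[OF that] that by (auto simp: coupling_def)
  qed (use \<beta>sym pos \<delta> in auto)
  have uS: "u \<in> ?Sol" and level: "?J u = ground_level TYPE('a) (\<lambda>_. lam) \<mu> b"
    using u by (auto simp: ground_states_def)
  have ui: "u i \<in> H1" for i using uS by (simp add: nontrivial_solutions_def H1_vec_def)
  \<comment> \<open>This component is the nonzero function that starts the scalar problem.\<close>
  obtain i0 where i0: "\<not> (AE x in lborel. u i0 x = 0)" using uS by (auto simp: nontrivial_solutions_def)
  obtain S w where S: "S > 0"
    and inf: "\<And>u :: 'a \<Rightarrow> real. u \<in> H1 \<Longrightarrow> S * sqrt (\<integral>x. (u x) ^ 4 \<partial>lborel) \<le> H1_form lam u u"
    and w: "w \<in> H1" "\<not> (AE x in lborel. w x = 0)" "H1_form lam w w \<le> S"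
    and crit: "\<And>\<phi> :: 'a \<Rightarrow> real. \<phi> \<in> H1 \<Longrightarrow> H1_form lam w \<phi> = S * (\<integral>x. (w x) ^ 3 * \<phi> x \<partial>lborel)"
    using scalar_ground_state[OF dim lam ui i0] by blast
  \<comment> \<open>Scaled so that the row sums against the squares of \<open>r\<close> become
    \<open>S\<close>, as \<open>proportional_solution\<close> asks; one scaling works for all rows
    since their sums against \<open>y\<close> all equal \<open>M\<close>.\<close>
  define r where "r i = sqrt (S / M * y i)" for i
  have r2: "(r i)\<^sup>2 = S / M * y i" for i using S M y(1)[of i] by (simp add: r_def)
  have sol: "(\<lambda>i x. r i * w x) \<in> ?Sol"
  proof (rule proportional_solution[OF dim lam sym w(1,2) crit])
    have "(\<Sum>j\<in>UNIV. ?\<beta> i j * (r j)\<^sup>2) = S / M * (\<Sum>j\<in>UNIV. ?\<beta> i j * y j)" for i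
      by (simp add: r2 sum_distrib_left mult_ac)
    then show "(\<Sum>j\<in>UNIV. ?\<beta> i j * (r j)\<^sup>2) = S" for i using M by (simp add: y(3))
    show "r i \<noteq> 0" for i using S M y(1)[of i] by (simp add: r_def)
  qed auto
  \<comment> \<open>The Nehari identity makes the energy of every solution nonnegative, so the
    infimum defining the level is a true lower bound.\<close>
  have bdd: "bdd_below (?J ` ?Sol)"
    by (rule bdd_belowI[of _ 0]) (use lam in \<open>auto simp: nontrivial_solution_Nehari(2)[OF _ sym] intro!: sum_nonneg H1_form_ge_0\<close>)
  define A where "A = (\<Sum>i\<in>UNIV. H1_form lam (u i) (u i))"
  have "1/4 * A = ?J u" unfolding A_def by (rule nontrivial_solution_Nehari(2)[OF uS sym, symmetric])
  also have "\<dots> \<le> ?J (\<lambda>i x. r i * w x)" unfolding level ground_level_def by (rule cINF_lower[OF bdd sol])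
  also have "\<dots> = 1/4 * (\<Sum>i\<in>UNIV. H1_form lam (\<lambda>x. r i * w x) (\<lambda>x. r i * w x))"
    by (rule nontrivial_solution_Nehari(2)[OF sol sym])
  also have "(\<Sum>i\<in>UNIV. H1_form lam (\<lambda>x. r i * w x) (\<lambda>x. r i * w x)) = (\<Sum>i\<in>UNIV. (r i)\<^sup>2) * H1_form lam w w"
    by (simp only: H1_form_mult_left H1_form_mult_right H1_mult w power2_eq_square mult.assoc sum_distrib_right)
  also have "(\<Sum>i\<in>UNIV. (r i)\<^sup>2) = S / M * (\<Sum>i\<in>UNIV. y i)" by (simp only: r2 sum_distrib_left)
  also have "\<dots> = S / M" by (simp add: y(2))
  also have "S / M * H1_form lam w w \<le> S / M * S" using w(3) S M by (intro mult_left_mono) auto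
  finally have A_le: "A \<le> S / M * S" by simp
  define z where "z i = sqrt (\<integral>x. (u i x) ^ 4 \<partial>lborel)" for i
  have z0: "0 \<le> z i" for i unfolding z_def by (intro real_sqrt_ge_zero integral_nonneg_AE) simp
  define Y where "Y = (\<Sum>i\<in>UNIV. z i)"
  obtain C where sob: "\<And>u :: 'a \<Rightarrow> real. u \<in> H1 \<Longrightarrow> L4 u \<and> (\<integral>x. (u x) ^ 4 \<partial>lborel) \<le> C * (H1_form lam u u)\<^sup>2"
    using Sobolev_L4[OF dim lam] by blast
  have z_AE: "z i = 0 \<longleftrightarrow> (AE x in lborel. u i x = 0)" for i
  proof -
    have "integrable lborel (\<lambda>x. (u i x) ^ 4)" using sob[OF ui] by (simp add: L4_def)
    then show ?thesis unfolding z_def by (simp add: integral_nonneg_eq_0_iff_AE)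
  qed
  have "z i0 > 0" using z_AE[of i0] i0 z0[of i0] by linarith
  moreover have "z i0 \<le> Y" unfolding Y_def by (intro member_le_sum z0) auto
  ultimately have Y: "Y > 0" by simp
  have SY: "S * Y \<le> A" unfolding Y_def A_def sum_distrib_left z_def by (intro sum_mono inf ui)
  have "A = quartic ?\<beta> u" unfolding A_def by (rule nontrivial_solution_Nehari(1)[OF uS sym])
  also have "\<dots> \<le> quad_form ?\<beta> z"
    unfolding quartic_def quad_form_def
  proof (intro sum_mono mult_left_mono)
    fix i j
    note L = conjunct1[OF sob[OF ui]]
    have "(L4_norm (u k))\<^sup>2 = z k" for k by (simp add: L4_norm_def z_def)
    then show "(\<integral>x. (u i x)\<^sup>2 * (u j x)\<^sup>2 \<partial>lborel) \<le> z i * z j"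
      using L4_Hoelder(2)[OF L L L L, of i i j j] by (simp add: power2_eq_square)
    show "0 \<le> ?\<beta> i j" using pos less_imp_le by blast
  qed
  finally have A_quad: "A \<le> quad_form ?\<beta> z" .
  \<comment> \<open>The upper bound on \<open>A\<close> limits \<open>Y\<close>; feeding
    \<open>M * Y \<le> S\<close> back into the lower bound \<open>S * Y \<le> A\<close> puts
    \<open>z\<close> into the equality case of the quadratic form.\<close>
  have "S * Y \<le> S * (S / M)" using SY A_le by (simp add: mult.commute)
  then have "Y \<le> S / M" using S by (rule mult_left_le_imp_le)
  then have "M * Y \<le> S" using M by (simp add: pos_le_divide_eq mult.commute)
  then have "M * Y * Y \<le> S * Y" using Y by (intro mult_right_mono) auto
  then have "M * Y\<^sup>2 \<le> quad_form ?\<beta> z" using SY A_quad by (simp add: power2_eq_square mult.assoc)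
  then have "0 < z i" using quad_max[of z i] z0 Y unfolding Y_def by blast
  then show ?thesis using z_AE[of i] by simp
qed

theorem theorem1p6:
  fixes lam \<alpha> :: real
    and \<mu> :: "'d::{finite,linorder} \<Rightarrow> real"
    and b :: "'d \<Rightarrow> 'd \<Rightarrow> real"
  assumes "CARD('n::finite) \<in> {1, 2, 3}"
    and "CARD('d) \<ge> 3"
    and "lam > 0"
    and "\<And>i. \<mu> i > 0"
    and "\<And>i j. i \<noteq> j \<Longrightarrow> b i j = b j i"
    and "\<And>i j. i \<noteq> j \<Longrightarrow> b i j > 0"
    and "\<alpha> = (MIN i. (MIN j\<in>{j. j \<noteq> i}. b i j) - \<mu> i)"
    and "\<alpha> > 0"
    and "Max {\<bar>b i j - b i k\<bar> | i j k. j \<noteq> i \<and> k \<noteq> i \<and> k \<noteq> j} < \<alpha> / (real CARD('d) - 2)"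
  shows "(ground_states (\<lambda>_. lam) \<mu> b :: ('d \<Rightarrow> real ^ 'n \<Rightarrow> real) set)
       = fully_nontrivial_ground_states (\<lambda>_. lam) \<mu> b"
proof -
  let ?D = "{\<bar>b i j - b i k\<bar> | i j k. j \<noteq> i \<and> k \<noteq> i \<and> k \<noteq> j}"
  \<comment> \<open>\<open>max 0\<close> supplies the nonnegativity asked of \<delta>; the strict
    bound persists because \<alpha> and the divisor are positive.\<close>
  define \<delta> where "\<delta> = max 0 (Max ?D)"
  have fin: "finite ?D"
  proof (rule finite_subset)
    show "?D \<subseteq> range (\<lambda>p. \<bar>b (fst p) (fst (snd p)) - b (fst p) (snd (snd p))\<bar>)"
      by (force intro: range_eqI[of _ _ "(i, j, k)" for i j k])
  qed simp
  have diag: "\<alpha> \<le> b i p - \<mu> p" if "i \<noteq> p" for i p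
  proof -
    have "\<alpha> \<le> (MIN j\<in>{j. j \<noteq> p}. b p j) - \<mu> p" unfolding assms(7) by (intro Min_le) auto
    also have "(MIN j\<in>{j. j \<noteq> p}. b p j) \<le> b p i" using that by (intro Min_le) auto
    finally show ?thesis using assms(5)[OF that] by simp
  qed
  have off: "\<bar>b j i - b j p\<bar> \<le> \<delta>" if "i \<noteq> j" "j \<noteq> p" "i \<noteq> p" for i j p
  proof -
    have "\<bar>b j i - b j p\<bar> \<le> Max ?D" by (rule Max_ge[OF fin]) (use that in blast)
    then show ?thesis by (simp add: \<delta>_def)
  qed
  have "\<delta> < \<alpha> / (real CARD('d) - 2)" using assms(2,8,9) by (simp add: \<delta>_def)
  then have \<delta>: "\<delta> * (real CARD('d) - 2) < \<alpha>"
    using assms(2) by (simp add: pos_less_divide_eq)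
  have \<delta>0: "0 \<le> \<delta>" by (simp add: \<delta>_def)
  have dim: "DIM(real ^ 'n) \<le> 3" using assms(1) by auto
  have pos: "coupling \<mu> b i j > 0" for i j using assms(4,6) by (simp add: coupling_def)
  have "\<not> (AE x in lborel. u i x = 0)" if "u \<in> ground_states (\<lambda>_. lam) \<mu> b" for u :: "'d \<Rightarrow> real ^ 'n \<Rightarrow> real" and i
    by (rule ground_states_fully_nontrivial[OF dim assms(3,5) pos diag off \<delta>0 \<delta> that])
  then show ?thesis by (auto simp: fully_nontrivial_ground_states_def)
qed

end
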